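(* For every integer $m\ge 0$ there is a constant $C_m$ such that for all integers $j\ge1$, \[ \alpha_j=\frac{j!\,2^{j}}{2j^2}\bigl(1+E_j\bigr),\qquad |E_j|\le C_m\, j^{-m}. \] Moreover, assuming the Riemann hypothesis, one has \[ \alpha_j=\frac{j!\,2^{j}}{2j^2}\Bigl(1+\bigl(\tfrac{2}{3}+o(1)\bigr)\bigl(\tfrac34\bigr)^{j}\Bigr)\qquad (j\to\infty). \]
   Context: Here $p$ runs over primes and for each integer $j\ge1$ the constant $\alpha_j$ is defined by \[ \alpha_j=\lim_{x\to\infty}\frac1j\Bigl(\frac{(\log x)^j}{j}-\sum_{p\le x}\frac{(\log p)^j}{p}\Bigr) \] (the limit exists). *)

theory Defs
  imports
    "HOL-Complex_Analysis.Complex_Analysis"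
    "HOL-Computational_Algebra.Primes"
begin

definition alpha :: "nat \<Rightarrow> real" where
  "alpha j = Lim at_top (\<lambda>x::real.
     (1 / real j) * (ln x ^ j / real j - (\<Sum>p | prime (p::nat) \<and> real p \<le> x. ln (real p) ^ j / real p)))"

text \<open>
  The Riemann zeta function is the analytic continuation of \<open>\<Sum>n\<ge>1. n\<^bsup>-s\<^esup>\<close> from the half-plane
  \<open>Re s > 1\<close> to the complex plane without \<open>1\<close>. By the identity theorem the choice below is unique
  except for the value at the pole \<open>1\<close>, which is unspecified.
\<close>

definition zeta :: "complex \<Rightarrow> complex" where
  "zeta = (SOME f. f holomorphic_on (- {1}) \<and>
     (\<forall>s. Re s > 1 \<longrightarrow> (\<lambda>n. of_nat (Suc n) powr (- s)) sums f s))"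

text \<open>The trivial zeros of zeta are the negative even integers.\<close>

definition riemann_hypothesis :: bool where
  "riemann_hypothesis \<longleftrightarrow>
     (\<forall>s. s \<noteq> 1 \<and> zeta s = 0 \<and> \<not> (\<exists>n::nat. n \<ge> 1 \<and> s = - of_nat (2 * n)) \<longrightarrow> Re s = 1 / 2)"

end

theory Submission
  imports Defs
begin

text \<open>
  Let \<open>F(s) = \<Sum> log p / p\<^sup>s\<close>, summed over the primes. By Abel summation \<open>-j \<alpha>\<^sub>j\<close> is, up to the sign
  \<open>(-1)\<^bsup>j-1\<^esup>\<close>, the derivative of order \<open>j - 1\<close> of \<open>F(s) - 1/(s-1)\<close> at \<open>s = 1\<close>. With \<open>Z = -\<zeta>'/\<zeta>\<close> one has
  \<open>F(s) = Z(s) - Z(2s) - Z(3s) + H(s)\<close>, where \<open>H\<close> is holomorphic for \<open>Re s > 1/5\<close>. Since \<open>(s-1)\<zeta>(s)\<close> has no zeros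
  near \<open>1\<close>, the only singularities of \<open>F(s) - 1/(s-1)\<close> in \<open>|s-1| < 7/10\<close> are the poles of \<open>-1/(2s-1)\<close> and
  \<open>-1/(3s-1)\<close>; these give the main term and the term \<open>(2/3)(3/4)\<^sup>j\<close>, and the rest is exponentially smaller.

  The limits exist because \<open>\<theta>(x) - x = O(x / (log x)\<^sup>A)\<close> for every \<open>A\<close>. This follows from Newman's contour argument
  with a contour whose size grows with \<open>x\<close>, using that for every \<open>\<epsilon> > 0\<close> the zeta function has no zeros with
  \<open>Re s \<ge> 1 - c |Im s|\<^bsup>-\<epsilon>\<^esup>\<close>, which the inequality \<open>3 + 4 cos x + cos 2x \<ge> 0\<close> yields.
\<close>

section \<open>The function \<open>(s - 1) \<zeta>(s)\<close>\<close>

text \<open>The point \<open>s = 1\<close> lies on the boundary of convergence, so the derivatives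
  there cannot be taken termwise. They are recovered from inside: as \<open>x\<close> decreases to
  0, \<open>F(1 + x) - 1/x\<close> has one expansion whose coefficients are the limits of the
  moments and one coming from the Taylor series of its holomorphic part. One-sided expansions are
  unique, so the coefficients agree. The first expansion needs every moment to converge, hence an
  error term smaller than every power of \<open>t = log x\<close>. In Newman's argument the height
  \<open>R\<close> of the contour is therefore an arbitrary power of \<open>t\<close>, while its
  left side at distance \<open>d\<close> must still satisfy \<open>exp(- d t) = o(R^(-A))\<close>
  for all \<open>A\<close>. A width \<open>d\<close> of order \<open>R^(-e)\<close> allows this only
  if \<open>e\<close> can be taken small depending on the power, which is why the zero-free region
  has an arbitrary exponent. The radius 7/10 lies between 2/3, the distance from 1 to the pole of
  \<open>1/(3s-1)\<close>, and \<open>1/sqrt 2\<close>, below which an elementary estimate excludes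
  zeros of \<open>xi\<close> at \<open>s\<close>, \<open>2s\<close> and \<open>3s\<close>.\<close>

definition dpow :: "real \<Rightarrow> complex \<Rightarrow> complex" where
  "dpow x s = exp (- (s * of_real (ln x)))"

lemma norm_dpow: "x > 0 \<Longrightarrow> norm (dpow x s) = x powr (- Re s)"
  by (simp add: dpow_def powr_def)

lemma dpow_add: "dpow x (s + w) = dpow x s * dpow x w"
  by (simp add: dpow_def exp_add[symmetric] algebra_simps)

lemma dpow_mult: "x > 0 \<Longrightarrow> y > 0 \<Longrightarrow> dpow (x * y) s = dpow x s * dpow y s"
  by (simp add: dpow_def exp_add[symmetric] ln_mult algebra_simps)

lemma dpow_simps [simp]: "dpow 1 s = 1" "dpow x s \<noteq> 0" "dpow x 0 = 1"
  by (auto simp: dpow_def)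

lemma dpow_minus_one: "x > 0 \<Longrightarrow> dpow x (- 1) = of_real x"
  by (simp add: dpow_def exp_of_real)

lemma dpow_diff_one: "x > 0 \<Longrightarrow> dpow x (s - 1) = of_real x * dpow x s"
  using dpow_add[of x s "- 1"] dpow_minus_one[of x] by (simp add: mult.commute)

lemma dpow_power: "dpow x s ^ k = dpow x (of_nat k * s)"
  by (simp add: dpow_def exp_of_nat_mult[symmetric] algebra_simps)

lemma holomorphic_dpow [holomorphic_intros]:
  "f holomorphic_on A \<Longrightarrow> (\<lambda>s. dpow x (f s)) holomorphic_on A"
  unfolding dpow_def by (intro holomorphic_intros)

lemma dpow_has_vector_derivative:
  assumes "x > 0"
  shows "((\<lambda>x. dpow x s) has_vector_derivative (- s * dpow x (s + 1))) (at x within A)"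
proof -
  have "((\<lambda>x. - (s * of_real (ln x))) has_vector_derivative (- (s * of_real (1 / x)))) (at x within A)"
    using assms
    by (intro derivative_intros has_vector_derivative_of_real)
       (auto intro!: derivative_eq_intros simp: has_real_derivative_iff_has_vector_derivative[symmetric])
  from field_vector_diff_chain_within[OF this DERIV_subset[OF DERIV_exp]]
  have "((\<lambda>x. exp (- (s * of_real (ln x)))) has_vector_derivative
      (- (s * of_real (1 / x)) * exp (- (s * of_real (ln x))))) (at x within A)"
    by (simp add: o_def)
  moreover have "dpow x (s + 1) = dpow x s / of_real x"
    using dpow_diff_one[of x "s + 1"] assms by (simp add: field_simps)
  ultimately show ?thesis
    by (simp add: dpow_def field_simps)
qed

text \<open>This is \<open>s - 1\<close> times the error of the trapezoidal rule for the integral of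
  \<open>x^(-s)\<close> over \<open>[n, n + 1]\<close>. The factor \<open>s - 1\<close> clears the
  denominator of that integral, so \<open>s = 1\<close> is not exceptional.\<close>

definition trapezoid_error :: "nat \<Rightarrow> complex \<Rightarrow> complex" where
  "trapezoid_error n s = (s - 1) * (dpow (real n) s + dpow (real n + 1) s) / 2
     - dpow (real n) (s - 1) + dpow (real n + 1) (s - 1)"

lemma powr_has_integral:
  fixes a :: real
  assumes "0 < u" "u \<le> v" "a > 0"
  shows "((\<lambda>x. x powr (- a - 1)) has_integral (u powr - a - v powr - a) / a) {u..v}"
proof -
  have "((\<lambda>x. x powr (- a - 1)) has_integral (- (v powr - a) / a - (- (u powr - a) / a))) {u..v}"
  proof (intro fundamental_theorem_of_calculus)
    fix x assume "x \<in> {u..v}"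
    then have "x > 0" using assms by auto
    have "((\<lambda>x. - (x powr - a) / a) has_real_derivative (x powr (- a - 1))) (at x within {u..v})"
      using assms \<open>x > 0\<close> by (auto intro!: derivative_eq_intros simp: field_simps powr_diff)
    then show "((\<lambda>x. - (x powr - a) / a) has_vector_derivative (x powr (- a - 1))) (at x within {u..v})"
      by (simp add: has_real_derivative_iff_has_vector_derivative)
  qed (use assms in auto)
  then show ?thesis using assms by (simp add: field_simps)
qed

abbreviation trapezoid_const :: "complex \<Rightarrow> real" where
  "trapezoid_const s \<equiv> norm (s - 1) * norm s * norm (s + 1) / (8 * (Re s + 1))"

text \<open>The error is an integral of the second derivative of \<open>x^(-s)\<close> against a
  quadratic with maximum 1/8. The bound is kept as a difference in \<open>n\<close> so that it
  telescopes under summation.\<close>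

lemma norm_trapezoid_error:
  assumes n: "n > 0" and s: "Re s > -1"
  shows "norm (trapezoid_error n s) \<le> trapezoid_const s *
     (real n powr (- Re s - 1) - real (Suc n) powr (- Re s - 1))"
proof -
  define B where "B = (\<lambda>x. of_real ((x - real n) * (real n + 1 - x) / 2) :: complex)"
  define B' where "B' = (\<lambda>x. of_real (real n + 1 / 2 - x) :: complex)"
  define c where "c = (s - 1) * s * (s + 1)"
  \<comment> \<open>Two integrations by parts against the Bernoulli polynomial \<open>B\<close>.\<close>
  define H where "H = (\<lambda>x. - (s - 1) * s * B x * dpow x (s + 1) - (s - 1) * B' x * dpow x s + dpow x (s - 1))"
  have "((\<lambda>x. c * B x * dpow x (s + 2)) has_integral (H (real n + 1) - H (real n))) {real n..real n + 1}"
  proof (intro fundamental_theorem_of_calculus)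
    fix x assume x: "x \<in> {real n..real n + 1}"
    then have "x > 0" using n by auto
    have [derivative_intros]: "(B has_vector_derivative B' x) (at x within {real n..real n + 1})"
      unfolding B_def B'_def
      by (rule has_vector_derivative_of_real)
         (auto intro!: derivative_eq_intros simp: has_real_derivative_iff_has_vector_derivative[symmetric] field_simps)
    have [derivative_intros]: "(B' has_vector_derivative - 1) (at x within {real n..real n + 1})"
      unfolding B'_def
      by (rule has_vector_derivative_eq_rhs[OF has_vector_derivative_of_real[where D = "-1"]])
         (auto intro!: derivative_eq_intros simp: has_real_derivative_iff_has_vector_derivative[symmetric])
    note d = dpow_has_vector_derivative[OF \<open>x > 0\<close>]
    show "(H has_vector_derivative c * B x * dpow x (s + 2)) (at x within {real n..real n + 1})"
      unfolding H_def
      by (rule has_vector_derivative_eq_rhs, (rule derivative_intros d)+)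
         (simp add: c_def algebra_simps)
  qed auto
  moreover have "H (real n + 1) - H (real n) = trapezoid_error n s"
    unfolding H_def B_def B'_def trapezoid_error_def by (simp add: field_simps)
  ultimately have I: "((\<lambda>x. c * B x * dpow x (s + 2)) has_integral trapezoid_error n s) {real n..real n + 1}"
    by simp
  have J: "((\<lambda>x. norm c / 8 * x powr (- (Re s + 1) - 1)) has_integral
      (norm c / 8 * ((real n powr - (Re s + 1) - (real n + 1) powr - (Re s + 1)) / (Re s + 1)))) {real n..real n + 1}"
    using s n by (intro has_integral_mult_right powr_has_integral) auto
  have "norm (trapezoid_error n s) \<le> norm c / 8 * ((real n powr - (Re s + 1) - (real n + 1) powr - (Re s + 1)) / (Re s + 1))"
    unfolding integral_unique[OF I, symmetric] integral_unique[OF J, symmetric]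
  proof (rule integral_norm_bound_integral)
    show "(\<lambda>x. c * B x * dpow x (s + 2)) integrable_on {real n..real n + 1}" using I by blast
    show "(\<lambda>x. norm c / 8 * x powr (- (Re s + 1) - 1)) integrable_on {real n..real n + 1}" using J by blast
    fix x assume x: "x \<in> {real n..real n + 1}"
    then have "x > 0" using n by auto
    have "norm (B x) = (x - real n) * (real n + 1 - x) / 2"
      unfolding B_def norm_of_real using x by (auto simp: abs_mult)
    also have "\<dots> = 1 / 8 - (x - real n - 1 / 2) ^ 2 / 2" by (simp add: power2_eq_square field_simps)
    also have "\<dots> \<le> 1 / 8" by simp
    finally have "norm (B x) \<le> 1 / 8" .
    then have "norm c * norm (B x) * x powr (- (Re s + 1) - 1) \<le> norm c * (1 / 8) * x powr (- (Re s + 1) - 1)"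
      by (intro mult_right_mono mult_left_mono) auto
    moreover have "- (Re s + 1) - 1 = - Re (s + 2)" by simp
    ultimately show "norm (c * B x * dpow x (s + 2)) \<le> norm c / 8 * x powr (- (Re s + 1) - 1)"
      using \<open>x > 0\<close> by (simp only: norm_mult norm_dpow)
  qed
  also have "\<dots> = trapezoid_const s *
     (real n powr (- Re s - 1) - real (Suc n) powr (- Re s - 1))"
    by (simp add: c_def norm_mult add.commute minus_diff_commute)
  finally show ?thesis .
qed

text \<open>\<open>xi s\<close> is \<open>(s - 1) \<zeta>(s)\<close> for \<open>Re s > -1\<close>; the factor \<open>s - 1\<close> removes the pole.\<close>

definition xi :: "complex \<Rightarrow> complex" where
  "xi s = (s + 1) / 2 + (\<Sum>n. trapezoid_error (Suc n) s)"

text \<open>The Euler-Maclaurin approximation to \<open>(s - 1)\<close> times zeta with cut-off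
  \<open>N\<close>: half of the last term is removed and \<open>N^(1-s)\<close> accounts for the
  integral over the tail.\<close>

definition xi_approx :: "nat \<Rightarrow> complex \<Rightarrow> complex" where
  "xi_approx N s = (s - 1) * ((\<Sum>n=1..N. dpow (real n) s) - dpow (real N) s / 2) + dpow (real N) (s - 1)"

text \<open>Raising the cut-off by one adds exactly one trapezoidal error; the starting value
  \<open>(s + 1) / 2\<close> is \<open>xi_approx 1 s\<close>.\<close>

lemma xi_approx_eq_sum: "xi_approx (Suc M) s = (s + 1) / 2 + (\<Sum>n<M. trapezoid_error (Suc n) s)"
proof (induction M)
  case 0
  then show ?case by (simp add: xi_approx_def field_simps)
next
  case (Suc M)
  have "xi_approx (Suc (Suc M)) s - xi_approx (Suc M) s = trapezoid_error (Suc M) s"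
    unfolding xi_approx_def trapezoid_error_def by (simp add: field_simps)
  then show ?case using Suc by (simp add: algebra_simps)
qed

lemma tendsto_nat_powr_neg: "a > 0 \<Longrightarrow> (\<lambda>n. real (Suc (n + M)) powr (- a)) \<longlonglongrightarrow> 0"
  by (rule tendsto_neg_powr, simp, rule filterlim_compose[OF filterlim_real_sequentially])
     (auto intro!: filterlim_at_top_mono[OF filterlim_ident] always_eventually)

lemma xi_approx_error:
  assumes s: "Re s > -1"
  shows "norm (xi s - xi_approx (Suc M) s) \<le>
    trapezoid_const s * real (Suc M) powr (- Re s - 1)"
proof -
  define c where "c = trapezoid_const s"
  define a where "a = (\<lambda>n. c * real (Suc (n + M)) powr (- Re s - 1))"
  have "a \<longlonglongrightarrow> 0"
    unfolding a_def using tendsto_mult_left[OF tendsto_nat_powr_neg[of "Re s + 1" M], of c] s by simp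
  then have sums: "(\<lambda>n. a n - a (Suc n)) sums (a 0)"
    using telescope_sums'[of a 0] by simp
  have le: "norm (trapezoid_error (Suc (n + M)) s) \<le> a n - a (Suc n)" for n
    using norm_trapezoid_error[of "Suc (n + M)" s] s unfolding a_def c_def by (simp add: algebra_simps)
  have summ: "summable (\<lambda>n. trapezoid_error (Suc (n + M)) s)"
    by (rule summable_comparison_test'[OF sums_summable[OF sums] le])
  then have summ0: "summable (\<lambda>n. trapezoid_error (Suc n) s)"
    using summable_iff_shift[of "\<lambda>n. trapezoid_error (Suc n) s" M] by simp
  have "xi s - xi_approx (Suc M) s = (\<Sum>n. trapezoid_error (Suc (n + M)) s)"
    using suminf_split_initial_segment[OF summ0, of M] by (simp add: xi_def xi_approx_eq_sum)
  also have "norm \<dots> \<le> (\<Sum>n. a n - a (Suc n))"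
    using le sums_summable[OF sums] by (intro norm_suminf_le)
  also have "\<dots> = a 0" using sums by (simp add: sums_iff)
  finally show ?thesis by (simp add: a_def c_def)
qed

text \<open>Already the cut-off 1 suffices: \<open>xi s\<close> differs from
  \<open>(s + 1) / 2\<close> by less than \<open>norm (s + 1) / 2\<close>. This explicit region near
  1 serves both the low part of the zero-free strip and the discs of the final Taylor
  expansion.\<close>

lemma xi_nonzero:
  assumes "Re s > -1" "norm s * norm (s - 1) < 4 * (Re s + 1)"
  shows "xi s \<noteq> 0"
proof
  assume "xi s = 0"
  have "s + 1 \<noteq> 0" using assms(1) by (metis Re_complex_of_real add_eq_0_iff2 less_irrefl of_real_1 of_real_minus)
  have "norm (s + 1) / 2 \<le> trapezoid_const s"
    using xi_approx_error[of s 0] assms(1) \<open>xi s = 0\<close> by (simp add: xi_approx_eq_sum norm_divide norm_minus_commute)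
  then have "norm (s + 1) * (4 * (Re s + 1)) \<le> norm (s + 1) * (norm s * norm (s - 1))"
    using assms(1) by (simp add: field_simps)
  then show False using assms \<open>s + 1 \<noteq> 0\<close> by (simp add: mult_le_cancel_left)
qed

lemma xi_approx_holomorphic: "xi_approx N holomorphic_on A"
  unfolding xi_approx_def by (intro holomorphic_intros) auto

lemma xi_holomorphic: "xi holomorphic_on {s. Re s > 0}"
proof (rule holomorphic_uniform_sequence)
  show "open {s. Re s > 0}" by (rule open_halfspace_Re_gt)
  show "xi_approx (Suc n) holomorphic_on {s. Re s > 0}" for n by (rule xi_approx_holomorphic)
  fix z assume z: "z \<in> {s. Re s > 0}"
  define d where "d = Re z / 2"
  have d: "d > 0" "Re w > 0" if "w \<in> cball z d" for w
    using z that abs_Re_le_cmod[of "z - w"] by (auto simp: d_def dist_norm)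
  have d0: "d > 0" using z by (simp add: d_def)
  define C where "C = (norm z + d + 1) * (norm z + d) * (norm z + d + 1) / 8"
  have "uniform_limit (cball z d) (\<lambda>n. xi_approx (Suc n)) xi sequentially"
  proof (rule uniform_limitI)
    fix e :: real assume "e > 0"
    have "(\<lambda>n. C * real (Suc (n + 0)) powr (- 1)) \<longlonglongrightarrow> C * 0"
      by (intro tendsto_intros tendsto_nat_powr_neg) auto
    then have "\<forall>\<^sub>F n in sequentially. C * real (Suc n) powr (- 1) < e"
      using \<open>e > 0\<close> by (auto dest: order_tendstoD)
    then show "\<forall>\<^sub>F n in sequentially. \<forall>w\<in>cball z d. dist (xi_approx (Suc n) w) (xi w) < e"
    proof eventually_elim
      case (elim n)
      show ?case
      proof
        fix w assume w: "w \<in> cball z d"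
        have nw: "norm w \<le> norm z + d"
          using w norm_triangle_sub[of w z] by (auto simp: dist_norm norm_minus_commute)
        have "norm (w - 1) \<le> norm w + 1" "norm (w + 1) \<le> norm w + 1"
          using norm_triangle_ineq4[of w 1] norm_triangle_ineq[of w 1] by auto
        then have "trapezoid_const w \<le> C"
          unfolding C_def using nw d[OF w] d0
          by (intro frac_le mult_mono) auto
        moreover have "real (Suc n) powr (- Re w - 1) \<le> real (Suc n) powr (- 1)"
          using d[OF w] by (intro powr_mono) auto
        ultimately have "trapezoid_const w * real (Suc n) powr (- Re w - 1)
            \<le> C * real (Suc n) powr (- 1)"
          using d0 by (intro mult_mono) (auto simp: C_def)
        then show "dist (xi_approx (Suc n) w) (xi w) < e"
          using xi_approx_error[of w n] d[OF w] elim by (simp add: dist_norm norm_minus_commute)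
      qed
    qed
  qed
  moreover have "cball z d \<subseteq> {s. Re s > 0}" using d by auto
  ultimately show "\<exists>d>0. cball z d \<subseteq> {s. Re s > 0} \<and> uniform_limit (cball z d) (\<lambda>n. xi_approx (Suc n)) xi sequentially"
    using d0 by blast
qed

lemma summable_dpow:
  assumes "Re s > 1"
  shows "summable (\<lambda>n. norm (dpow (real (Suc n)) s))" 
proof -
  have "summable (\<lambda>n. real (Suc n) powr (- Re s))"
    using assms by (subst summable_Suc_iff) (simp add: summable_real_powr_iff)
  then show ?thesis by (simp add: norm_dpow)
qed

lemma xi_eq_dirichlet_series:
  assumes s: "Re s > 1"
  shows "xi s = (s - 1) * (\<Sum>n. dpow (real (Suc n)) s)"
proof -
  have "(\<lambda>n. \<Sum>k<Suc n. dpow (real (Suc k)) s) \<longlonglongrightarrow> (\<Sum>n. dpow (real (Suc n)) s)"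
    by (rule LIMSEQ_Suc, rule summable_LIMSEQ) (rule summable_norm_cancel[OF summable_dpow[OF s]])
  then have 1: "(\<lambda>n. \<Sum>k=1..Suc n. dpow (real k) s) \<longlonglongrightarrow> (\<Sum>n. dpow (real (Suc n)) s)"
    by (simp only: One_nat_def sum.atLeast1_atMost_eq)
  have 2: "(\<lambda>n. dpow (real (Suc n)) w) \<longlonglongrightarrow> 0" if "Re w > 0" for w
    by (rule tendsto_norm_zero_cancel) (use tendsto_nat_powr_neg[OF that, of 0] in \<open>simp add: norm_dpow\<close>)
  have "(\<lambda>n. xi_approx (Suc n) s) \<longlonglongrightarrow> (s - 1) * ((\<Sum>n. dpow (real (Suc n)) s) - 0 / 2) + 0"
    unfolding xi_approx_def using s by (intro tendsto_intros 1 2) auto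
  moreover have "(\<lambda>n. xi_approx (Suc n) s) \<longlonglongrightarrow> xi s"
  proof (rule Lim_null[THEN iffD2, OF Lim_null_comparison])
    have "(\<lambda>n. real (Suc (n + 0)) powr - (Re s + 1)) \<longlonglongrightarrow> 0"
      using s by (intro tendsto_nat_powr_neg) auto
    from tendsto_mult_left[OF this, of "trapezoid_const s"]
    show "(\<lambda>n. trapezoid_const s * real (Suc n) powr (- Re s - 1)) \<longlonglongrightarrow> 0"
      by simp
    show "\<forall>\<^sub>F n in sequentially. norm (xi_approx (Suc n) s - xi s) \<le>
       trapezoid_const s * real (Suc n) powr (- Re s - 1)"
      using xi_approx_error[of s] s by (auto simp: norm_minus_commute intro!: always_eventually)
  qed
  ultimately show ?thesis by (simp add: LIMSEQ_unique)
qed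

section \<open>Euler product\<close>

lemma sum_powr_le:
  assumes e: "0 < e" "e \<le> (1::real)"
  shows "(\<Sum>n=1..Suc N. real n powr (e - 1)) \<le> real (Suc N) powr e / e"
proof (induction N)
  case 0
  then show ?case using e by simp
next
  case (Suc N)
  have "\<exists>z>real (Suc N). z < real (Suc (Suc N)) \<and> real (Suc (Suc N)) powr e - real (Suc N) powr e
      = (real (Suc (Suc N)) - real (Suc N)) * (e * z powr (e - 1))"
    by (intro MVT2) (auto intro!: derivative_eq_intros simp: field_simps powr_diff)
  then obtain z where z: "z > real (Suc N)" "z < real (Suc (Suc N))"
    and eq: "real (Suc (Suc N)) powr e - real (Suc N) powr e = e * z powr (e - 1)"
    by auto
  have "real (Suc (Suc N)) powr (e - 1) \<le> z powr (e - 1)"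
    using z e by (intro powr_mono2') auto
  then have "real (Suc (Suc N)) powr (e - 1) \<le> (real (Suc (Suc N)) powr e - real (Suc N) powr e) / e"
    using eq e by (simp add: field_simps)
  then show ?case using Suc e by (simp add: diff_divide_distrib)
qed

text \<open>The cut-off is taken close to \<open>|Im s|\<close>. The factor \<open>s - 1\<close>
  costs one power of \<open>|Im s|\<close>, and the partial sum, bounded termwise by
  \<open>n^(e-1)\<close>, costs the power \<open>e\<close>.\<close>

lemma xi_growth:
  assumes e: "0 < e" "e \<le> 1 / 2"
  obtains C where "C > 0" 
    "\<And>s. 1 - e \<le> Re s \<Longrightarrow> Re s \<le> 3 \<Longrightarrow> \<bar>Im s\<bar> \<ge> 1 \<Longrightarrow> norm (xi s) \<le> C * \<bar>Im s\<bar> powr (1 + e)"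
proof
  show "6 / e + 11 > 0" using e by (simp add: add_pos_pos)
  fix s assume s: "1 - e \<le> Re s" "Re s \<le> 3" "\<bar>Im s\<bar> \<ge> 1"
  define t where "t = \<bar>Im s\<bar>"
  \<comment> \<open>This makes \<open>Suc M\<close> the ceiling of \<open>t\<close>, hence between
    \<open>t\<close> and \<open>2 * t\<close> because \<open>t\<close> is at least 1.\<close>
  define M where "M = nat \<lceil>t\<rceil> - 1"
  have N: "t \<le> real (Suc M)" "real (Suc M) \<le> 2 * t" "t \<ge> 1"
    using s unfolding t_def M_def by linarith+
  define T where "T = t powr (1 + e)"
  have te: "t * t powr e = T" using N by (simp add: T_def powr_add)
  have "t powr e \<ge> 1" using N e by (intro ge_one_powr_ge_zero) auto
  then have tT: "t \<le> T" using N te mult_left_mono[of 1 "t powr e" t] by simp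
  have te_le: "t powr e \<le> T" using N by (simp add: T_def powr_mono)
  have Ne: "real (Suc M) powr e \<le> 2 * t powr e"
  proof -
    have "real (Suc M) powr e \<le> (2 * t) powr e" using N e by (intro powr_mono2) auto
    also have "\<dots> = 2 powr e * t powr e" using N by (simp add: powr_mult)
    also have "\<dots> \<le> 2 powr 1 * t powr e" using e by (intro mult_right_mono powr_mono) auto
    finally show ?thesis by simp
  qed
  have n1: "norm (s - 1) \<le> 3 * t" "norm s \<le> 4 * t" "norm (s + 1) \<le> 5 * t"
    using cmod_le[of "s - 1"] cmod_le[of s] cmod_le[of "s + 1"] s e unfolding t_def by auto
  have sum: "norm (\<Sum>n=1..Suc M. dpow (real n) s) \<le> 2 * t powr e / e"
  proof -
    have "norm (\<Sum>n=1..Suc M. dpow (real n) s) \<le> (\<Sum>n=1..Suc M. real n powr (e - 1))"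
      using s by (intro sum_norm_le) (auto simp: norm_dpow intro!: powr_mono)
    also have "\<dots> \<le> real (Suc M) powr e / e" using e by (intro sum_powr_le) auto
    also have "\<dots> \<le> 2 * t powr e / e" using Ne e by (intro divide_right_mono) auto
    finally show ?thesis .
  qed
  have d1: "norm (dpow (real (Suc M)) s) \<le> 1"
    using s e powr_mono[of "- Re s" 0 "real (Suc M)"] by (simp add: norm_dpow)
  have d2: "norm (dpow (real (Suc M)) (s - 1)) \<le> 2 * T"
  proof -
    have "norm (dpow (real (Suc M)) (s - 1)) = real (Suc M) powr (1 - Re s)" by (simp add: norm_dpow)
    also have "\<dots> \<le> real (Suc M) powr e" using s by (intro powr_mono) auto
    finally show ?thesis using Ne te_le by linarith
  qed
  have "norm (xi_approx (Suc M) s) \<le> norm (s - 1) * (norm (\<Sum>n=1..Suc M. dpow (real n) s) + norm (dpow (real (Suc M)) s) / 2) + norm (dpow (real (Suc M)) (s - 1))"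
    unfolding xi_approx_def
    by (intro order.trans[OF norm_triangle_ineq] add_right_mono)
       (simp only: norm_mult, intro mult_left_mono order.trans[OF norm_triangle_ineq4], auto simp: norm_divide)
  also have "\<dots> \<le> 3 * t * (2 * t powr e / e + 1 / 2) + 2 * T"
    using n1 sum d1 d2 N e by (intro add_mono mult_mono) auto
  also have "\<dots> = 6 / e * T + 3 / 2 * t + 2 * T"
    using te by (simp add: field_simps)
  also have "\<dots> \<le> (6 / e + 7 / 2) * T" using tT by (simp add: algebra_simps)
  finally have A: "norm (xi_approx (Suc M) s) \<le> (6 / e + 7 / 2) * T" .
  \<comment> \<open>The three linear factors of the constant give \<open>t^3\<close>, the cut-off
    gives \<open>t^(e-2)\<close>; the remainder thus has the same order \<open>t^(1+e)\<close> as
    the main part.\<close>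
  have "trapezoid_const s * real (Suc M) powr (- Re s - 1)
     \<le> 3 * t * (4 * t) * (5 * t) / (8 * 1) * t powr (e - 2)"
  proof (intro mult_mono frac_le)
    have "real (Suc M) powr (- Re s - 1) \<le> real (Suc M) powr (e - 2)" using s by (intro powr_mono) auto
    also have "\<dots> \<le> t powr (e - 2)" using N e by (intro powr_mono2') auto
    finally show "real (Suc M) powr (- Re s - 1) \<le> t powr (e - 2)" .
  qed (use n1 N s e in auto)
  also have "\<dots> = 15 / 2 * (t powr 3 * t powr (e - 2))"
    using N by (simp add: power3_eq_cube powr_numeral)
  also have "t powr 3 * t powr (e - 2) = T" unfolding T_def by (simp flip: powr_add)
  finally have "norm (xi s - xi_approx (Suc M) s) \<le> 15 / 2 * T"
    using xi_approx_error[of s M] s e by linarith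
  then have "norm (xi s) \<le> (6 / e + 11) * T"
    using A norm_triangle_sub[of "xi s" "xi_approx (Suc M) s"] by (simp add: algebra_simps)
  then show "norm (xi s) \<le> (6 / e + 11) * \<bar>Im s\<bar> powr (1 + e)" by (simp add: T_def t_def)
qed

section \<open>Sieving the Dirichlet series and the Euler product\<close>

definition sieved :: "nat set \<Rightarrow> nat set" where
  "sieved P = {n. n > 0 \<and> (\<forall>p\<in>P. \<not> p dvd n)}"

definition zeta_series :: "complex \<Rightarrow> complex" where
  "zeta_series s = (\<Sum>n. dpow (real (Suc n)) s)"

text \<open>The sieve of Eratosthenes: multiplication by \<open>p^(-s)\<close> reindexes the sum to
  the multiples of \<open>p\<close>, and subtracting it removes them. Unordered summation makes the
  removal of a subset immediate.\<close>

lemma sieved_has_sum: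
  assumes s: "Re s > 1" and "finite P" "\<And>p. p \<in> P \<Longrightarrow> prime p"
  shows "((\<lambda>n. dpow (real n) s) has_sum ((\<Prod>p\<in>P. 1 - dpow (real p) s) * zeta_series s)) (sieved P)"
  using assms(2,3)
proof (induction P rule: finite_induct)
  case empty
  have "((\<lambda>n. dpow (real (Suc n)) s) has_sum zeta_series s) UNIV"
    unfolding zeta_series_def by (rule norm_summable_imp_has_sum[OF summable_dpow[OF s]])
      (rule summable_sums[OF summable_norm_cancel[OF summable_dpow[OF s]]])
  then have "((\<lambda>n. dpow (real n) s) has_sum zeta_series s) (range Suc)"
    by (subst has_sum_reindex) (auto simp: o_def)
  moreover have "sieved {} = range Suc"
    unfolding sieved_def by (auto simp: image_iff gr0_conv_Suc)
  ultimately show ?case by simp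
next
  case (insert p P)
  define S where "S = (\<Prod>p\<in>P. 1 - dpow (real p) s) * zeta_series s"
  have p: "prime p" using insert.prems by auto
  have IH: "((\<lambda>n. dpow (real n) s) has_sum S) (sieved P)"
    unfolding S_def using insert by auto
  have sub: "(\<lambda>n. p * n) ` sieved P \<subseteq> sieved P"
    using p insert.prems \<open>p \<notin> P\<close> primes_dvd_imp_eq
    by (auto simp: sieved_def prime_dvd_mult_iff prime_gt_0_nat) blast
  have "((\<lambda>n. dpow (real (p * n)) s) has_sum (dpow (real p) s * S)) (sieved P)"
  proof (rule has_sum_cong[THEN iffD1, OF _ has_sum_cmult_right[OF IH]])
    show "dpow (real p) s * dpow (real n) s = dpow (real (p * n)) s" if "n \<in> sieved P" for n
      using that p prime_gt_0_nat[OF p] by (simp add: dpow_mult sieved_def)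
  qed
  then have "((\<lambda>n. dpow (real n) s) has_sum (dpow (real p) s * S)) ((\<lambda>n. p * n) ` sieved P)"
    using prime_gt_0_nat[OF p] by (subst has_sum_reindex) (auto simp: o_def inj_on_def)
  from has_sum_Diff[OF IH this sub]
  have "((\<lambda>n. dpow (real n) s) has_sum (S - dpow (real p) s * S)) (sieved P - (\<lambda>n. p * n) ` sieved P)" .
  moreover have "sieved P - (\<lambda>n. p * n) ` sieved P = sieved (insert p P)"
    by (fastforce simp: sieved_def elim!: dvdE)
  ultimately show ?case using insert.hyps by (simp add: S_def algebra_simps)
qed

definition primes_below :: "nat \<Rightarrow> nat set" where
  "primes_below n = {p. prime p \<and> p < n}"

lemma finite_primes_below [simp]: "finite (primes_below n)"
  by (rule finite_subset[of _ "{..<n}"]) (auto simp: primes_below_def)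

text \<open>An integer other than 1 without prime factors below \<open>N\<close> is at least
  \<open>N\<close>, so the error is part of the tail of the series. The bound is uniform in
  \<open>Re s \<ge> a\<close>, which the logarithmic derivative requires later.\<close>

lemma euler_product_error:
  assumes a: "a > 1" and s: "Re s \<ge> a"
  shows "norm ((\<Prod>p\<in>primes_below N. 1 - dpow (real p) s) * zeta_series s - 1) \<le> (\<Sum>n. real (n + N) powr (- a))"
proof -
  define h where "h = (\<lambda>n. real n powr (- a))"
  have s1: "Re s > 1" using a s by simp
  define A where "A = sieved (primes_below N) - {1}"
  define v where "v = (\<Prod>p\<in>primes_below N. 1 - dpow (real p) s) * zeta_series s"
  have A_ge: "n \<ge> N" "n > 0" if n: "n \<in> A" for n
  proof -
    from n have "n \<noteq> 1" "n > 0" by (auto simp: A_def sieved_def)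
    then obtain p where p: "prime p" "p dvd n" using prime_factor_nat by blast
    then have "\<not> p < N" using n by (auto simp: A_def sieved_def primes_below_def)
    then show "n \<ge> N" "n > 0" using dvd_imp_le[OF p(2) \<open>n > 0\<close>] \<open>n > 0\<close> by auto
  qed
  have "((\<lambda>n. dpow (real n) s) has_sum v) (sieved (primes_below N))"
    unfolding v_def by (rule sieved_has_sum[OF s1]) (auto simp: primes_below_def)
  moreover have "((\<lambda>n. dpow (real n) s) has_sum 1) {1}"
    using has_sum_finite[of "{1::nat}" "\<lambda>n. dpow (real n) s"] by simp
  moreover have "{1} \<subseteq> sieved (primes_below N)"
    by (auto simp: sieved_def primes_below_def)
  ultimately have hs: "((\<lambda>n. dpow (real n) s) has_sum (v - 1)) A"
    unfolding A_def by (rule has_sum_Diff)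
  have summ: "summable h" unfolding h_def using a by (simp add: summable_real_powr_iff)
  have h_on: "h summable_on B" for B
    using summ by (intro summable_on_subset_banach[of h UNIV B])
      (auto simp: summable_on_UNIV_nonneg_real_iff h_def)
  have le: "norm (dpow (real n) s) \<le> h n" if "n \<in> A" for n
    using A_ge[OF that] s by (auto simp: norm_dpow h_def intro!: powr_mono)
  have abs: "(\<lambda>n. norm (dpow (real n) s)) summable_on A"
    using h_on[of A] le by (rule summable_on_comparison_test) auto
  have "norm (v - 1) = norm (infsum (\<lambda>n. dpow (real n) s) A)" using infsumI[OF hs] by simp
  also have "\<dots> \<le> infsum (\<lambda>n. norm (dpow (real n) s)) A" using abs by (rule norm_infsum_bound)
  also have "\<dots> \<le> infsum h {N..}"
    using A_ge le by (intro infsum_mono_neutral[OF abs h_on]) (auto simp: h_def)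
  also have "{N..} = range (\<lambda>n. n + N)" by (auto simp: image_iff le_iff_add add.commute)
  also have "infsum h (range (\<lambda>n. n + N)) = infsum (h \<circ> (\<lambda>n. n + N)) UNIV"
    by (rule infsum_reindex) auto
  also have "\<dots> = (\<Sum>n. h (n + N))"
  proof -
    have "summable (\<lambda>n. h (n + N))" using summ by (simp add: summable_iff_shift)
    then have "(\<lambda>n. h (n + N)) summable_on UNIV"
      by (subst summable_on_UNIV_nonneg_real_iff) (auto simp: h_def)
    then have "(\<lambda>n. h (n + N)) sums infsum (\<lambda>n. h (n + N)) UNIV"
      by (intro has_sum_imp_sums has_sum_infsum)
    then show ?thesis by (simp add: o_def sums_iff)
  qed
  finally show ?thesis by (simp add: v_def h_def)
qed

lemma euler_tail_tendsto_0:
  assumes "a > 1"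
  shows "(\<lambda>N. \<Sum>n. real (n + N) powr (- a)) \<longlonglongrightarrow> 0"
  using suminf_exist_split2[of "\<lambda>n. real n powr (- a)"] assms by (simp add: summable_real_powr_iff)

lemma euler_product_tendsto:
  assumes "Re s > 1"
  shows "(\<lambda>N. (\<Prod>p\<in>primes_below N. 1 - dpow (real p) s) * zeta_series s) \<longlonglongrightarrow> 1"
  by (rule Lim_null[THEN iffD2, OF Lim_null_comparison[OF _ euler_tail_tendsto_0[OF assms]]])
     (intro always_eventually allI euler_product_error[OF assms], simp)

text \<open>At a zero the products of \<open>euler_product_tendsto\<close> would all vanish, yet
  they tend to 1.\<close>

lemma zeta_series_nonzero: "Re s > 1 \<Longrightarrow> zeta_series s \<noteq> 0"
  using euler_product_tendsto[of s] LIMSEQ_unique[OF tendsto_const, of "0::complex" 1] by auto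

lemma xi_eq_zeta_series: "Re s > 1 \<Longrightarrow> xi s = (s - 1) * zeta_series s"
  by (simp add: xi_eq_dirichlet_series zeta_series_def)

lemma xi_nonzero_right: "Re s > 1 \<Longrightarrow> xi s \<noteq> 0"
  using zeta_series_nonzero[of s] by (auto simp: xi_eq_zeta_series)

text \<open>The logarithm of the left side is a power series in \<open>r\<close> whose
  \<open>n\<close>-th coefficient is \<open>-(3 + 4c + (2c^2 - 1)) / n = -2(1 + c)^2 / n\<close>,
  where \<open>c = Re (w ^ n)\<close>. The factors are reciprocals of local Euler factors, hence the
  direction of the inequality.\<close>

lemma three_four_one_factor:
  fixes w :: complex
  assumes r: "0 \<le> r" "r < 1" and w: "norm w = 1"
  shows "norm (1 - complex_of_real r) ^ 3 * norm (1 - of_real r * w) ^ 4 * norm (1 - of_real r * w ^ 2) \<le> (1::real)"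
proof -
  have *: "(\<lambda>n. - (r ^ n * Re (v ^ n)) / real n) sums ln (norm (1 - of_real r * v))" "norm (1 - of_real r * v) > 0"
    if v: "norm v = 1" for v
  proof -
    have n: "norm (- (of_real r * v)) < 1" using r v by (simp add: norm_mult)
    then have nz: "1 - of_real r * v \<noteq> 0" by auto
    from sums_Re[OF Ln_series'[OF n]]
    have "(\<lambda>n. Re (- ((of_real r * v) ^ n) / of_nat n)) sums ln (norm (1 - of_real r * v))"
      using nz by simp
    moreover have "Re (- ((of_real r * v) ^ n) / of_nat n) = - (r ^ n * Re (v ^ n)) / real n" for n
    proof -
      have "- ((of_real r * v) ^ n) / of_nat n = of_real (- (r ^ n) / real n) * v ^ n"
        by (simp add: power_mult_distrib)
      also have "Re \<dots> = - (r ^ n) / real n * Re (v ^ n)" by (simp only: times_complex.sel Re_complex_of_real Im_complex_of_real)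
      finally show ?thesis by simp
    qed
    ultimately show "(\<lambda>n. - (r ^ n * Re (v ^ n)) / real n) sums ln (norm (1 - of_real r * v))" by (simp only:)
    show "norm (1 - of_real r * v) > 0" using nz by simp
  qed
  have w2: "norm (w ^ 2) = 1" using w by (simp add: norm_power)
  have "(\<lambda>n. 3 * (- (r ^ n * Re (1 ^ n)) / real n) + 4 * (- (r ^ n * Re (w ^ n)) / real n) + (- (r ^ n * Re ((w ^ 2) ^ n)) / real n))
     sums (3 * ln (norm (1 - complex_of_real r * 1)) + 4 * ln (norm (1 - of_real r * w)) + ln (norm (1 - of_real r * w ^ 2)))"
    using *(1)[of 1] *(1)[OF w] *(1)[OF w2] by (intro sums_add sums_mult) auto
  moreover have "3 * (- (r ^ n * Re (1 ^ n)) / real n) + 4 * (- (r ^ n * Re (w ^ n)) / real n) + (- (r ^ n * Re ((w ^ 2) ^ n)) / real n) \<le> 0" for n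
  proof -
    define c where "c = Re (w ^ n)"
    have "(Re (w ^ n))\<^sup>2 + (Im (w ^ n))\<^sup>2 = 1"
      using w by (simp add: cmod_power2[symmetric] norm_power)
    then have Re2: "Re ((w ^ 2) ^ n) = 2 * c ^ 2 - 1"
      by (simp add: power_mult[symmetric] mult.commute[of 2] c_def) (simp add: power_mult power2_eq_square)
    have "3 * (- (x * 1) / y) + 4 * (- (x * c) / y) + (- (x * (2 * c ^ 2 - 1)) / y) = - (x / y * (2 * (1 + c) ^ 2))" for x y
      \<comment> \<open>The case \<open>y = 0\<close> is the term of index 0, where division by zero
        makes both sides vanish.\<close>
      by (cases "y = 0") (simp_all add: field_simps power2_eq_square)
    then have "3 * (- (r ^ n * Re (1 ^ n)) / real n) + 4 * (- (r ^ n * Re (w ^ n)) / real n) + (- (r ^ n * Re ((w ^ 2) ^ n)) / real n)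
      = - (r ^ n / real n * (2 * (1 + c) ^ 2))"
      by (simp only: Re2 c_def[symmetric] power_one one_complex.sel)
    also have "\<dots> \<le> 0" using r by simp
    finally show ?thesis .
  qed
  ultimately have "3 * ln (norm (1 - complex_of_real r * 1)) + 4 * ln (norm (1 - of_real r * w)) + ln (norm (1 - of_real r * w ^ 2)) \<le> 0"
    by (rule sums_le[OF _ _ sums_zero, rotated]) 
  moreover have "3 * ln (norm (1 - complex_of_real r * 1)) + 4 * ln (norm (1 - of_real r * w)) + ln (norm (1 - of_real r * w ^ 2))
    = ln (norm (1 - complex_of_real r * 1) ^ 3 * norm (1 - of_real r * w) ^ 4 * norm (1 - of_real r * w ^ 2))"
    using *(2)[of 1] *(2)[OF w] *(2)[OF w2] by (simp add: ln_mult ln_realpow)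
  ultimately show ?thesis
    using *(2)[of 1] *(2)[OF w] *(2)[OF w2] by (simp add: zero_less_mult_iff)
qed

text \<open>The local inequality is multiplied over the primes below \<open>N\<close>. The partial
  products times the zeta values are then at most the left side for every \<open>N\<close>, and they
  tend to 1.\<close>

lemma three_four_one:
  assumes "a > 1"
  shows "norm (zeta_series (of_real a)) ^ 3 * norm (zeta_series (Complex a t)) ^ 4 * norm (zeta_series (Complex a (2 * t))) \<ge> 1"
proof -
  define P where "P = (\<lambda>N s. \<Prod>p\<in>primes_below N. 1 - dpow (real p) s)"
  have lim: "(\<lambda>N. norm (P N s * zeta_series s)) \<longlonglongrightarrow> norm (1 :: complex)" if "Re s > 1" for s
    unfolding P_def using that by (intro tendsto_norm euler_product_tendsto)
  define X where "X = norm (zeta_series (of_real a)) ^ 3 * norm (zeta_series (Complex a t)) ^ 4 * norm (zeta_series (Complex a (2 * t)))"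
  have P1: "norm (P N (of_real a)) ^ 3 * norm (P N (Complex a t)) ^ 4 * norm (P N (Complex a (2 * t))) \<le> 1" for N
  proof -
    have "norm (P N (of_real a)) ^ 3 * norm (P N (Complex a t)) ^ 4 * norm (P N (Complex a (2 * t)))
      = (\<Prod>p\<in>primes_below N. norm (1 - dpow (real p) (of_real a)) ^ 3 * norm (1 - dpow (real p) (Complex a t)) ^ 4 * norm (1 - dpow (real p) (Complex a (2 * t))))"
      unfolding P_def by (simp add: prod_norm[symmetric] prod_power_distrib prod.distrib)
    also have "\<dots> \<le> 1"
    proof (intro prod_le_1 conjI)
      fix p assume "p \<in> primes_below N"
      then have p: "real p > 1" using prime_gt_1_nat by (auto simp: primes_below_def)
      define r where "r = real p powr (- a)"
      define w where "w = exp (- (\<i> * of_real (t * ln (real p))))"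
      have r: "0 \<le> r" "r < 1" using p assms powr_less_mono[of "- a" 0 "real p"] by (auto simp: r_def)
      have w: "norm w = 1" by (simp add: w_def)
      have "dpow (real p) (of_real a) = of_real r"
        using p by (simp add: dpow_def r_def powr_def exp_of_real[symmetric])
      moreover have "dpow (real p) (Complex a t) = of_real r * w"
        using p by (simp add: dpow_def r_def powr_def exp_of_real[symmetric] w_def exp_add[symmetric] Complex_eq algebra_simps)
      moreover have "dpow (real p) (Complex a (2 * t)) = of_real r * w ^ 2"
        using p by (simp add: dpow_def r_def powr_def exp_of_real[symmetric] w_def exp_of_nat_mult[symmetric] exp_add[symmetric] Complex_eq algebra_simps power2_eq_square)
      ultimately show "norm (1 - dpow (real p) (of_real a)) ^ 3 * norm (1 - dpow (real p) (Complex a t)) ^ 4 * norm (1 - dpow (real p) (Complex a (2 * t))) \<le> 1"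
        using three_four_one_factor[OF r w] by simp
    qed auto
    finally show ?thesis .
  qed
  have "(\<lambda>N. norm (P N (of_real a) * zeta_series (of_real a)) ^ 3 * norm (P N (Complex a t) * zeta_series (Complex a t)) ^ 4
     * norm (P N (Complex a (2 * t)) * zeta_series (Complex a (2 * t)))) \<longlonglongrightarrow> norm (1::complex) ^ 3 * norm (1::complex) ^ 4 * norm (1::complex)"
    using assms by (intro tendsto_mult tendsto_power lim) auto
  moreover have "norm (P N (of_real a) * zeta_series (of_real a)) ^ 3 * norm (P N (Complex a t) * zeta_series (Complex a t)) ^ 4
     * norm (P N (Complex a (2 * t)) * zeta_series (Complex a (2 * t))) \<le> X" for N
    using mult_right_mono[OF P1[of N], of X] by (simp add: X_def norm_mult power_mult_distrib mult_ac)
  ultimately have "1 \<le> X" using LIMSEQ_le_const2 by fastforce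
  then show ?thesis by (simp add: X_def)
qed

text \<open>Locally uniform convergence of the Euler product permits termwise logarithmic
  differentiation; the fraction \<open>1 / (s - 1)\<close> is the pole carried by zeta but not by
  \<open>xi\<close>.\<close>

lemma logderiv_euler_product:
  assumes s: "Re s > 1"
  shows "(\<lambda>n. if prime n then of_real (ln (real n)) * (dpow (real n) s / (1 - dpow (real n) s)) else 0)
    sums (1 / (s - 1) - deriv xi s / xi s)"
proof -
  \<comment> \<open>The midpoint of 1 and \<open>Re s\<close>, so that convergence is uniform on an
    open half-plane containing \<open>s\<close>.\<close>
  define a where "a = (1 + Re s) / 2"
  define f where "f = (\<lambda>k s. if prime k then 1 / (1 - dpow (real k) s) else 1)"
  define A where "A = {w. Re w > a}"
  have a: "a > 1" "a < Re s" using s by (auto simp: a_def)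
  have A: "open A" "s \<in> A" using a by (auto simp: A_def open_halfspace_Re_gt)
  have nz: "1 - dpow (real k) w \<noteq> 0" if "prime k" "Re w > 0" for k w
  proof -
    have "real k > 1" using prime_gt_1_nat[OF that(1)] by simp
    then have "norm (dpow (real k) w) < 1" using powr_less_mono[of "- Re w" 0 "real k"] that by (simp add: norm_dpow)
    then show ?thesis by auto
  qed
  define Z where "Z = (\<Sum>n. real (Suc n) powr (- a))"
  have Zb: "norm (zeta_series w) \<le> Z" if "w \<in> A" for w
  proof -
    have summ: "summable (\<lambda>n. real (Suc n) powr (- a))"
      using a by (subst summable_Suc_iff) (simp add: summable_real_powr_iff)
    show ?thesis unfolding zeta_series_def Z_def
      using that by (intro norm_suminf_le summ) (auto simp: norm_dpow A_def intro!: powr_mono)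
  qed
  have Pf: "(\<Prod>k<n. f k w) = 1 / (\<Prod>p\<in>primes_below n. 1 - dpow (real p) w)" for n w
  proof -
    have "(\<Prod>k<n. f k w) = (\<Prod>k\<in>{k\<in>{..<n}. prime k}. 1 / (1 - dpow (real k) w))"
      unfolding f_def by (rule prod.inter_filter[symmetric]) auto
    also have "{k\<in>{..<n}. prime k} = primes_below n" by (auto simp: primes_below_def)
    finally show ?thesis by (simp add: prod_dividef)
  qed
  have "uniform_limit A (\<lambda>n w. \<Prod>k<n. f k w) zeta_series sequentially"
  proof (rule uniform_limitI)
    fix e :: real assume e: "e > 0"
    have "(\<lambda>N. 2 * Z * (\<Sum>n. real (n + N) powr (- a))) \<longlonglongrightarrow> 2 * Z * 0"
      by (intro tendsto_intros euler_tail_tendsto_0 a)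
    then have "\<forall>\<^sub>F N in sequentially. 2 * Z * (\<Sum>n. real (n + N) powr (- a)) < e"
      using e by (auto dest: order_tendstoD)
    moreover have "\<forall>\<^sub>F N in sequentially. (\<Sum>n. real (n + N) powr (- a)) < 1 / 2"
      by (rule order_tendstoD(2)[OF euler_tail_tendsto_0[OF a(1)]]) simp
    ultimately show "\<forall>\<^sub>F n in sequentially. \<forall>w\<in>A. dist (\<Prod>k<n. f k w) (zeta_series w) < e"
    proof eventually_elim
      case (elim N)
      show ?case
      proof
        fix w assume w: "w \<in> A"
        define P where "P = (\<Prod>p\<in>primes_below N. 1 - dpow (real p) w)"
        \<comment> \<open>Since \<open>P * zeta_series w = 1 + d\<close>, the reciprocal product
          differs from zeta by \<open>- zeta_series w * d / (1 + d)\<close>; keeping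
          \<open>d\<close> below 1/2 keeps the denominator away from 0.\<close>
        define d where "d = P * zeta_series w - 1"
        have d: "norm d \<le> (\<Sum>n. real (n + N) powr (- a))"
          unfolding d_def P_def using w by (intro euler_product_error a) (auto simp: A_def)
        then have d2: "norm d < 1 / 2" using elim by simp
        have "norm (1 + d) \<ge> 1 / 2" using d2 norm_triangle_ineq4[of "1 + d" d] by simp
        have "zeta_series w \<noteq> 0" using w a by (intro zeta_series_nonzero) (auto simp: A_def)
        moreover have "P \<noteq> 0" using \<open>norm (1 + d) \<ge> 1 / 2\<close> by (auto simp: d_def)
        ultimately have "1 / P - zeta_series w = - zeta_series w * d / (1 + d)"
          by (simp add: d_def field_simps)
        then have "norm (1 / P - zeta_series w) = norm (zeta_series w) * norm d / norm (1 + d)"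
          by (simp add: norm_mult norm_divide)
        also have "\<dots> \<le> Z * (\<Sum>n. real (n + N) powr (- a)) / (1 / 2)"
          using d Zb[OF w] \<open>norm (1 + d) \<ge> 1 / 2\<close> order.trans[OF norm_ge_zero Zb[OF w]]
            order.trans[OF norm_ge_zero d]
          by (intro frac_le mult_mono mult_nonneg_nonneg) auto
        finally show "dist (\<Prod>k<N. f k w) (zeta_series w) < e"
          using elim by (simp add: Pf P_def dist_norm)
      qed
    qed
  qed
  moreover have hol: "f k holomorphic_on A" for k
    unfolding f_def using nz a by (cases "prime k") (auto intro!: holomorphic_intros simp: A_def)
  ultimately have sums: "(\<lambda>k. deriv (f k) s / f k s) sums (deriv zeta_series s / zeta_series s)"
    using A zeta_series_nonzero[OF s] by (intro logderiv_prodinf_complex_uniform_limit) auto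
  have "deriv (f k) s / f k s = - (if prime k then of_real (ln (real k)) * (dpow (real k) s / (1 - dpow (real k) s)) else 0)" for k
  proof (cases "prime k")
    case True
    have "((\<lambda>s. 1 / (1 - dpow (real k) s)) has_field_derivative
       (- of_real (ln (real k)) * dpow (real k) s / (1 - dpow (real k) s) ^ 2)) (at s)"
      using nz[OF True, of s] s unfolding dpow_def
      by (auto intro!: derivative_eq_intros simp: power2_eq_square mult_ac)
    then have "deriv (f k) s = - of_real (ln (real k)) * dpow (real k) s / (1 - dpow (real k) s) ^ 2"
      using True by (auto simp: f_def intro!: DERIV_imp_deriv)
    then show ?thesis using True nz[OF True, of s] s by (simp add: f_def power2_eq_square)
  qed (simp add: f_def)
  then have "(\<lambda>n. if prime n then of_real (ln (real n)) * (dpow (real n) s / (1 - dpow (real n) s)) else 0)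
    sums (- (deriv zeta_series s / zeta_series s))"
    using sums_minus[OF sums] by simp
  moreover have "- (deriv zeta_series s / zeta_series s) = 1 / (s - 1) - deriv xi s / xi s"
  proof -
    have "xi field_differentiable at s"
      using xi_holomorphic s by (auto intro!: holomorphic_on_imp_differentiable_at[OF _ open_halfspace_Re_gt[of 0]])
    then have d: "(xi has_field_derivative deriv xi s) (at s)" by (rule field_differentiable_derivI)
    have "s \<noteq> 1" using s by auto
    have "((\<lambda>s. xi s / (s - 1)) has_field_derivative (deriv xi s * (s - 1) - xi s) / (s - 1) ^ 2) (at s)"
      using \<open>s \<noteq> 1\<close> by (auto intro!: derivative_eq_intros d simp: power2_eq_square)
    moreover have "xi w / (w - 1) = zeta_series w" if "w \<in> A" for w
    proof -
      have "Re w > 1" using that a by (simp add: A_def)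
      then show ?thesis by (auto simp: xi_eq_zeta_series)
    qed
    ultimately have "(zeta_series has_field_derivative (deriv xi s * (s - 1) - xi s) / (s - 1) ^ 2) (at s)"
      using A by (auto intro: has_field_derivative_transform_within_open)
    then have "deriv zeta_series s = (deriv xi s * (s - 1) - xi s) / (s - 1) ^ 2" by (rule DERIV_imp_deriv)
    moreover have "zeta_series s = xi s / (s - 1)" using \<open>s \<noteq> 1\<close> s by (simp add: xi_eq_zeta_series)
    moreover have "- ((x * u - y) / u ^ 2 / (y / u)) = 1 / u - x / y" if "u \<noteq> 0" "y \<noteq> 0" for x y u :: complex
      using that by (simp add: field_simps power2_eq_square)
    ultimately show ?thesis using \<open>s \<noteq> 1\<close> xi_nonzero_right[OF s] by simp
  qed
  ultimately show ?thesis by simp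
qed

section \<open>Sums over primes\<close>

abbreviation prime_term :: "(complex \<Rightarrow> complex) \<Rightarrow> complex \<Rightarrow> nat \<Rightarrow> complex" where
  "prime_term V s \<equiv> (\<lambda>n. if prime n then of_real (ln (real n)) * V (dpow (real n) s) else 0)"

text \<open>The kernel \<open>V\<close> is a function of \<open>q = p^(-s)\<close>. The series with
  kernels \<open>q\<close>, \<open>q/(1-q)\<close> and the two tails thus share one notation and one
  convergence criterion.\<close>

definition primesum :: "(complex \<Rightarrow> complex) \<Rightarrow> complex \<Rightarrow> complex" where
  "primesum V s = (\<Sum>n. prime_term V s n)"

lemma summable_ln_powr:
  assumes "b > (1::real)"
  shows "summable (\<lambda>n. ln (real n) * real n powr (- b))"
proof -
  define c where "c = (b - 1) / 2"
  have c: "c > 0" using assms by (simp add: c_def)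
  have "summable (\<lambda>n. 1 / c * real n powr (c - b))"
    using assms by (intro summable_mult) (simp add: summable_real_powr_iff c_def field_simps)
  then show ?thesis
  proof (rule summable_comparison_test'[where N = 1])
    fix n :: nat assume "n \<ge> 1"
    then have "ln (real n) * real n powr (- b) \<le> (real n powr c / c) * real n powr (- b)"
      using c by (intro mult_right_mono ln_powr_bound) auto
    also have "\<dots> = 1 / c * real n powr (c - b)" by (simp add: powr_add[symmetric])
    finally show "norm (ln (real n) * real n powr (- b)) \<le> 1 / c * real n powr (c - b)"
      using \<open>n \<ge> 1\<close> by (simp add: abs_mult)
  qed
qed

lemma norm_dpow_prime:
  assumes "prime n" "a \<le> Re s" "a > 0"
  shows "norm (dpow (real n) s) \<le> 2 powr (- a)" "norm (dpow (real n) s) \<le> real n powr (- a)"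
    "norm (dpow (real n) s) < 1"
proof -
  have n: "real n \<ge> 2" using prime_ge_2_nat[OF assms(1)] by simp
  show 1: "norm (dpow (real n) s) \<le> real n powr (- a)"
    using n assms by (auto simp: norm_dpow intro!: powr_mono)
  also have "\<dots> \<le> 2 powr (- a)" using n assms by (intro powr_mono2') auto
  finally show "norm (dpow (real n) s) \<le> 2 powr (- a)" .
  also have "2 powr (- a) < 1" using assms powr_less_mono[of "- a" 0 "2::real"] by simp
  finally show "norm (dpow (real n) s) < 1" .
qed

text \<open>If \<open>V\<close> is of order \<open>q^k\<close> at 0, the series is dominated by the
  sum of \<open>ln n / n^(k a)\<close>, so the Weierstrass test applies. The bound on
  \<open>V\<close> is asked for \<open>norm q \<le> 2 powr (- a)\<close> only, as the smallest prime
  is 2.\<close>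

lemma
  fixes V :: "complex \<Rightarrow> complex"
  assumes V: "V holomorphic_on ball 0 1" and C: "C \<ge> 0"
    and bd: "\<And>q. norm q \<le> 2 powr (- a) \<Longrightarrow> norm (V q) \<le> C * norm q ^ k"
    and a: "a > 0" "real k * a > 1"
  shows primesum_summable: "Re s \<ge> a \<Longrightarrow> summable (prime_term V s)"
    and primesum_bounded: "\<exists>B>0. \<forall>s. Re s \<ge> a \<longrightarrow> norm (primesum V s) \<le> B"
    and primesum_holomorphic: "primesum V holomorphic_on {s. Re s > a}"
proof -
  define M where "M = (\<lambda>n. C * (ln (real n) * real n powr (- (real k * a))))"
  define f where "f = (\<lambda>n s. if prime n then of_real (ln (real n)) * V (dpow (real n) s) else 0)"
  have M: "summable M" unfolding M_def using a by (intro summable_mult summable_ln_powr)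
  have M0: "M n \<ge> 0" for n unfolding M_def using C by (cases "n = 0") auto
  have fM: "norm (f n s) \<le> M n" if "Re s \<ge> a" for n s
  proof (cases "prime n")
    case True
    note b = norm_dpow_prime[OF True that a(1)]
    have ln: "ln (real n) \<ge> 0" using prime_ge_2_nat[OF True] by simp
    have "norm (V (dpow (real n) s)) \<le> C * norm (dpow (real n) s) ^ k" using b by (intro bd)
    also have "\<dots> \<le> C * (real n powr (- a)) ^ k" using C b by (intro mult_left_mono power_mono) auto
    also have "(real n powr (- a)) ^ k = real n powr (- (real k * a))"
      using prime_gt_0_nat[OF True] by (simp add: powr_powr powr_realpow[symmetric] mult.commute)
    finally have "ln (real n) * norm (V (dpow (real n) s)) \<le> ln (real n) * (C * real n powr (- (real k * a)))"
      using ln by (rule mult_left_mono)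
    then show ?thesis using True ln by (simp add: f_def M_def norm_mult mult_ac)
  qed (use M0 in \<open>simp add: f_def\<close>)
  show "summable (prime_term V s)" if "Re s \<ge> a"
    using summable_comparison_test'[OF M fM[OF that]] by (simp add: f_def)
  have ps: "primesum V s = (\<Sum>n. f n s)" for s by (simp add: primesum_def f_def)
  have "norm (primesum V s) \<le> suminf M" if "Re s \<ge> a" for s
    unfolding ps by (intro norm_suminf_le M fM that)
  moreover have "suminf M \<ge> 0" by (intro suminf_nonneg M M0)
  ultimately show "\<exists>B>0. \<forall>s. Re s \<ge> a \<longrightarrow> norm (primesum V s) \<le> B"
    by (intro exI[of _ "suminf M + 1"]) (auto simp: add_nonneg_pos add_increasing2)
  have ul: "uniform_limit {s. Re s > a} (\<lambda>n s. \<Sum>i<n. f i s) (primesum V) sequentially"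
    unfolding ps[abs_def] using fM by (intro Weierstrass_m_test[OF _ M]) auto
  show "primesum V holomorphic_on {s. Re s > a}"
  proof (rule holomorphic_uniform_sequence)
    show "open {s. Re s > a}" by (rule open_halfspace_Re_gt)
    have "f i holomorphic_on {s. Re s > a}" for i
    proof (cases "prime i")
      case True
      have "(V \<circ> dpow (real i)) holomorphic_on {s. Re s > a}"
        by (rule holomorphic_on_compose_gen[OF _ V])
           (use norm_dpow_prime(3)[OF True _ a(1)] in \<open>auto intro!: holomorphic_intros\<close>)
      then show ?thesis using True by (auto simp: f_def o_def intro!: holomorphic_intros)
    qed (simp add: f_def)
    then show "(\<lambda>s. \<Sum>i<n. f i s) holomorphic_on {s. Re s > a}" for n
      by (intro holomorphic_intros)
    fix z assume "z \<in> {s. Re s > a}"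
    then obtain d where "d > 0" "cball z d \<subseteq> {s. Re s > a}"
      using open_halfspace_Re_gt[of a] open_contains_cball by metis
    then show "\<exists>d>0. cball z d \<subseteq> {s. Re s > a} \<and> uniform_limit (cball z d) (\<lambda>n s. \<Sum>i<n. f i s) (primesum V) sequentially"
      using uniform_limit_on_subset[OF ul] by blast
  qed
qed

lemma norm_one_minus_ge:
  fixes q :: "'a :: real_normed_div_algebra"
  assumes "norm q \<le> r" "r < 1" "m > 0"
  shows "norm (1 - q ^ m) \<ge> 1 - r"
proof -
  have "norm (q ^ m) \<le> norm q ^ 1"
    unfolding norm_power using assms by (intro power_decreasing) auto
  then show ?thesis using assms norm_triangle_ineq2[of 1 "q ^ m"] by simp
qed

definition xi_logderiv :: "complex \<Rightarrow> complex" where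
  "xi_logderiv s = deriv xi s / xi s"

text \<open>Here \<open>q = q / (1 - q) - q ^ 2 / (1 - q)\<close>. The tail converges for
  \<open>Re s > 1/2\<close>, which is enough for work near the line \<open>Re s = 1\<close>; the
  finer tail of order five is for the expansion at 1.\<close>

abbreviation "prime_tail2 \<equiv> primesum (\<lambda>q. q ^ 2 / (1 - q))"
text \<open>For \<open>|q| < 1\<close>: \<open>q = q/(1-q) - q\<^sup>2/(1-q\<^sup>2) - q\<^sup>3/(1-q\<^sup>3) - q\<^sup>5/((1+q)(1-q\<^sup>3))\<close>.\<close>

abbreviation "prime_tail5 \<equiv> primesum (\<lambda>q. q ^ 5 / ((1 + q) * (1 - q ^ 3)))"

lemma prime_kernel_summable:
  assumes "Re s > 1"
  shows "summable (prime_term (\<lambda>q. q) s)"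
    "primesum (\<lambda>q. q / (1 - q)) s = 1 / (s - 1) - xi_logderiv s"
    "summable (prime_term (\<lambda>q. q / (1 - q)) s)"
  using primesum_summable[of "\<lambda>q. q" 1 "Re s" 1 s] assms logderiv_euler_product[OF assms]
  by (auto simp: primesum_def sums_iff xi_logderiv_def)

lemma two_powr_neg_less_1: "a > 0 \<Longrightarrow> 2 powr (- a) < (1::real)"
  using powr_less_mono[of "- a" 0 "2::real"] by simp

lemma 
  assumes a: "a > 1 / 2"
  shows prime_tail2_summable: "Re s \<ge> a \<Longrightarrow> summable (prime_term (\<lambda>q. q ^ 2 / (1 - q)) s)"
    and prime_tail2_bounded: "\<exists>B>0. \<forall>s. Re s \<ge> a \<longrightarrow> norm (prime_tail2 s) \<le> B"
    and prime_tail2_holomorphic: "prime_tail2 holomorphic_on {s. Re s > a}"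
proof -
  define r where "r = 2 powr (- a)"
  have r: "r < 1" using a by (simp add: r_def two_powr_neg_less_1)
  have V: "(\<lambda>q::complex. q ^ 2 / (1 - q)) holomorphic_on ball 0 1"
    by (auto intro!: holomorphic_intros)
  have bd: "norm (q ^ 2 / (1 - q)) \<le> 1 / (1 - r) * norm q ^ 2" if "norm q \<le> 2 powr (- a)" for q :: complex
    using frac_le[OF _ order.refl _ norm_one_minus_ge[of q r 1], of "norm q ^ 2"] that r
    by (simp add: r_def norm_divide norm_power)
  show "Re s \<ge> a \<Longrightarrow> summable (prime_term (\<lambda>q. q ^ 2 / (1 - q)) s)"
    using r a by (intro primesum_summable[OF V _ bd]) auto
  show "\<exists>B>0. \<forall>s. Re s \<ge> a \<longrightarrow> norm (prime_tail2 s) \<le> B"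
    using r a by (intro primesum_bounded[OF V _ bd]) auto
  show "prime_tail2 holomorphic_on {s. Re s > a}"
    using r a by (intro primesum_holomorphic[OF V _ bd]) auto
qed

text \<open>The kernel vanishes to order five at 0, whence the half-plane \<open>Re s > 1/5\<close>;
  it contains the disc of radius 7/10 around 1.\<close>

lemma 
  assumes a: "a > 1 / 5"
  shows prime_tail5_summable: "Re s \<ge> a \<Longrightarrow> summable (prime_term (\<lambda>q. q ^ 5 / ((1 + q) * (1 - q ^ 3))) s)"
    and prime_tail5_holomorphic: "prime_tail5 holomorphic_on {s. Re s > a}"
proof -
  define r where "r = 2 powr (- a)"
  have r: "r < 1" using a by (simp add: r_def two_powr_neg_less_1)
  have le: "norm ((1 + q) * (1 - q ^ 3)) \<ge> (1 - s) ^ 2" if "norm q \<le> s" "s < 1" for q :: complex and s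
    using mult_mono[OF norm_one_minus_ge[of "- q" s 1] norm_one_minus_ge[of q s 3]] that
    by (simp add: norm_mult power2_eq_square)
  have V: "(\<lambda>q::complex. q ^ 5 / ((1 + q) * (1 - q ^ 3))) holomorphic_on ball 0 1"
  proof (intro holomorphic_intros)
    fix z :: complex assume "z \<in> ball 0 1"
    then have "norm z < 1" by simp
    then show "(1 + z) * (1 - z ^ 3) \<noteq> 0" using le[of z "norm z"] by (metis eq_iff_diff_eq_0 less_irrefl norm_zero not_less zero_less_power2)
  qed
  have bd: "norm (q ^ 5 / ((1 + q) * (1 - q ^ 3))) \<le> 1 / (1 - r) ^ 2 * norm q ^ 5" if "norm q \<le> 2 powr (- a)" for q :: complex
    using frac_le[OF _ order.refl _ le[of q r], of "norm q ^ 5"] that r a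
    by (simp add: r_def norm_divide norm_power)
  show "Re s \<ge> a \<Longrightarrow> summable (prime_term (\<lambda>q. q ^ 5 / ((1 + q) * (1 - q ^ 3))) s)"
    using r a by (intro primesum_summable[OF V _ bd]) auto
  show "prime_tail5 holomorphic_on {s. Re s > a}"
    using r a by (intro primesum_holomorphic[OF V _ bd]) auto
qed

lemma prime_series_eq_tail2:
  assumes s: "Re s > 1"
  shows "primesum (\<lambda>q. q) s = 1 / (s - 1) - xi_logderiv s - prime_tail2 s"
proof -
  have nz: "1 - dpow (real n) s \<noteq> 0" if "prime n" for n
    using norm_dpow_prime(3)[OF that order.refl, of s] s by auto
  have "primesum (\<lambda>q. q / (1 - q)) s - prime_tail2 s = primesum (\<lambda>q. q) s"
    unfolding primesum_def
  proof (subst suminf_diff, goal_cases)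
    case 2 show ?case using s by (intro prime_tail2_summable[of "Re s"]) auto
    case 3 show ?case using nz by (intro suminf_cong) (auto simp: field_simps power2_eq_square)
  qed (use prime_kernel_summable(3)[OF s] in simp)
  then show ?thesis using prime_kernel_summable(2)[OF s] by simp
qed

lemma prime_series_eq_tail5:
  assumes s: "Re s > 1"
  shows "primesum (\<lambda>q. q) s = (1 / (s - 1) - xi_logderiv s) - (1 / (2 * s - 1) - xi_logderiv (2 * s))
    - (1 / (3 * s - 1) - xi_logderiv (3 * s)) - prime_tail5 s"
proof -
  define U where "U = (\<lambda>V n. if prime n then of_real (ln (real n)) * V (dpow (real n) s) else (0::complex))"
  have U: "primesum V s = suminf (U V)" for V by (simp add: primesum_def U_def)
  \<comment> \<open>Replacing \<open>s\<close> by \<open>k * s\<close> replaces \<open>q\<close> by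
    \<open>q ^ k\<close>, so all terms of the identity become kernels at the same
    \<open>s\<close>.\<close>
  have U2: "primesum (\<lambda>q. q / (1 - q)) (of_nat k * s) = suminf (U (\<lambda>q. q ^ k / (1 - q ^ k)))" for k
    by (simp add: primesum_def U_def dpow_power cong: if_cong)
  have S: "summable (U (\<lambda>q. q ^ k / (1 - q ^ k)))" if "k > 0" for k
  proof -
    have "1 * Re s \<le> real k * Re s" using that s by (intro mult_right_mono) auto
    then have "1 < real k * Re s" using s by linarith
    then have "Re (of_nat k * s) > 1" by simp
    from prime_kernel_summable(3)[OF this] show ?thesis by (simp add: U_def dpow_power cong: if_cong)
  qed
  have S5: "summable (U (\<lambda>q. q ^ 5 / ((1 + q) * (1 - q ^ 3))))"
    unfolding U_def using s by (intro prime_tail5_summable[of "Re s"]) auto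
  have *: "U (\<lambda>q. q) n = U (\<lambda>q. q ^ 1 / (1 - q ^ 1)) n - U (\<lambda>q. q ^ 2 / (1 - q ^ 2)) n - U (\<lambda>q. q ^ 3 / (1 - q ^ 3)) n
     - U (\<lambda>q. q ^ 5 / ((1 + q) * (1 - q ^ 3))) n" for n
  proof (cases "prime n")
    case True
    define q where "q = dpow (real n) s"
    have q: "norm q < 1" unfolding q_def using norm_dpow_prime(3)[OF True order.refl, of s] s by simp
    have nz: "1 - q ^ k \<noteq> 0" if "k > 0" for k
    proof
      assume "1 - q ^ k = 0"
      then have "norm (1 - q ^ k) = 0" by (simp only: norm_zero)
      then show False using norm_one_minus_ge[OF order.refl q that] q by linarith
    qed
    have factor: "1 - q ^ 2 = (1 - q) * (1 + q)" by (simp add: power2_eq_square algebra_simps)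
    have nz': "1 + q \<noteq> 0" using nz[of 2] unfolding factor by simp
    have "q ^ 1 / (1 - q ^ 1) - q ^ 2 / (1 - q ^ 2) - q ^ 3 / (1 - q ^ 3) - q ^ 5 / ((1 + q) * (1 - q ^ 3)) = q"
      using nz[of 1] nz[of 3] nz' unfolding factor by (simp add: divide_simps) (simp add: algebra_simps eval_nat_numeral)
    from arg_cong[OF this, of "\<lambda>x. of_real (ln (real n)) * x"]
    show ?thesis using True unfolding U_def by (simp add: q_def[symmetric] algebra_simps)
  qed (simp add: U_def)
  have "primesum (\<lambda>q. q) s = (\<Sum>n. U (\<lambda>q. q ^ 1 / (1 - q ^ 1)) n - U (\<lambda>q. q ^ 2 / (1 - q ^ 2)) n - U (\<lambda>q. q ^ 3 / (1 - q ^ 3)) n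
     - U (\<lambda>q. q ^ 5 / ((1 + q) * (1 - q ^ 3))) n)"
    unfolding U by (rule suminf_cong) (rule *)
  also have "\<dots> = primesum (\<lambda>q. q / (1 - q)) (of_nat 1 * s) - primesum (\<lambda>q. q / (1 - q)) (of_nat 2 * s)
      - primesum (\<lambda>q. q / (1 - q)) (of_nat 3 * s) - prime_tail5 s"
    unfolding U2 unfolding U using S[of 1] S[of 2] S[of 3] S5
    by (simp only: suminf_diff[symmetric] summable_diff zero_less_numeral zero_less_one)
  finally show ?thesis
    using s prime_kernel_summable(2)[of s] prime_kernel_summable(2)[of "2 * s"] prime_kernel_summable(2)[of "3 * s"]
    by simp
qed

section \<open>A zero-free region\<close>

lemma xi_field_derivative: "Re s > 0 \<Longrightarrow> (xi has_field_derivative deriv xi s) (at s within A)"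
  by (rule has_field_derivative_at_within, rule holomorphic_derivI[OF xi_holomorphic open_halfspace_Re_gt]) simp

lemma xi_continuous_on: "A \<subseteq> {s. Re s > 0} \<Longrightarrow> continuous_on A xi"
  using holomorphic_on_imp_continuous_on[OF xi_holomorphic] continuous_on_subset by blast

lemma xi_logderiv_holomorphic:
  assumes "A \<subseteq> {s. Re s > 0}" "\<And>s. s \<in> A \<Longrightarrow> xi s \<noteq> 0"
  shows "xi_logderiv holomorphic_on A"
proof -
  have "deriv xi holomorphic_on {s. Re s > 0}"
    by (rule holomorphic_deriv[OF xi_holomorphic open_halfspace_Re_gt])
  then show ?thesis unfolding xi_logderiv_def
    using assms by (intro holomorphic_on_divide) (auto intro: holomorphic_on_subset xi_holomorphic)
qed

text \<open>Cauchy's estimate on a circle of radius \<open>d / 2\<close>. The circle stays in the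
  region of \<open>xi_growth\<close>, and its imaginary parts are at most
  \<open>2 * \<bar>Im s\<bar>\<close>, which costs only a constant.\<close>

lemma xi_deriv_growth:
  assumes d: "0 < d" "d \<le> 1 / 2"
  obtains C where "C > 0" 
    "\<And>s. 1 - d / 2 \<le> Re s \<Longrightarrow> Re s \<le> 2 \<Longrightarrow> \<bar>Im s\<bar> \<ge> 2 \<Longrightarrow> norm (deriv xi s) \<le> C * \<bar>Im s\<bar> powr (1 + d)"
proof -
  obtain C where C: "C > 0" "\<And>s. 1 - d \<le> Re s \<Longrightarrow> Re s \<le> 3 \<Longrightarrow> \<bar>Im s\<bar> \<ge> 1 \<Longrightarrow> norm (xi s) \<le> C * \<bar>Im s\<bar> powr (1 + d)"
    using xi_growth[OF d] by blast
  show ?thesis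
  proof
    show "C * 2 powr (1 + d) / (d / 2) > 0" using C d by simp
    fix s assume s: "1 - d / 2 \<le> Re s" "Re s \<le> 2" "\<bar>Im s\<bar> \<ge> 2"
    have near: "\<bar>Re w - Re s\<bar> \<le> d / 2" "\<bar>Im w - Im s\<bar> \<le> d / 2" if "norm (s - w) \<le> d / 2" for w
      using abs_Re_le_cmod[of "w - s"] abs_Im_le_cmod[of "w - s"] that by (auto simp: norm_minus_commute)
    have sub: "cball s (d / 2) \<subseteq> {s. Re s > 0}"
    proof
      fix w assume "w \<in> cball s (d / 2)"
      then have "\<bar>Re w - Re s\<bar> \<le> d / 2" by (intro near) (simp add: dist_norm)
      then show "w \<in> {s. Re s > 0}" using s d unfolding mem_Collect_eq by linarith
    qed
    have "norm ((deriv ^^ 1) xi s) \<le> fact 1 * (C * (2 powr (1 + d) * \<bar>Im s\<bar> powr (1 + d))) / (d / 2) ^ 1"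
    proof (rule Cauchy_inequality)
      show "xi holomorphic_on ball s (d / 2)" using sub ball_subset_cball by (blast intro: holomorphic_on_subset[OF xi_holomorphic])
      show "continuous_on (cball s (d / 2)) xi" using sub by (rule xi_continuous_on)
      fix w assume "norm (s - w) = d / 2"
      then have "1 - d \<le> Re w" "Re w \<le> 3" "\<bar>Im w\<bar> \<ge> 1" "\<bar>Im w\<bar> \<le> 2 * \<bar>Im s\<bar>"
        using near[of w] s d by auto
      then have "norm (xi w) \<le> C * (2 * \<bar>Im s\<bar>) powr (1 + d)"
        using C(2)[of w] powr_mono2[of "1 + d" "\<bar>Im w\<bar>" "2 * \<bar>Im s\<bar>"] C(1) d
        by (meson abs_ge_zero add_nonneg_nonneg less_imp_le mult_left_mono order.trans zero_le_one)
      then show "norm (xi w) \<le> C * (2 powr (1 + d) * \<bar>Im s\<bar> powr (1 + d))"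
        by (simp add: powr_mult)
    qed (use d in auto)
    then show "norm (deriv xi s) \<le> C * 2 powr (1 + d) / (d / 2) * \<bar>Im s\<bar> powr (1 + d)"
      by (simp add: mult_ac)
  qed
qed

text \<open>In the 3-4-1 inequality, with \<open>a = Re s\<close> and
  \<open>t = \<bar>Im s\<bar>\<close>, zeta is at most \<open>K / (a - 1)\<close> at the real point
  and of order \<open>t^d\<close> at height \<open>2t\<close>. This bounds the fourth power at
  height \<open>t\<close> from below by a multiple of \<open>(a - 1)^3 * t^(-d)\<close>; passing
  from zeta to \<open>xi\<close> contributes \<open>t^4\<close>.\<close>

lemma xi_lower_bound_right:
  assumes d: "0 < d" "d \<le> 1 / 2"
  obtains k where "k > 0"
    "\<And>s. 1 < Re s \<Longrightarrow> Re s \<le> 2 \<Longrightarrow> \<bar>Im s\<bar> \<ge> 2 \<Longrightarrow> norm (xi s) ^ 4 \<ge> k * (Re s - 1) ^ 3 * \<bar>Im s\<bar> powr (4 - d)"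
proof -
  obtain C where C: "C > 0" "\<And>s. 1 - d \<le> Re s \<Longrightarrow> Re s \<le> 3 \<Longrightarrow> \<bar>Im s\<bar> \<ge> 1 \<Longrightarrow> norm (xi s) \<le> C * \<bar>Im s\<bar> powr (1 + d)"
    using xi_growth[OF d] by blast
  have "compact (of_real ` {1..2} :: complex set)"
    by (intro compact_continuous_image continuous_intros) auto
  then have "bounded (xi ` of_real ` {1..2})"
    by (intro compact_imp_bounded compact_continuous_image xi_continuous_on) auto
  then obtain K where K: "K > 0" "\<And>a. 1 \<le> a \<Longrightarrow> a \<le> 2 \<Longrightarrow> norm (xi (of_real a)) \<le> K"
    unfolding bounded_pos by force
  show ?thesis
  proof
    show "1 / (K ^ 3 * (4 * C)) > 0" using K C by simp
    fix s assume s: "1 < Re s" "Re s \<le> 2" "\<bar>Im s\<bar> \<ge> 2"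
    define a where "a = Re s"
    define t where "t = \<bar>Im s\<bar>"
    define s2 where "s2 = Complex a (2 * Im s)"
    have seq: "s = Complex a (Im s)" by (simp add: a_def complex_eq_iff)
    have a: "a > 1" "a \<le> 2" and t: "t \<ge> 2" using s by (auto simp: a_def t_def)
    have "1 \<le> norm (zeta_series (of_real a)) ^ 3 * norm (zeta_series s) ^ 4 * norm (zeta_series s2)"
      using three_four_one[OF a(1), of "Im s"] seq by (simp add: s2_def)
    also have "\<dots> \<le> (K / (a - 1)) ^ 3 * (norm (xi s) / t) ^ 4 * (4 * C * t powr d)"
    proof (intro mult_mono power_mono)
      have "norm (of_real a - (1::complex)) = \<bar>a - 1\<bar>" by (metis norm_of_real of_real_1 of_real_diff)
      then have "(a - 1) * norm (zeta_series (of_real a)) = norm (xi (of_real a))"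
        using xi_eq_zeta_series[of "of_real a"] a by (simp add: norm_mult)
      then show "norm (zeta_series (of_real a)) \<le> K / (a - 1)"
        using K(2)[of a] a by (simp add: pos_le_divide_eq mult.commute)
      have "t * norm (zeta_series s) \<le> norm (s - 1) * norm (zeta_series s)"
        using abs_Im_le_cmod[of "s - 1"] by (intro mult_right_mono) (auto simp: t_def)
      also have "\<dots> = norm (xi s)" using xi_eq_zeta_series[of s] s by (simp add: norm_mult)
      finally show "norm (zeta_series s) \<le> norm (xi s) / t" using t by (simp add: field_simps)
      have "t * norm (zeta_series s2) \<le> norm (s2 - 1) * norm (zeta_series s2)"
        using abs_Im_le_cmod[of "s2 - 1"] by (intro mult_right_mono) (auto simp: t_def s2_def)
      also have "\<dots> = norm (xi s2)" using xi_eq_zeta_series[of s2] a by (simp add: norm_mult s2_def)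
      also have "\<dots> \<le> C * (2 * t) powr (1 + d)"
        using C(2)[of s2] a t d by (simp add: s2_def t_def abs_mult)
      also have "(2 * t) powr (1 + d) = 2 powr (1 + d) * (t * t powr d)"
        using t by (simp add: powr_mult powr_add)
      also have "C * (2 powr (1 + d) * (t * t powr d)) \<le> C * (2 powr 2 * (t * t powr d))"
        using C d t by (intro mult_left_mono mult_right_mono powr_mono) auto
      also have "\<dots> = t * (4 * C * t powr d)" by simp
      finally show "norm (zeta_series s2) \<le> 4 * C * t powr d" using t by (simp add: mult_le_cancel_left_pos)
    qed (use a t K C in auto)
    finally have "(a - 1) ^ 3 * t ^ 4 \<le> K ^ 3 * (4 * C) * norm (xi s) ^ 4 * t powr d"
      using a t by (simp add: field_simps power_divide)
    then have "(a - 1) ^ 3 * t ^ 4 * t powr (- d) \<le> K ^ 3 * (4 * C) * norm (xi s) ^ 4 * t powr d * t powr (- d)"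
      by (intro mult_right_mono) auto
    moreover have "t powr 4 = t ^ 4" using t by simp
    then have "t ^ 4 * t powr (- d) = t powr (4 - d)"
      by (metis powr_add add_uminus_conv_diff)
    moreover have "t powr d * t powr (- d) = 1"
      using t by (simp flip: powr_add)
    ultimately have "(a - 1) ^ 3 * t powr (4 - d) \<le> K ^ 3 * (4 * C) * norm (xi s) ^ 4"
      by (simp add: mult.assoc)
    then show "norm (xi s) ^ 4 \<ge> 1 / (K ^ 3 * (4 * C)) * (Re s - 1) ^ 3 * \<bar>Im s\<bar> powr (4 - d)"
      using K C by (simp add: a_def t_def field_simps)
  qed
qed

text \<open>
  The lower bound at \<open>Re s = 1 + h\<close> is of order \<open>h\<^bsup>3/4\<^esup>\<close>, whereas moving to \<open>Re s \<ge> 1 - h\<close> costs only order \<open>h\<close>;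
  so a small negative power of \<open>|Im s|\<close> can be chosen for \<open>h\<close>.
\<close>

lemma xi_zero_free_high:
  assumes d: "0 < d" "d \<le> 1 / 8"
  obtains c C where "c > 0" "c \<le> 1 / 2" "C > 0"
    "\<And>s. \<bar>Im s\<bar> \<ge> 2 \<Longrightarrow> 1 - c * \<bar>Im s\<bar> powr (- (8 * d)) \<le> Re s \<Longrightarrow> Re s \<le> 1 \<Longrightarrow>
       xi s \<noteq> 0 \<and> norm (xi_logderiv s) \<le> C * \<bar>Im s\<bar> ^ 2"
proof -
  have d2: "d \<le> 1 / 2" using d by simp
  obtain C where C: "C > 0" "\<And>s. 1 - d / 2 \<le> Re s \<Longrightarrow> Re s \<le> 2 \<Longrightarrow> \<bar>Im s\<bar> \<ge> 2 \<Longrightarrow> norm (deriv xi s) \<le> C * \<bar>Im s\<bar> powr (1 + d)"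
    using xi_deriv_growth[OF d(1) d2] by blast
  obtain k0 where k0: "k0 > 0"
    "\<And>s. 1 < Re s \<Longrightarrow> Re s \<le> 2 \<Longrightarrow> \<bar>Im s\<bar> \<ge> 2 \<Longrightarrow> norm (xi s) ^ 4 \<ge> k0 * (Re s - 1) ^ 3 * \<bar>Im s\<bar> powr (4 - d)"
    using xi_lower_bound_right[OF d(1) d2] by blast
  define k where "k = root 4 k0"
  have k: "k > 0" "k ^ 4 = k0" using k0 by (auto simp: k_def)
  \<comment> \<open>The first entry keeps \<open>u ^ 4\<close> below \<open>d / 2\<close>, inside
    the region where the derivative is controlled; the second makes the loss along the segment at
    most half of the lower bound.\<close>
  define u where "u = min (d / 2) (k / (4 * C))"
  have u: "u > 0" "u \<le> d / 2" "4 * C * u \<le> k"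
    using d k C by (auto simp: u_def min_def field_simps)
  have "u ^ 4 \<le> u ^ 1" using u d by (intro power_decreasing) auto
  then have u4: "u ^ 4 \<le> d / 2" using u by simp
  show ?thesis
  proof
    show "u ^ 4 > 0" "u ^ 4 \<le> 1 / 2" "C / (k / 2 * u ^ 3) > 0" using u u4 d k C by auto
    fix s assume s: "\<bar>Im s\<bar> \<ge> 2" "1 - u ^ 4 * \<bar>Im s\<bar> powr (- (8 * d)) \<le> Re s" "Re s \<le> 1"
    define t where "t = \<bar>Im s\<bar>"
    define h where "h = u ^ 4 * t powr (- (8 * d))"
    \<comment> \<open>The comparison point to the right of the line, at the same height as
      \<open>s\<close>.\<close>
    define w where "w = Complex (1 + h) (Im s)"
    have t: "t \<ge> 2" using s by (simp add: t_def)
    have "t powr (- (8 * d)) \<le> t powr 0" using t d by (intro powr_mono) auto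
    then have "h \<le> u ^ 4 * 1" unfolding h_def using u t by (intro mult_left_mono) auto
    then have h: "h \<le> d / 2" "h > 0" using u4 by linarith (use u t in \<open>simp add: h_def\<close>)
    have pp: "(t powr x) ^ n = t powr (real n * x)" for x n
      using t by (simp add: powr_power mult.commute)
    \<comment> \<open>The exponent \<open>1 - 7 * d\<close> is that of the loss
      \<open>h * t powr (1 + d)\<close>. The lower bound at \<open>w\<close> has the larger exponent
      \<open>1 - 25 * d / 4\<close> and is weakened to match; the loss then carries
      \<open>u ^ 4\<close> against \<open>u ^ 3\<close>, and a small \<open>u\<close>
      decides.\<close>
    have "(k * u ^ 3 * t powr (1 - 7 * d)) ^ 4 = k ^ 4 * (u ^ 3) ^ 4 * (t powr (1 - 7 * d)) ^ 4"
      by (simp only: power_mult_distrib)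
    also have "(t powr (1 - 7 * d)) ^ 4 = t powr (4 - 28 * d)"
      unfolding pp by (simp add: algebra_simps)
    also have "k ^ 4 * (u ^ 3) ^ 4 * t powr (4 - 28 * d) = k0 * u ^ 12 * t powr (4 - 28 * d)"
      using k by (simp flip: power_mult)
    also have "\<dots> \<le> k0 * u ^ 12 * t powr (4 - 25 * d)"
      using t d k0 u by (intro mult_left_mono powr_mono) auto
    also have "\<dots> = k0 * h ^ 3 * t powr (4 - d)"
    proof -
      have "h ^ 3 = u ^ 12 * t powr (- (24 * d))"
        unfolding h_def power_mult_distrib pp by (simp flip: power_mult)
      moreover have "t powr (- (24 * d)) * t powr (4 - d) = t powr (4 - 25 * d)"
        by (simp flip: powr_add)
      ultimately show ?thesis by (simp add: mult.assoc)
    qed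
    also have "\<dots> \<le> norm (xi w) ^ 4"
      using k0(2)[of w] h t d by (simp add: w_def t_def)
    finally have low: "k * u ^ 3 * t powr (1 - 7 * d) \<le> norm (xi w)"
      by (rule power_le_imp_le_base[of _ 3, simplified]) simp
    have "norm (xi s - xi w) \<le> C * t powr (1 + d) * norm (s - w)"
    proof (rule field_differentiable_bound[OF convex_closed_segment])
      fix z assume "z \<in> closed_segment s w"
      then have z: "Im z = Im s" "Re z \<ge> Re s" "Re z \<le> 1 + h"
        using h s by (auto simp: closed_segment_same_Im w_def closed_segment_eq_real_ivl split: if_splits)
      have "Re z \<ge> 1 - d / 2" using z h s by (simp add: h_def t_def)
      moreover have "Re z \<le> 2" using z h d by simp
      ultimately show "(xi has_field_derivative deriv xi z) (at z within closed_segment s w)" "norm (deriv xi z) \<le> C * t powr (1 + d)"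
        using C(2)[of z] z s d by (auto simp: t_def intro!: xi_field_derivative)
    qed auto
    also have "\<dots> \<le> C * t powr (1 + d) * (2 * h)"
    proof (intro mult_left_mono)
      have "s - w = of_real (Re s - 1 - h)" by (simp add: complex_eq_iff w_def)
      then have "norm (s - w) = \<bar>Re s - 1 - h\<bar>" by (simp only: norm_of_real)
      also have "\<dots> \<le> 2 * h" using s unfolding h_def t_def by linarith
      finally show "norm (s - w) \<le> 2 * h" .
    qed (use C in auto)
    also have "\<dots> = 2 * C * u * u ^ 3 * (t powr (1 + d) * t powr (- (8 * d)))"
      by (simp add: h_def power4_eq_xxxx power3_eq_cube)
    also have "\<dots> = 2 * C * u * u ^ 3 * t powr (1 - 7 * d)"
      by (simp flip: powr_add)
    also have "\<dots> \<le> k / 2 * u ^ 3 * t powr (1 - 7 * d)"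
      using u by (intro mult_right_mono) auto
    finally have "norm (xi s - xi w) \<le> k / 2 * u ^ 3 * t powr (1 - 7 * d)" .
    then have L: "norm (xi s) \<ge> k / 2 * u ^ 3 * t powr (1 - 7 * d)"
      using low norm_triangle_ineq3[of "xi s" "xi w"] by simp
    have pos: "k / 2 * u ^ 3 * t powr (1 - 7 * d) > 0" using k u t by simp
    have "norm (deriv xi s) \<le> C * t powr (1 + d)"
      using C(2)[of s] s h by (simp add: t_def h_def)
    then have "norm (xi_logderiv s) \<le> (C * t powr (1 + d)) / (k / 2 * u ^ 3 * t powr (1 - 7 * d))"
      unfolding xi_logderiv_def norm_divide using C pos L by (intro frac_le) auto
    also have "\<dots> = C / (k / 2 * u ^ 3) * (t powr (1 + d) / t powr (1 - 7 * d))" by simp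
    also have "t powr (1 + d) / t powr (1 - 7 * d) = t powr (8 * d)" by (simp add: powr_diff[symmetric])
    also have "C / (k / 2 * u ^ 3) * t powr (8 * d) \<le> C / (k / 2 * u ^ 3) * t powr 2"
      using t d C k u by (intro mult_left_mono powr_mono) auto
    finally show "xi s \<noteq> 0 \<and> norm (xi_logderiv s) \<le> C / (k / 2 * u ^ 3) * \<bar>Im s\<bar> ^ 2"
      using L pos t by (auto simp: t_def)
  qed
qed

text \<open>Heights of at least 2 come from \<open>xi_zero_free_high\<close> with
  \<open>d = e / 8\<close>, the rest from compactness and the explicit region of
  \<open>xi_nonzero\<close>. The statement is uniform over boxes of height \<open>R\<close>, the
  shape of the contours below.\<close>

lemma xi_zero_free:
  assumes e: "0 < e" "e \<le> 1"
  obtains c C where "c > 0" "c \<le> 1 / 2" "C > 0"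
    "\<And>R s. R \<ge> 2 \<Longrightarrow> \<bar>Im s\<bar> \<le> R \<Longrightarrow> 1 - c * R powr (- e) \<le> Re s \<Longrightarrow> Re s \<le> 1 \<Longrightarrow>
       xi s \<noteq> 0 \<and> norm (xi_logderiv s) \<le> C * R ^ 2"
proof -
  obtain c C where c: "c > 0" "c \<le> 1 / 2" "C > 0" and
    high: "\<And>s. \<bar>Im s\<bar> \<ge> 2 \<Longrightarrow> 1 - c * \<bar>Im s\<bar> powr (- e) \<le> Re s \<Longrightarrow> Re s \<le> 1 \<Longrightarrow>
       xi s \<noteq> 0 \<and> norm (xi_logderiv s) \<le> C * \<bar>Im s\<bar> ^ 2"
    using xi_zero_free_high[of "e / 8"] e by auto
  define B where "B = cbox (Complex (1 / 2) (- 2)) (Complex 1 2)"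
  have B: "s \<in> B \<longleftrightarrow> 1 / 2 \<le> Re s \<and> Re s \<le> 1 \<and> \<bar>Im s\<bar> \<le> 2" for s
    by (auto simp: B_def in_cbox_complex_iff)
  have nzB: "xi s \<noteq> 0" if "s \<in> B" for s
  proof (rule xi_nonzero)
    have s: "1 / 2 \<le> Re s" "Re s \<le> 1" "\<bar>Im s\<bar> \<le> 2" using that by (auto simp: B)
    have i: "(Im s)\<^sup>2 \<le> 4" using s abs_le_square_iff[of "Im s" 2] by simp
    have "(Re s)\<^sup>2 \<le> 1" "(Re s - 1)\<^sup>2 \<le> 1" using s by (auto simp: abs_square_le_1)
    then have "(norm s)\<^sup>2 \<le> 5" "(norm (s - 1))\<^sup>2 \<le> 5" using i by (auto simp: cmod_power2)
    then have "norm s \<le> sqrt 5" "norm (s - 1) \<le> sqrt 5" by (auto intro: real_le_rsqrt)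
    then have "norm s * norm (s - 1) \<le> sqrt 5 * sqrt 5" by (intro mult_mono) auto
    \<comment> \<open>The product is at most 5, while \<open>Re s \<ge> 1/2\<close> makes the right
      side at least 6.\<close>
    then show "norm s * norm (s - 1) < 4 * (Re s + 1)" using s by simp
    show "Re s > - 1" using s by simp
  qed
  have "continuous_on B xi_logderiv"
    using nzB by (intro holomorphic_on_imp_continuous_on xi_logderiv_holomorphic) (auto simp: B)
  then have "bounded (xi_logderiv ` B)"
    by (intro compact_imp_bounded compact_continuous_image) (auto simp: B_def)
  then obtain K where K: "K > 0" "\<And>s. s \<in> B \<Longrightarrow> norm (xi_logderiv s) \<le> K"
    unfolding bounded_pos by force
  show ?thesis
  proof
    show "c > 0" "c \<le> 1 / 2" "C + K > 0" using c K by auto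
    fix R s assume R: "R \<ge> (2::real)" and s: "\<bar>Im s\<bar> \<le> R" "1 - c * R powr (- e) \<le> Re s" "Re s \<le> 1"
    show "xi s \<noteq> 0 \<and> norm (xi_logderiv s) \<le> (C + K) * R ^ 2"
    proof (cases "\<bar>Im s\<bar> \<ge> 2")
      case True
      have "R powr (- e) \<le> \<bar>Im s\<bar> powr (- e)" using s True e by (intro powr_mono2') auto
      then have "c * R powr (- e) \<le> c * \<bar>Im s\<bar> powr (- e)" using c by (intro mult_left_mono) auto
      then have "1 - c * \<bar>Im s\<bar> powr (- e) \<le> Re s" using s by linarith
      then have *: "xi s \<noteq> 0" "norm (xi_logderiv s) \<le> C * \<bar>Im s\<bar> ^ 2" using high[of s] True s by auto
      have "C * \<bar>Im s\<bar> ^ 2 \<le> (C + K) * R ^ 2" using c K s by (intro mult_mono power_mono) auto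
      then show ?thesis using * by linarith
    next
      case False
      have "R powr (- e) \<le> R powr 0" using R e by (intro powr_mono) auto
      then have "c * R powr (- e) \<le> c * 1" using c R by (intro mult_left_mono) auto
      then have "1 / 2 \<le> Re s" using s c by linarith
      then have "s \<in> B" using False s by (simp add: B)
      moreover have "K * 1 \<le> (C + K) * R ^ 2" using c K R by (intro mult_mono one_le_power) auto
      ultimately show ?thesis using nzB[of s] K(2)[of s] by auto
    qed
  qed
qed

section \<open>A quantitative form of Newman's Tauberian theorem\<close>

text \<open>Three sides of a rectangle, leading from \<open>-iR\<close> to \<open>iR\<close> by way
  of \<open>Re z = c\<close>; \<open>c\<close> may have either sign. Both halves of Newman's contour
  have the same end points, so the left one can be chosen separately for each function.\<close>

definition bracket_integral :: "real \<Rightarrow> real \<Rightarrow> (complex \<Rightarrow> complex) \<Rightarrow> complex" where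
  "bracket_integral R c \<phi> = contour_integral (linepath (Complex 0 (- R)) (Complex c (- R))) \<phi>
     + contour_integral (linepath (Complex c (- R)) (Complex c R)) \<phi>
     + contour_integral (linepath (Complex c R) (Complex 0 R)) \<phi>"

definition bracket :: "real \<Rightarrow> real \<Rightarrow> complex set" where
  "bracket R c = closed_segment (Complex 0 (- R)) (Complex c (- R)) \<union> closed_segment (Complex c (- R)) (Complex c R)
     \<union> closed_segment (Complex c R) (Complex 0 R)"

lemma bracket_integral_bound:
  assumes cont: "continuous_on (bracket R c) \<phi>" and R: "R \<ge> 0" and Q: "Q1 \<ge> 0" "Q2 \<ge> 0"
    and hor: "\<And>z. \<bar>Im z\<bar> = R \<Longrightarrow> Re z \<in> closed_segment 0 c \<Longrightarrow> norm (\<phi> z) \<le> Q1"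
    and ver: "\<And>z. Re z = c \<Longrightarrow> \<bar>Im z\<bar> \<le> R \<Longrightarrow> norm (\<phi> z) \<le> Q2"
  shows "norm (bracket_integral R c \<phi>) \<le> 2 * Q1 * \<bar>c\<bar> + 2 * R * Q2"
proof -
  have int: "\<phi> contour_integrable_on linepath a b" if "closed_segment a b \<subseteq> bracket R c" for a b
    using continuous_on_subset[OF cont that] by (rule contour_integrable_continuous_linepath)
  have "norm (contour_integral (linepath (Complex 0 (- R)) (Complex c (- R))) \<phi>) \<le> Q1 * norm (Complex c (- R) - Complex 0 (- R))"
    by (intro contour_integral_bound_linepath int Q hor) (use R in \<open>auto simp: bracket_def closed_segment_same_Im\<close>)
  moreover have "norm (contour_integral (linepath (Complex c R) (Complex 0 R)) \<phi>) \<le> Q1 * norm (Complex 0 R - Complex c R)"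
    by (intro contour_integral_bound_linepath int Q hor) (use R in \<open>auto simp: bracket_def closed_segment_same_Im closed_segment_commute\<close>)
  moreover have "norm (contour_integral (linepath (Complex c (- R)) (Complex c R)) \<phi>) \<le> Q2 * norm (Complex c R - Complex c (- R))"
    by (intro contour_integral_bound_linepath int Q ver)
       (use R in \<open>auto simp: bracket_def closed_segment_same_Re closed_segment_eq_real_ivl\<close>)
  moreover have "Complex c (- R) - Complex 0 (- R) = of_real c" "Complex 0 R - Complex c R = of_real (- c)"
      "Complex c R - Complex c (- R) = of_real (2 * R) * \<i>"
    by (auto simp: complex_eq_iff)
  ultimately have "norm (contour_integral (linepath (Complex 0 (- R)) (Complex c (- R))) \<phi>)
     + norm (contour_integral (linepath (Complex c (- R)) (Complex c R)) \<phi>)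
     + norm (contour_integral (linepath (Complex c R) (Complex 0 R)) \<phi>) \<le> Q1 * \<bar>c\<bar> + Q2 * (2 * R) + Q1 * \<bar>c\<bar>"
    using R by (simp add: norm_mult)
  then show ?thesis
    unfolding bracket_integral_def
    by (intro order.trans[OF norm_triangle_ineq] order.trans[OF add_right_mono[OF norm_triangle_ineq]])
       (simp add: algebra_simps)
qed

lemma bracket_integral_diff:
  assumes "continuous_on (bracket R c) \<phi>" "continuous_on (bracket R c) \<psi>"
  shows "bracket_integral R c (\<lambda>z. \<phi> z - \<psi> z) = bracket_integral R c \<phi> - bracket_integral R c \<psi>"
proof -
  have "contour_integral (linepath a b) (\<lambda>z. \<phi> z - \<psi> z) = contour_integral (linepath a b) \<phi> - contour_integral (linepath a b) \<psi>"
    if "closed_segment a b \<subseteq> bracket R c" for a b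
    using that assms by (intro contour_integral_diff contour_integrable_continuous_linepath) (auto intro: continuous_on_subset)
  note * = this
  show ?thesis unfolding bracket_integral_def
    by (subst (1 2 3) *) (auto simp: bracket_def)
qed

lemmas segment_simps = in_cbox_complex_iff closed_segment_same_Im closed_segment_same_Re closed_segment_eq_real_ivl

lemma bracket_subset:
  assumes "R \<ge> 0" "a \<le> 0" "0 \<le> b" "c = a \<or> c = b"
  shows "bracket R c \<subseteq> cbox (Complex a (- R)) (Complex b R)"
  using assms
  by (auto simp: bracket_def segment_simps split: if_splits)

lemma zero_notin_bracket: "R > 0 \<Longrightarrow> c \<noteq> 0 \<Longrightarrow> 0 \<notin> bracket R c"
  by (auto simp: bracket_def closed_segment_same_Im closed_segment_same_Re)

text \<open>The rectangle is the right bracket followed by the reversed left one, and the only pole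
  inside is at 0. The abscissa \<open>a\<close> is free: an entire function allows
  \<open>a = - R\<close>, the continued transform only \<open>a = - d\<close>.\<close>

lemma Cauchy_brackets:
  assumes R: "R > 0" and ab: "a < 0" "0 < b"
    and hol: "\<phi> holomorphic_on cbox (Complex a (- R)) (Complex b R)"
  shows "2 * pi * \<i> * \<phi> 0 = bracket_integral R b (\<lambda>z. \<phi> z / z) - bracket_integral R a (\<lambda>z. \<phi> z / z)"
proof -
  define S where "S = cbox (Complex a (- R)) (Complex b R)"
  define \<psi> where "\<psi> = (\<lambda>z. \<phi> z / z)"
  let ?I = "\<lambda>x y. contour_integral (linepath x y) \<psi>"
  let ?B = "cbox (Complex a (- R)) (Complex b R)"
  let ?r = "rectpath (Complex a (- R)) (Complex b R)"
  have cont\<phi>: "continuous_on S \<phi>" using hol unfolding S_def by (rule holomorphic_on_imp_continuous_on)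
  have cont: "continuous_on (closed_segment x y) \<psi>" if "closed_segment x y \<subseteq> S - {0}" for x y
    unfolding \<psi>_def using that
    by (intro continuous_on_divide continuous_on_subset[OF cont\<phi>] continuous_on_id) auto
  have "((\<lambda>w. \<phi> w / (w - 0)) has_contour_integral (2 * pi * \<i> * winding_number ?r 0 * \<phi> 0)) ?r"
  proof (rule Cauchy_integral_formula_convex_simple[OF _ hol])
    show "convex (?B)" by (rule convex_box)
    show "0 \<in> interior (?B)"
      using R ab by (simp add: in_box_complex_iff)
    show "path_image ?r \<subseteq> ?B - {0}"
      using R ab by (subst path_image_rectpath_cbox_minus_box) (auto simp: in_box_complex_iff)
  qed auto
  moreover have "winding_number ?r 0 = 1"
    using R ab by (intro winding_number_rectpath) (simp add: in_box_complex_iff)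
  ultimately have "2 * pi * \<i> * \<phi> 0 = contour_integral ?r \<psi>"
    unfolding \<psi>_def by (simp add: contour_integral_unique)
  also have "\<dots> = ?I (Complex a (- R)) (Complex b (- R))
     + ?I (Complex b (- R)) (Complex b R)
     + ?I (Complex b R) (Complex a R)
     + ?I (Complex a R) (Complex a (- R))"
  proof -
    have "closed_segment (Complex a (- R)) (Complex b (- R)) \<subseteq> S - {0}" "closed_segment (Complex b (- R)) (Complex b R) \<subseteq> S - {0}"
      "closed_segment (Complex b R) (Complex a R) \<subseteq> S - {0}" "closed_segment (Complex a R) (Complex a (- R)) \<subseteq> S - {0}"
      using R ab by (auto simp: S_def segment_simps split: if_splits)
    then have "\<psi> contour_integrable_on linepath (Complex a (- R)) (Complex b (- R))" "\<psi> contour_integrable_on linepath (Complex b (- R)) (Complex b R)"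
      "\<psi> contour_integrable_on linepath (Complex b R) (Complex a R)" "\<psi> contour_integrable_on linepath (Complex a R) (Complex a (- R))"
      by (auto intro!: contour_integrable_continuous_linepath cont)
    then show ?thesis by (simp add: rectpath_def Let_def)
  qed
  also have "?I (Complex a (- R)) (Complex b (- R)) =
     ?I (Complex a (- R)) (Complex 0 (- R)) + ?I (Complex 0 (- R)) (Complex b (- R))"
    by (rule contour_integral_split_linepath, rule cont)
       (use R ab in \<open>auto simp: S_def segment_simps split: if_splits\<close>)
  also have "?I (Complex b R) (Complex a R) =
     ?I (Complex b R) (Complex 0 R) + ?I (Complex 0 R) (Complex a R)"
    by (rule contour_integral_split_linepath, rule cont)
       (use R ab in \<open>auto simp: S_def segment_simps split: if_splits\<close>)
  also have "?I (Complex a (- R)) (Complex 0 (- R)) = - ?I (Complex 0 (- R)) (Complex a (- R))"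
    by (rule contour_integral_reverse_linepath, rule cont)
       (use R ab in \<open>auto simp: S_def segment_simps split: if_splits\<close>)
  also have "?I (Complex 0 R) (Complex a R) = - ?I (Complex a R) (Complex 0 R)"
    by (rule contour_integral_reverse_linepath, rule cont)
       (use R ab in \<open>auto simp: S_def segment_simps split: if_splits\<close>)
  also have "?I (Complex a R) (Complex a (- R)) = - ?I (Complex a (- R)) (Complex a R)"
    by (rule contour_integral_reverse_linepath, rule cont)
       (use R ab in \<open>auto simp: S_def segment_simps split: if_splits\<close>)
  finally show ?thesis unfolding bracket_integral_def \<psi>_def by simp
qed

text \<open>
  Squaring Newman's kernel makes the trivial bound \<open>|f(t)| \<le> B (1 + t)\<close> sufficient, so that Chebyshev's estimate
  is not needed.
\<close>

definition newman_kernel :: "real \<Rightarrow> complex \<Rightarrow> complex" where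
  "newman_kernel R z = (1 + z ^ 2 / of_real R ^ 2) ^ 2"

text \<open>For \<open>z = x + iy\<close> with \<open>\<bar>y\<bar> = R\<close> one has
  \<open>R^2 + z^2 = x (x + 2iy)\<close>, so the squared kernel is \<open>O(x^2 / R^2)\<close>. This
  cancels the singularity \<open>1 / x^2\<close> of the tail bound at the corners on the imaginary
  axis.\<close>

lemma newman_kernel_bounds:
  assumes R: "R > 0" and z: "\<bar>Re z\<bar> \<le> R" "\<bar>Im z\<bar> \<le> R"
  shows "norm (newman_kernel R z) \<le> 9"
    and "\<bar>Im z\<bar> = R \<Longrightarrow> norm (newman_kernel R z) \<le> 9 * (Re z) ^ 2 / R ^ 2"
proof -
  have sq: "(Re z)\<^sup>2 \<le> R\<^sup>2" "(Im z)\<^sup>2 \<le> R\<^sup>2"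
    using z R by (auto simp flip: abs_le_square_iff)
  then have "(norm z)\<^sup>2 \<le> 2 * R\<^sup>2" by (simp add: cmod_power2)
  then have "norm (z ^ 2 / of_real R ^ 2) \<le> 2" using R by (simp add: norm_divide norm_power divide_simps)
  then have "norm (1 + z ^ 2 / of_real R ^ 2) \<le> 3" using norm_triangle_ineq[of 1 "z ^ 2 / of_real R ^ 2"] by simp
  from power_mono[OF this, of 2] show "norm (newman_kernel R z) \<le> 9"
    by (simp add: newman_kernel_def norm_power)
  assume i: "\<bar>Im z\<bar> = R"
  have "of_real R ^ 2 * (1 + z ^ 2 / of_real R ^ 2) = of_real (R ^ 2) + z ^ 2" using R by (simp add: field_simps)
  also have "\<dots> = of_real (Re z) * (of_real (Re z) + of_real (2 * Im z) * \<i>)"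
    unfolding i[symmetric] power2_abs by (simp add: complex_eq_iff power2_eq_square algebra_simps)
  finally have "R ^ 2 * norm (1 + z ^ 2 / of_real R ^ 2) = \<bar>Re z\<bar> * norm (of_real (Re z) + of_real (2 * Im z) * \<i>)"
    using R by (metis norm_mult norm_of_real norm_power abs_of_pos)
  also have "\<dots> \<le> \<bar>Re z\<bar> * (3 * R)"
    using norm_triangle_ineq[of "of_real (Re z)" "of_real (2 * Im z) * \<i>"] z i
    by (intro mult_left_mono) (auto simp: norm_mult)
  finally have "norm (1 + z ^ 2 / of_real R ^ 2) \<le> 3 * \<bar>Re z\<bar> / R" using R by (simp add: field_simps power2_eq_square)
  from power_mono[OF this, of 2] show "norm (newman_kernel R z) \<le> 9 * (Re z) ^ 2 / R ^ 2"
    by (simp add: newman_kernel_def norm_power power_divide power_mult_distrib)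
qed

lemma newman_kernel_holomorphic [holomorphic_intros]: "newman_kernel R holomorphic_on A"
  unfolding newman_kernel_def by (cases "R = 0") (auto intro!: holomorphic_intros)

text \<open>The function \<open>g\<close> is tied to \<open>f\<close> only for
  \<open>Re z > 0\<close>. Its continuation to the left enters later, as a holomorphy assumption on
  a box.\<close>

locale laplace =
  fixes f :: "real \<Rightarrow> real" and B :: real and gT :: "real \<Rightarrow> complex \<Rightarrow> complex" and g :: "complex \<Rightarrow> complex"
  assumes f_bound: "\<And>t. t \<ge> 0 \<Longrightarrow> \<bar>f t\<bar> \<le> B * (1 + t)"
    and B_nonneg: "B \<ge> 0"
    and gT: "\<And>T z. T \<ge> 0 \<Longrightarrow> ((\<lambda>t. of_real (f t) * exp (- (z * of_real t))) has_integral gT T z) {0..T}"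
    and gT_holomorphic: "\<And>T. T \<ge> 0 \<Longrightarrow> gT T holomorphic_on UNIV"
    and g_lim: "\<And>z. Re z > 0 \<Longrightarrow> ((\<lambda>T. gT T z) \<longlongrightarrow> g z) at_top"
begin

lemma laplace_tail:
  assumes z: "Re z > 0" and T: "T \<ge> 0"
  shows "norm (g z - gT T z) \<le> B * exp (- (Re z * T)) * ((1 + T) / Re z + 1 / (Re z) ^ 2)"
proof -
  define x where "x = Re z"
  have x: "x > 0" using z by (simp add: x_def)
  define H where "H = (\<lambda>t. - B * exp (- (x * t)) * ((1 + t) / x + 1 / x ^ 2))"
  have "norm (gT T' z - gT T z) \<le> - H T" if T': "T' \<ge> T" for T'
  proof -
    have I: "((\<lambda>t. of_real (f t) * exp (- (z * of_real t))) has_integral (gT T' z - gT T z)) {T..T'}"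
    proof -
      have "(\<lambda>t. of_real (f t) * exp (- (z * of_real t))) integrable_on {0..T'}"
        using gT[of T' z] T T' by auto
      then have "(\<lambda>t. of_real (f t) * exp (- (z * of_real t))) integrable_on {T..T'}"
        by (rule integrable_on_subinterval) (use T in auto)
      then obtain y where y: "((\<lambda>t. of_real (f t) * exp (- (z * of_real t))) has_integral y) {T..T'}" by blast
      have "((\<lambda>t. of_real (f t) * exp (- (z * of_real t))) has_integral (gT T z + y)) {0..T'}"
        by (rule has_integral_combine[OF T T' gT[OF T] y])
      then have "gT T z + y = gT T' z" by (rule has_integral_unique) (use gT T T' in auto)
      then show ?thesis using y by (metis add_diff_cancel_left')
    qed
    have J: "((\<lambda>t. B * (1 + t) * exp (- (x * t))) has_integral (H T' - H T)) {T..T'}"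
    proof (intro fundamental_theorem_of_calculus T')
      fix t
      have "(H has_real_derivative B * (1 + t) * exp (- (x * t))) (at t within {T..T'})"
        unfolding H_def using x by (auto intro!: derivative_eq_intros simp: field_simps power2_eq_square)
      then show "(H has_vector_derivative B * (1 + t) * exp (- (x * t))) (at t within {T..T'})"
        by (simp add: has_real_derivative_iff_has_vector_derivative)
    qed
    have "norm (gT T' z - gT T z) \<le> H T' - H T"
      unfolding integral_unique[OF I, symmetric] integral_unique[OF J, symmetric]
    proof (rule integral_norm_bound_integral)
      fix t assume "t \<in> {T..T'}"
      then show "norm (of_real (f t) * exp (- (z * of_real t))) \<le> B * (1 + t) * exp (- (x * t))"
        using f_bound[of t] T by (auto simp: norm_mult x_def)
    qed (use I J in auto)
    also have "H T' \<le> 0" unfolding H_def using B_nonneg x T T' by (auto intro!: mult_nonneg_nonneg add_nonneg_nonneg)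
    finally show ?thesis by simp
  qed
  then have "\<forall>\<^sub>F T' in at_top. norm (gT T' z - gT T z) \<le> - H T"
    unfolding eventually_at_top_linorder by blast
  moreover have "((\<lambda>T'. norm (gT T' z - gT T z)) \<longlongrightarrow> norm (g z - gT T z)) at_top"
    by (intro tendsto_intros g_lim z)
  ultimately have "norm (g z - gT T z) \<le> - H T"
    by (intro tendsto_upperbound) auto
  then show ?thesis by (simp add: H_def x_def)
qed

text \<open>On the left the exponential is largest at \<open>t = T\<close>; the resulting factor
  \<open>exp (- (Re z * T))\<close> is cancelled by the \<open>exp (z * T)\<close> in Newman's
  integrand.\<close>

lemma laplace_partial_bound:
  assumes z: "Re z < 0" and T: "T \<ge> 0"
  shows "norm (gT T z) \<le> B * (1 + T) * exp (- (Re z * T)) / (- Re z)"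
proof -
  define x where "x = Re z"
  have x: "x < 0" using z by (simp add: x_def)
  note I = gT[OF T, of z]
  have J: "((\<lambda>t. B * (1 + T) * exp (- (x * t))) has_integral (B * (1 + T) * exp (- (x * T)) / (- x) - B * (1 + T) * exp (- (x * 0)) / (- x))) {0..T}"
  proof (intro fundamental_theorem_of_calculus T)
    fix t
    have "((\<lambda>t. B * (1 + T) * exp (- (x * t)) / (- x)) has_real_derivative B * (1 + T) * exp (- (x * t))) (at t within {0..T})"
      using x by (auto intro!: derivative_eq_intros simp: field_simps)
    then show "((\<lambda>t. B * (1 + T) * exp (- (x * t)) / (- x)) has_vector_derivative B * (1 + T) * exp (- (x * t))) (at t within {0..T})"
      by (simp add: has_real_derivative_iff_has_vector_derivative)
  qed
  have "norm (gT T z) \<le> B * (1 + T) * exp (- (x * T)) / (- x) - B * (1 + T) * exp (- (x * 0)) / (- x)"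
    unfolding integral_unique[OF I, symmetric] integral_unique[OF J, symmetric]
  proof (rule integral_norm_bound_integral)
    fix t assume t: "t \<in> {0..T}"
    then have "\<bar>f t\<bar> \<le> B * (1 + t)" using f_bound[of t] by simp
    also have "\<dots> \<le> B * (1 + T)" using t B_nonneg by (intro mult_left_mono) auto
    finally show "norm (of_real (f t) * exp (- (z * of_real t))) \<le> B * (1 + T) * exp (- (x * t))"
      by (auto simp: norm_mult x_def)
  qed (use I J in auto)
  also have "\<dots> \<le> B * (1 + T) * exp (- (x * T)) / (- x)"
    using B_nonneg T x by (simp add: divide_nonneg_neg)
  finally show ?thesis by (simp add: x_def)
qed

text \<open>Cauchy's formula for \<open>g\<close> and \<open>gT T\<close>, each multiplied by
  \<open>exp (z * T)\<close> and the kernel. The right bracket of the difference and the left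
  bracket of the entire function \<open>gT T\<close>, pushed out to \<open>- R\<close>, together
  give the first term. The left bracket of \<open>g\<close> at \<open>- d\<close> gives the second
  term on its horizontal sides and the third on its vertical side.\<close>

lemma newman_bound:
  assumes R: "R \<ge> 1" and d: "0 < d" "d \<le> R" and T: "T \<ge> 0"
    and hol: "g holomorphic_on cbox (Complex (- d) (- R)) (Complex R R)"
    and M: "\<And>z. - d \<le> Re z \<Longrightarrow> Re z \<le> 0 \<Longrightarrow> \<bar>Im z\<bar> \<le> R \<Longrightarrow> norm (g z) \<le> M"
  shows "norm (g 0 - gT T 0) \<le> 72 * B * (2 + T) / R + 18 * M * d ^ 3 / R ^ 3 + 18 * M * R * exp (- (d * T)) / d"
proof -
  define E where "E = (\<lambda>z. exp (z * of_real T) * newman_kernel R z)"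
  have E0: "E 0 = 1" by (simp add: E_def newman_kernel_def)
  have holE: "E holomorphic_on A" for A unfolding E_def by (intro holomorphic_intros)
  have "norm (g 0) \<le> M" using d R by (intro M) auto
  then have M0: "M \<ge> 0" by (rule order.trans[OF norm_ge_zero])
  have R0: "R > 0" using R by simp
  define \<phi> where "\<phi> = (\<lambda>z. g z * E z)"
  define \<psi> where "\<psi> = (\<lambda>z. gT T z * E z)"
  have hol\<phi>: "\<phi> holomorphic_on cbox (Complex (- d) (- R)) (Complex R R)" unfolding \<phi>_def by (intro holomorphic_intros hol holE)
  have hol\<psi>: "\<psi> holomorphic_on A" for A
    unfolding \<psi>_def by (intro holomorphic_intros holE holomorphic_on_subset[OF gT_holomorphic[OF T]]) auto
  have c1: "continuous_on (bracket R c) (\<lambda>z. \<phi> z / z)" if "c = R \<or> c = - d" for c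
    using that R d zero_notin_bracket[of R c]
    by (intro continuous_on_divide continuous_on_id continuous_on_subset[OF holomorphic_on_imp_continuous_on[OF hol\<phi>]] bracket_subset) auto
  have c2: "continuous_on (bracket R c) (\<lambda>z. \<psi> z / z)" if "c \<noteq> 0" for c
    using that R d zero_notin_bracket[of R c]
    by (intro continuous_on_divide continuous_on_id holomorphic_on_imp_continuous_on[OF hol\<psi>]) auto
  have nz: "norm z \<ge> \<bar>Re z\<bar>" "norm z \<ge> \<bar>Im z\<bar>" for z by (rule abs_Re_le_cmod abs_Im_le_cmod)+
  have div: "norm (a / z) \<le> X / y" if "norm a \<le> X" "norm z \<ge> y" "y > 0" for a z :: complex and X y
    unfolding norm_divide using that order.trans[OF norm_ge_zero that(1)] by (intro frac_le) auto
  have ker: "norm (h * E z) = norm h * exp (Re z * T) * norm (newman_kernel R z)" for h z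
    by (simp add: E_def norm_mult)

  have b1: "norm (bracket_integral R R (\<lambda>z. \<phi> z / z - \<psi> z / z)) \<le> 2 * (9 * B * (2 + T) / R ^ 2) * \<bar>R\<bar> + 2 * R * (9 * B * (2 + T) / R ^ 2)"
  proof (rule bracket_integral_bound)
    show "continuous_on (bracket R R) (\<lambda>z. \<phi> z / z - \<psi> z / z)" using R by (intro continuous_on_diff c1 c2) auto
    have *: "norm (\<phi> z / z - \<psi> z / z) \<le> (9 * B * (2 + T) / R) / R"
      if z: "\<bar>Im z\<bar> \<le> R" "0 \<le> Re z" "Re z \<le> R" "Re z = R \<or> \<bar>Im z\<bar> = R" for z
    proof -
      have K: "norm (newman_kernel R z) \<le> 9 * (Re z) ^ 2 / R ^ 2"
        using newman_kernel_bounds[of R z] z R by auto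
      have "norm ((g z - gT T z) * E z) \<le> 9 * B * (2 + T) / R"
      proof (cases "Re z = 0")
        case True
        \<comment> \<open>This is a corner \<open>\<plusminus>iR\<close>, where the tail bound is
          void but the kernel vanishes.\<close>
        then have "newman_kernel R z = 0" using K by simp
        then show ?thesis using B_nonneg T R by (simp add: E_def)
      next
        case False
        then have x: "Re z > 0" using z by simp
        have "norm (g z - gT T z) * exp (Re z * T) \<le> B * exp (- (Re z * T)) * ((1 + T) / Re z + 1 / (Re z) ^ 2) * exp (Re z * T)"
          using laplace_tail[OF x T] by (intro mult_right_mono) auto
        also have "\<dots> = B * ((1 + T) / Re z + 1 / (Re z) ^ 2)" by (simp add: exp_minus field_simps)
        finally have "norm (g z - gT T z) * exp (Re z * T) \<le> B * ((1 + T) / Re z + 1 / (Re z) ^ 2)" .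
        moreover have "B * ((1 + T) / Re z + 1 / (Re z) ^ 2) \<ge> 0" using x T B_nonneg by simp
        ultimately have "norm ((g z - gT T z) * E z) \<le> B * ((1 + T) / Re z + 1 / (Re z) ^ 2) * (9 * (Re z) ^ 2 / R ^ 2)"
          unfolding ker by (rule mult_mono[OF _ K]) simp
        also have "\<dots> = 9 * B * ((1 + T) * Re z + 1) / R ^ 2"
          using x R by (simp add: field_simps power2_eq_square)
        also have "\<dots> \<le> 9 * B * ((1 + T) * R + R) / R ^ 2"
          using z R T B_nonneg by (intro divide_right_mono mult_left_mono add_mono) auto
        also have "\<dots> = 9 * B * (2 + T) / R" using R by (simp add: field_simps power2_eq_square)
        finally show ?thesis .
      qed
      moreover have "norm z \<ge> R" using nz[of z] z by auto
      ultimately have "norm ((g z - gT T z) * E z / z) \<le> (9 * B * (2 + T) / R) / R" using R by (intro div) auto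
      then show ?thesis by (simp add: \<phi>_def \<psi>_def diff_divide_distrib left_diff_distrib)
    qed
    show "norm (\<phi> z / z - \<psi> z / z) \<le> 9 * B * (2 + T) / R ^ 2" if "\<bar>Im z\<bar> = R" "Re z \<in> closed_segment 0 R" for z
      using *[of z] that R by (auto simp: closed_segment_eq_real_ivl power2_eq_square)
    show "norm (\<phi> z / z - \<psi> z / z) \<le> 9 * B * (2 + T) / R ^ 2" if "Re z = R" "\<bar>Im z\<bar> \<le> R" for z
      using *[of z] that R by (auto simp: power2_eq_square)
  qed (use R B_nonneg T in auto)

  have b2: "norm (bracket_integral R (- R) (\<lambda>z. \<psi> z / z)) \<le> 2 * (9 * B * (2 + T) / R ^ 2) * \<bar>- R\<bar> + 2 * R * (9 * B * (2 + T) / R ^ 2)"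
  proof (rule bracket_integral_bound)
    show "continuous_on (bracket R (- R)) (\<lambda>z. \<psi> z / z)" using R by (intro c2) auto
    have *: "norm (\<psi> z / z) \<le> (9 * B * (2 + T) / R) / R"
      if z: "\<bar>Im z\<bar> \<le> R" "Re z \<le> 0" "- R \<le> Re z" "Re z = - R \<or> \<bar>Im z\<bar> = R" for z
    proof -
      have K: "norm (newman_kernel R z) \<le> 9 * (Re z) ^ 2 / R ^ 2"
        using newman_kernel_bounds[of R z] z R by auto
      have "norm (gT T z * E z) \<le> 9 * B * (2 + T) / R"
      proof (cases "Re z = 0")
        case True
        then have "newman_kernel R z = 0" using K by simp
        then show ?thesis using B_nonneg T R by (simp add: E_def)
      next
        case False
        then have x: "Re z < 0" using z by simp
        have "norm (gT T z) * exp (Re z * T) \<le> B * (1 + T) * exp (- (Re z * T)) / (- Re z) * exp (Re z * T)"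
          using laplace_partial_bound[OF x T] by (intro mult_right_mono) auto
        also have "\<dots> = B * (1 + T) / (- Re z) * (exp (- (Re z * T)) * exp (Re z * T))" by simp
        also have "\<dots> = B * (1 + T) / (- Re z)" by (simp flip: exp_add)
        finally have "norm (gT T z) * exp (Re z * T) \<le> B * (1 + T) / (- Re z)" .
        moreover have "B * (1 + T) / (- Re z) \<ge> 0" using x T B_nonneg by (intro divide_nonneg_pos) auto
        ultimately have "norm (gT T z * E z) \<le> B * (1 + T) / (- Re z) * (9 * (Re z) ^ 2 / R ^ 2)"
          unfolding ker by (rule mult_mono[OF _ K]) simp
        also have "\<dots> = 9 * B * (1 + T) * (- Re z) / R ^ 2"
          using x R by (simp add: field_simps power2_eq_square)
        also have "\<dots> \<le> 9 * B * (2 + T) * R / R ^ 2"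
          using z R T B_nonneg by (intro divide_right_mono mult_mono mult_left_mono) auto
        also have "\<dots> = 9 * B * (2 + T) / R" using R by (simp add: field_simps power2_eq_square)
        finally show ?thesis .
      qed
      moreover have "norm z \<ge> R" using nz[of z] z by auto
      ultimately have "norm (gT T z * E z / z) \<le> (9 * B * (2 + T) / R) / R" using R by (intro div) auto
      then show ?thesis by (simp add: \<psi>_def)
    qed
    show "norm (\<psi> z / z) \<le> 9 * B * (2 + T) / R ^ 2" if "\<bar>Im z\<bar> = R" "Re z \<in> closed_segment 0 (- R)" for z
      using *[of z] that R by (auto simp: closed_segment_eq_real_ivl power2_eq_square)
    show "norm (\<psi> z / z) \<le> 9 * B * (2 + T) / R ^ 2" if "Re z = - R" "\<bar>Im z\<bar> \<le> R" for z
      using *[of z] that R by (auto simp: power2_eq_square)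
  qed (use R B_nonneg T in auto)

  have b3: "norm (bracket_integral R (- d) (\<lambda>z. \<phi> z / z)) \<le> 2 * (9 * M * d ^ 2 / R ^ 3) * \<bar>- d\<bar> + 2 * R * (9 * M * exp (- (d * T)) / d)"
  proof (rule bracket_integral_bound)
    show "continuous_on (bracket R (- d)) (\<lambda>z. \<phi> z / z)" by (intro c1) auto
    show "norm (\<phi> z / z) \<le> 9 * M * d ^ 2 / R ^ 3" if z: "\<bar>Im z\<bar> = R" "Re z \<in> closed_segment 0 (- d)" for z
    proof -
      have x: "- d \<le> Re z" "Re z \<le> 0" using z d by (auto simp: closed_segment_eq_real_ivl split: if_splits)
      have K: "norm (newman_kernel R z) \<le> 9 * (Re z) ^ 2 / R ^ 2"
        using newman_kernel_bounds(2)[of R z] z x d R by auto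
      also have "\<dots> \<le> 9 * d ^ 2 / R ^ 2"
        using x d by (intro divide_right_mono mult_left_mono) (auto simp flip: abs_le_square_iff)
      finally have "norm (\<phi> z) \<le> M * 1 * (9 * d ^ 2 / R ^ 2)"
        unfolding \<phi>_def ker using M[of z] x z M0 T by (intro mult_mono) (auto simp: mult_nonpos_nonneg)
      then have "norm (\<phi> z / z) \<le> M * 1 * (9 * d ^ 2 / R ^ 2) / R"
        using nz(2)[of z] z R by (intro div) auto
      then show ?thesis using R by (simp add: power3_eq_cube power2_eq_square mult_ac)
    qed
    show "norm (\<phi> z / z) \<le> 9 * M * exp (- (d * T)) / d" if z: "Re z = - d" "\<bar>Im z\<bar> \<le> R" for z
    proof -
      have "norm (newman_kernel R z) \<le> 9" using newman_kernel_bounds(1)[of R z] z d R by auto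
      then have "norm (\<phi> z) \<le> M * exp (- (d * T)) * 9"
        unfolding \<phi>_def ker using M[of z] z M0 d by (intro mult_mono) auto
      then have "norm (\<phi> z / z) \<le> M * exp (- (d * T)) * 9 / d"
        using nz(1)[of z] z d by (intro div) auto
      then show ?thesis by (simp add: mult_ac)
    qed
  qed (use R M0 d in auto)

  have "2 * pi * \<i> * (g 0 - gT T 0) = 2 * pi * \<i> * \<phi> 0 - 2 * pi * \<i> * \<psi> 0"
    by (simp add: \<phi>_def \<psi>_def E0 algebra_simps)
  also have "\<dots> = bracket_integral R R (\<lambda>z. \<phi> z / z - \<psi> z / z) + bracket_integral R (- R) (\<lambda>z. \<psi> z / z) - bracket_integral R (- d) (\<lambda>z. \<phi> z / z)"
    using Cauchy_brackets[OF R0 _ _ hol\<phi>] Cauchy_brackets[OF R0 _ _ hol\<psi>, of "- R" R] d R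
      bracket_integral_diff[of R R "\<lambda>z. \<phi> z / z" "\<lambda>z. \<psi> z / z"] c1[of R] c2[of R] by simp
  finally have "norm (2 * pi * \<i> * (g 0 - gT T 0)) \<le> norm (bracket_integral R R (\<lambda>z. \<phi> z / z - \<psi> z / z)) + norm (bracket_integral R (- R) (\<lambda>z. \<psi> z / z))
      + norm (bracket_integral R (- d) (\<lambda>z. \<phi> z / z))"
    by (simp only:) (intro order.trans[OF norm_triangle_ineq4] add_right_mono norm_triangle_ineq)
  also have "\<dots> \<le> 72 * B * (2 + T) / R + 18 * M * d ^ 3 / R ^ 3 + 18 * M * R * exp (- (d * T)) / d"
  proof -
    define P Q S where "P = B * (2 + T) / R" and "Q = M * d ^ 3 / R ^ 3" and "S = M * R * exp (- (d * T)) / d"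
    have "2 * (9 * B * (2 + T) / R ^ 2) * \<bar>R\<bar> = 18 * P" "2 * R * (9 * B * (2 + T) / R ^ 2) = 18 * P"
      "2 * (9 * B * (2 + T) / R ^ 2) * \<bar>- R\<bar> = 18 * P"
      "2 * (9 * M * d ^ 2 / R ^ 3) * \<bar>- d\<bar> = 18 * Q" "2 * R * (9 * M * exp (- (d * T)) / d) = 18 * S"
      using R d by (simp_all add: P_def Q_def S_def power2_eq_square power3_eq_cube)
    note b = b1[unfolded this] b2[unfolded this] b3[unfolded this]
    have "72 * B * (2 + T) / R = 72 * P" "18 * M * d ^ 3 / R ^ 3 = 18 * Q" "18 * M * R * exp (- (d * T)) / d = 18 * S"
      by (simp_all add: P_def Q_def S_def)
    then show ?thesis using b by linarith
  qed
  finally have *: "2 * pi * norm (g 0 - gT T 0) \<le> 72 * B * (2 + T) / R + 18 * M * d ^ 3 / R ^ 3 + 18 * M * R * exp (- (d * T)) / d"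
    by (simp add: norm_mult)
  have "1 * norm (g 0 - gT T 0) \<le> 2 * pi * norm (g 0 - gT T 0)"
    using pi_gt3 by (intro mult_right_mono) auto
  then show ?thesis using * by linarith
qed

end

section \<open>Chebyshev's function and its Laplace transform\<close>

text \<open>The variable is \<open>T = log x\<close>, which turns Mellin transforms in
  \<open>x\<close> into Laplace transforms and powers of logarithms into powers of
  \<open>T\<close>.\<close>

definition primes_exp :: "real \<Rightarrow> nat set" where
  "primes_exp T = {p. prime p \<and> real p \<le> exp T}"

definition theta_exp :: "real \<Rightarrow> real" where
  "theta_exp T = (\<Sum>p\<in>primes_exp T. ln (real p))"

definition theta_error :: "real \<Rightarrow> real" where
  "theta_error t = theta_exp t * exp (- t) - 1"

lemma ln_le_iff_le_exp: "0 < x \<Longrightarrow> ln x \<le> T \<longleftrightarrow> x \<le> exp T"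
  for x T :: real
  using ln_le_cancel_iff[of x "exp T"] by simp

lemma primes_exp_eq: "primes_exp T = primes_below (Suc (nat \<lfloor>exp T\<rfloor>))"
proof -
  have "real p \<le> exp T \<longleftrightarrow> p \<le> nat \<lfloor>exp T\<rfloor>" for p
    using le_nat_floor[of p "exp T"] of_nat_floor[of "exp T"] of_nat_mono[of p "nat \<lfloor>exp T\<rfloor>", where 'a = real]
    by (meson exp_ge_zero order.trans)
  then show ?thesis by (simp add: primes_exp_def primes_below_def less_Suc_eq_le)
qed

lemma finite_primes_exp [simp]: "finite (primes_exp T)"
  by (simp add: primes_exp_eq)

lemma primes_exp_ln:
  assumes "p \<in> primes_exp T"
  shows "prime p" "real p > 0" "0 \<le> ln (real p)" "ln (real p) \<le> T"
proof -
  show p: "prime p" using assms by (simp add: primes_exp_def)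
  show p0: "real p > 0" using prime_gt_0_nat[OF p] by simp
  show "0 \<le> ln (real p)" using prime_ge_1_nat[OF p] by simp
  show "ln (real p) \<le> T" using assms p0 by (simp add: primes_exp_def ln_le_iff_le_exp)
qed

lemma primes_exp_filter: "t \<le> T \<Longrightarrow> primes_exp t = {p \<in> primes_exp T. ln (real p) \<le> t}"
proof -
  assume "t \<le> T"
  then have "exp t \<le> exp T" by simp
  then have "prime p \<Longrightarrow> real p \<le> exp t \<longleftrightarrow> real p \<le> exp T \<and> ln (real p) \<le> t" for p
    using prime_gt_0_nat[of p] ln_le_iff_le_exp[of "real p" t] order.trans[of "real p" "exp t" "exp T"] by auto
  then show ?thesis unfolding primes_exp_def by blast
qed

lemma theta_exp_nonneg: "theta_exp t \<ge> 0"
  unfolding theta_exp_def by (intro sum_nonneg primes_exp_ln(3)) auto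

lemma theta_exp_mono:
  assumes "s \<le> t"
  shows "theta_exp s \<le> theta_exp t"
  unfolding theta_exp_def
proof (rule sum_mono2)
  show "primes_exp s \<subseteq> primes_exp t" unfolding primes_exp_filter[OF assms] by blast
qed (auto intro: primes_exp_ln(3))

text \<open>There are at most \<open>exp t\<close> primes up to \<open>exp t\<close>, each with
  logarithm at most \<open>t\<close>.\<close>

lemma theta_error_bound:
  assumes "t \<ge> 0"
  shows "\<bar>theta_error t\<bar> \<le> 1 * (1 + t)"
proof -
  have "theta_exp t \<le> (\<Sum>p\<in>primes_exp t. t)"
    unfolding theta_exp_def by (intro sum_mono primes_exp_ln)
  also have "\<dots> = real (card (primes_exp t)) * t" by simp
  finally have 1: "theta_exp t \<le> real (card (primes_exp t)) * t" .
  have "card (primes_exp t) \<le> card {1..nat \<lfloor>exp t\<rfloor>}"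
    by (intro card_mono) (auto simp: primes_exp_eq primes_below_def dest: prime_ge_1_nat)
  then have "real (card (primes_exp t)) \<le> real (nat \<lfloor>exp t\<rfloor>)"
    unfolding card_atLeastAtMost diff_Suc_1 Suc_eq_plus1[symmetric] by (intro of_nat_mono) simp
  also have "\<dots> \<le> exp t" by (rule of_nat_floor) simp
  finally have "real (card (primes_exp t)) * t \<le> exp t * t"
    using assms by (intro mult_right_mono) auto
  then have "theta_exp t * exp (- t) \<le> exp t * t * exp (- t)" using 1 by (intro mult_right_mono) auto
  also have "\<dots> = t" by (simp add: exp_minus field_simps)
  finally have "theta_exp t * exp (- t) \<le> t" .
  moreover have "theta_exp t * exp (- t) \<ge> 0" using theta_exp_nonneg[of t] by simp
  ultimately show ?thesis using assms unfolding theta_error_def by (simp add: abs_le_iff)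
qed

text \<open>A prime contributes to \<open>theta_exp t\<close> exactly for
  \<open>t \<ge> ln p\<close>, so the finite sum can be interchanged with the integral.\<close>

lemma theta_integral:
  fixes \<psi> :: "real \<Rightarrow> 'a :: banach"
  assumes \<psi>: "\<psi> integrable_on {0..T}"
  shows "((\<lambda>t. theta_exp t *\<^sub>R \<psi> t) has_integral (\<Sum>p\<in>primes_exp T. ln (real p) *\<^sub>R integral {ln (real p)..T} \<psi>)) {0..T}"
proof -
  have I: "((\<lambda>t. \<Sum>p\<in>primes_exp T. ln (real p) *\<^sub>R (if t \<in> {ln (real p)..T} then \<psi> t else 0)) has_integral
      (\<Sum>p\<in>primes_exp T. ln (real p) *\<^sub>R integral {ln (real p)..T} \<psi>)) {0..T}"
  proof (intro has_integral_sum has_integral_cmul)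
    fix p assume p: "p \<in> primes_exp T"
    have sub: "{ln (real p)..T} \<subseteq> {0..T}" using primes_exp_ln[OF p] by auto
    show "((\<lambda>t. if t \<in> {ln (real p)..T} then \<psi> t else 0) has_integral integral {ln (real p)..T} \<psi>) {0..T}"
      by (subst has_integral_restrict[OF sub]) (intro integrable_integral integrable_on_subinterval[OF \<psi> sub])
  qed auto
  have eq: "(\<Sum>p\<in>primes_exp T. ln (real p) *\<^sub>R (if t \<in> {ln (real p)..T} then \<psi> t else 0)) = theta_exp t *\<^sub>R \<psi> t"
    if "t \<in> {0..T}" for t
  proof -
    have "(\<Sum>p\<in>primes_exp T. ln (real p) *\<^sub>R (if t \<in> {ln (real p)..T} then \<psi> t else 0))
      = (\<Sum>p\<in>primes_exp T. if ln (real p) \<le> t then ln (real p) *\<^sub>R \<psi> t else 0)"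
      using that by (intro sum.cong) auto
    also have "\<dots> = (\<Sum>p\<in>primes_exp t. ln (real p) *\<^sub>R \<psi> t)"
      using that by (simp add: primes_exp_filter[of t T] sum.inter_filter)
    finally show ?thesis by (simp add: theta_exp_def scaleR_sum_left)
  qed
  show ?thesis by (rule has_integral_eq[OF eq I])
qed

text \<open>Abel summation in the variable \<open>log x\<close>, comparing the sum with weights
  \<open>ln p / p\<close> to the plain integral. The term \<open>\<phi> 0\<close> arises because
  \<open>theta_error 0 = -1\<close>. Values in a Banach space cover complex exponentials, powers and
  Taylor remainders of the exponential at once.\<close>

lemma prime_sum_by_parts:
  fixes \<phi> \<phi>' :: "real \<Rightarrow> 'a :: banach"
  assumes T: "T \<ge> 0" and d: "\<And>t. t \<in> {0..T} \<Longrightarrow> (\<phi> has_vector_derivative \<phi>' t) (at t within {0..T})"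
  shows "((\<lambda>t. theta_error t *\<^sub>R (\<phi> t - \<phi>' t)) has_integral
    ((\<Sum>p\<in>primes_exp T. (ln (real p) / real p) *\<^sub>R \<phi> (ln (real p))) - integral {0..T} \<phi> - theta_error T *\<^sub>R \<phi> T - \<phi> 0)) {0..T}"
proof -
  \<comment> \<open>The negative derivative of \<open>exp (- t) *\<^sub>R \<phi> t\<close>; its
    integral from \<open>ln p\<close> to \<open>T\<close> produces
    \<open>\<phi> (ln p) / p\<close>.\<close>
  define \<psi> where "\<psi> = (\<lambda>t. exp (- t) *\<^sub>R (\<phi> t - \<phi>' t))"
  have \<psi>: "(\<psi> has_integral (exp (- a) *\<^sub>R \<phi> a - exp (- T) *\<^sub>R \<phi> T)) {a..T}" if a: "0 \<le> a" "a \<le> T" for a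
  proof -
    have "(\<psi> has_integral (- exp (- T) *\<^sub>R \<phi> T - (- exp (- a) *\<^sub>R \<phi> a))) {a..T}"
    proof (intro fundamental_theorem_of_calculus a)
      fix t assume t: "t \<in> {a..T}"
      have d': "(\<phi> has_vector_derivative \<phi>' t) (at t within {a..T})"
        using a t by (intro has_vector_derivative_within_subset[OF d]) auto
      have e: "((\<lambda>t. - exp (- t)) has_real_derivative exp (- t)) (at t within {a..T})"
        by (auto intro!: derivative_eq_intros)
      show "((\<lambda>t. - exp (- t) *\<^sub>R \<phi> t) has_vector_derivative \<psi> t) (at t within {a..T})"
        using has_vector_derivative_scaleR[OF e d'] by (simp add: \<psi>_def algebra_simps)
    qed
    then show ?thesis by simp
  qed
  have "((\<lambda>t. theta_exp t *\<^sub>R \<psi> t) has_integral (\<Sum>p\<in>primes_exp T. ln (real p) *\<^sub>R integral {ln (real p)..T} \<psi>)) {0..T}"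
    using \<psi>[of 0] T by (intro theta_integral) auto
  also have "(\<Sum>p\<in>primes_exp T. ln (real p) *\<^sub>R integral {ln (real p)..T} \<psi>) =
     (\<Sum>p\<in>primes_exp T. (ln (real p) / real p) *\<^sub>R \<phi> (ln (real p)) - ln (real p) *\<^sub>R exp (- T) *\<^sub>R \<phi> T)"
  proof (rule sum.cong)
    fix p assume p: "p \<in> primes_exp T"
    have "integral {ln (real p)..T} \<psi> = exp (- ln (real p)) *\<^sub>R \<phi> (ln (real p)) - exp (- T) *\<^sub>R \<phi> T"
      using \<psi>[of "ln (real p)"] primes_exp_ln[OF p] by (intro integral_unique) auto
    then show "ln (real p) *\<^sub>R integral {ln (real p)..T} \<psi> = (ln (real p) / real p) *\<^sub>R \<phi> (ln (real p)) - ln (real p) *\<^sub>R exp (- T) *\<^sub>R \<phi> T"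
      using primes_exp_ln(2)[OF p] by (simp only: scaleR_diff_right) (simp add: exp_minus divide_inverse)
  qed simp
  also have "\<dots> = (\<Sum>p\<in>primes_exp T. (ln (real p) / real p) *\<^sub>R \<phi> (ln (real p))) - (theta_error T + 1) *\<^sub>R \<phi> T"
    by (simp add: sum_subtractf theta_error_def theta_exp_def scaleR_sum_left[symmetric] sum_distrib_right)
  finally have 1: "((\<lambda>t. theta_exp t *\<^sub>R \<psi> t) has_integral ((\<Sum>p\<in>primes_exp T. (ln (real p) / real p) *\<^sub>R \<phi> (ln (real p))) - (theta_error T + 1) *\<^sub>R \<phi> T)) {0..T}" .
  have "continuous_on {0..T} \<phi>"
    using d has_vector_derivative_continuous unfolding continuous_on_eq_continuous_within by blast
  then have i\<phi>: "(\<phi> has_integral integral {0..T} \<phi>) {0..T}"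
    by (intro integrable_integral integrable_continuous_interval)
  have i\<phi>': "(\<phi>' has_integral (\<phi> T - \<phi> 0)) {0..T}"
    by (intro fundamental_theorem_of_calculus T d)
  from has_integral_diff[OF 1 has_integral_diff[OF i\<phi> i\<phi>']]
  have "((\<lambda>t. theta_exp t *\<^sub>R \<psi> t - (\<phi> t - \<phi>' t)) has_integral
    ((\<Sum>p\<in>primes_exp T. (ln (real p) / real p) *\<^sub>R \<phi> (ln (real p))) - (theta_error T + 1) *\<^sub>R \<phi> T - (integral {0..T} \<phi> - (\<phi> T - \<phi> 0)))) {0..T}" .
  moreover have "(\<lambda>t. theta_exp t *\<^sub>R \<psi> t - (\<phi> t - \<phi>' t)) = (\<lambda>t. theta_error t *\<^sub>R (\<phi> t - \<phi>' t))"
    by (simp add: \<psi>_def theta_error_def fun_eq_iff scaleR_left_diff_distrib)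
  moreover have "a - (r + 1) *\<^sub>R b - (c - (b - d)) = a - c - r *\<^sub>R b - d" for a b c d :: 'a and r
    by (simp add: algebra_simps)
  ultimately show ?thesis by (simp only:)
qed

text \<open>The truncated Laplace transform of \<open>theta_error\<close>, written as a finite
  combination of integrals of exponentials so that it is visibly entire.\<close>

definition theta_laplace_upto :: "real \<Rightarrow> complex \<Rightarrow> complex" where
  "theta_laplace_upto T z = (\<Sum>p\<in>primes_exp T. of_real (ln (real p)) * integral {ln (real p)..T} (\<lambda>t. exp (- ((1 + z) * of_real t))))
     - integral {0..T} (\<lambda>t. exp (- (z * of_real t)))"

text \<open>For \<open>Re z > 0\<close> this equals \<open>(F(1 + z) - 1/z - 1) / (1 + z)\<close>.
  Expressing \<open>F\<close> through \<open>xi_logderiv\<close> cancels the pole at 0 and gives the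
  formula a meaning to the left of the imaginary axis.\<close>

definition theta_laplace :: "complex \<Rightarrow> complex" where
  "theta_laplace z = - (1 + xi_logderiv (1 + z) + prime_tail2 (1 + z)) / (1 + z)"

lemma theta_laplace_upto_has_integral:
  "((\<lambda>t. of_real (theta_error t) * exp (- (z * of_real t))) has_integral theta_laplace_upto T z) {0..T}"
proof -
  have 1: "((\<lambda>t. theta_exp t *\<^sub>R exp (- ((1 + z) * of_real t))) has_integral
     (\<Sum>p\<in>primes_exp T. ln (real p) *\<^sub>R integral {ln (real p)..T} (\<lambda>t. exp (- ((1 + z) * of_real t))))) {0..T}"
    by (intro theta_integral integrable_continuous_interval continuous_intros)
  have 2: "((\<lambda>t. exp (- (z * of_real t))) has_integral integral {0..T} (\<lambda>t. exp (- (z * of_real t)))) {0..T}"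
    by (intro integrable_integral integrable_continuous_interval continuous_intros)
  have "theta_exp t *\<^sub>R exp (- ((1 + z) * of_real t)) - exp (- (z * of_real t)) = of_real (theta_error t) * exp (- (z * of_real t))" for t
  proof -
    have "exp (- ((1 + z) * of_real t)) = exp (of_real (- t)) * exp (- (z * of_real t))"
      by (simp only: exp_add[symmetric]) (simp add: algebra_simps)
    moreover have "exp (of_real (- t)) = complex_of_real (exp (- t))" by (rule exp_of_real)
    ultimately show ?thesis
      by (simp only: theta_error_def scaleR_conv_of_real left_diff_distrib of_real_diff of_real_mult of_real_1 mult.assoc mult_1_left)
  qed
  then show ?thesis
    using has_integral_diff[OF 1 2] by (simp add: theta_laplace_upto_def scaleR_conv_of_real)
qed

lemma holomorphic_exp_integral:
  "(\<lambda>w. integral {a..b} (\<lambda>t. exp (- (w * of_real t)))) holomorphic_on UNIV"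
proof -
  have "(\<lambda>w. integral (cbox a b) (\<lambda>t. exp (- (w * of_real t)))) holomorphic_on UNIV"
  proof (rule leibniz_rule_holomorphic[where fx = "\<lambda>w t. - of_real t * exp (- (w * of_real t))"])
    show "((\<lambda>x. exp (- (x * of_real t))) has_field_derivative - of_real t * exp (- (x * of_real t))) (at x within UNIV)" for x t
      by (auto intro!: derivative_eq_intros)
    show "(\<lambda>t. exp (- (x * complex_of_real t))) integrable_on cbox a b" for x
      by (intro integrable_continuous continuous_intros)
    show "continuous_on (UNIV \<times> cbox a b) (\<lambda>(x, t). - complex_of_real t * exp (- (x * complex_of_real t)))"
      by (auto intro!: continuous_intros simp: case_prod_unfold)
  qed auto
  then show ?thesis by simp
qed

lemma theta_laplace_upto_holomorphic: "theta_laplace_upto T holomorphic_on UNIV"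
  unfolding theta_laplace_upto_def
proof (intro holomorphic_intros)
  fix p :: nat
  have "(\<lambda>w. integral {ln (real p)..T} (\<lambda>t. exp (- (w * of_real t)))) \<circ> (\<lambda>z. 1 + z) holomorphic_on UNIV"
    by (rule holomorphic_on_compose_gen[OF _ holomorphic_exp_integral]) (auto intro!: holomorphic_intros)
  then show "(\<lambda>z. integral {ln (real p)..T} (\<lambda>t. exp (- ((1 + z) * of_real t)))) holomorphic_on UNIV"
    by (simp add: o_def)
qed (rule holomorphic_exp_integral)

lemma prime_sum_tendsto:
  assumes "Re z > 0"
  shows "((\<lambda>T. \<Sum>p\<in>primes_exp T. (ln (real p) / real p) *\<^sub>R exp (- (z * of_real (ln (real p))))) \<longlongrightarrow> primesum (\<lambda>q. q) (1 + z)) at_top"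
proof -
  define a where "a = (prime_term (\<lambda>q. q) (1 + z))"
  have "a sums primesum (\<lambda>q. q) (1 + z)"
    unfolding a_def primesum_def using prime_kernel_summable(1)[of "1 + z"] assms by (intro summable_sums) auto
  then have lim: "(\<lambda>n. \<Sum>k<n. a k) \<longlonglongrightarrow> primesum (\<lambda>q. q) (1 + z)" by (simp add: sums_def)
  have "filterlim (\<lambda>T::real. Suc (nat \<lfloor>exp T\<rfloor>)) sequentially at_top"
    by (intro filterlim_compose[OF filterlim_Suc] filterlim_compose[OF filterlim_nat_sequentially]
        filterlim_compose[OF filterlim_floor_sequentially] exp_at_top)
  from filterlim_compose[OF lim this]
  have "((\<lambda>T::real. \<Sum>k<Suc (nat \<lfloor>exp T\<rfloor>). a k) \<longlongrightarrow> primesum (\<lambda>q. q) (1 + z)) at_top" .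
  moreover have "(\<Sum>k<n. a k) = (\<Sum>p\<in>primes_below n. (ln (real p) / real p) *\<^sub>R exp (- (z * of_real (ln (real p)))))" for n
  proof -
    have "(\<Sum>k<n. a k) = (\<Sum>p\<in>{p\<in>{..<n}. prime p}. of_real (ln (real p)) * dpow (real p) (1 + z))"
      unfolding a_def by (rule sum.inter_filter[symmetric]) auto
    also have "{p\<in>{..<n}. prime p} = primes_below n" by (auto simp: primes_below_def)
    also have "(\<Sum>p\<in>primes_below n. of_real (ln (real p)) * dpow (real p) (1 + z)) =
       (\<Sum>p\<in>primes_below n. (ln (real p) / real p) *\<^sub>R exp (- (z * of_real (ln (real p)))))"
    proof (rule sum.cong)
      fix p assume "p \<in> primes_below n"
      then have "real p > 0" using prime_gt_0_nat by (auto simp: primes_below_def)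
      then have "dpow (real p) 1 = of_real (1 / real p)" unfolding dpow_def by (simp add: exp_minus exp_of_real inverse_eq_divide)
      then show "of_real (ln (real p)) * dpow (real p) (1 + z) = (ln (real p) / real p) *\<^sub>R exp (- (z * of_real (ln (real p))))"
        by (simp add: dpow_add scaleR_conv_of_real) (simp add: dpow_def)
    qed simp
    finally show ?thesis .
  qed
  ultimately show ?thesis by (simp only: primes_exp_eq)
qed

lemma theta_error_exp_tendsto:
  assumes "Re z > 0"
  shows "((\<lambda>T. of_real (theta_error T) * exp (- (z * of_real T))) \<longlongrightarrow> 0) at_top"
proof (rule Lim_null_comparison)
  have x: "0 < Re z" by fact
  have "((\<lambda>T. exp (- (Re z * T)) + (Re z * T) ^ 1 / exp (Re z * T) / Re z) \<longlongrightarrow> 0 + 0 / Re z) at_top"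
    using x
    by (intro tendsto_intros filterlim_compose[OF tendsto_power_div_exp_0] filterlim_compose[OF exp_at_bot]
        filterlim_uminus_at_bot_at_top[THEN filterlim_compose] filterlim_tendsto_pos_mult_at_top[OF tendsto_const] filterlim_ident) auto
  then show "((\<lambda>T. (1 + T) * exp (- (Re z * T))) \<longlongrightarrow> 0) at_top"
    using x by (simp add: exp_minus field_simps)
  show "\<forall>\<^sub>F T in at_top. norm (of_real (theta_error T) * exp (- (z * of_real T))) \<le> (1 + T) * exp (- (Re z * T))"
    using eventually_ge_at_top[of 0]
    by eventually_elim (use theta_error_bound in \<open>auto simp: norm_mult\<close>)
qed

lemma integral_exp_tendsto:
  assumes "Re z > 0"
  shows "((\<lambda>T. integral {0..T} (\<lambda>t. exp (- (z * of_real t)))) \<longlongrightarrow> 1 / z) at_top"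
proof -
  have z: "z \<noteq> 0" using assms by auto
  have eq: "integral {0..T} (\<lambda>t. exp (- (z * of_real t))) = (1 - exp (- (z * of_real T))) / z" if T: "T \<ge> 0" for T
  proof -
    have "((\<lambda>t. exp (- (z * of_real t))) has_integral (- exp (- (z * of_real T)) / z - (- exp (- (z * of_real 0)) / z))) {0..T}"
    proof (intro fundamental_theorem_of_calculus T)
      fix t
      have "((\<lambda>t. - exp (- (z * t)) / z) has_field_derivative exp (- (z * of_real t))) (at (of_real t))"
        using z by (auto intro!: derivative_eq_intros)
      then show "((\<lambda>t. - exp (- (z * of_real t)) / z) has_vector_derivative exp (- (z * of_real t))) (at t within {0..T})"
        by (rule has_vector_derivative_real_field)
    qed
    then show ?thesis by (simp add: integral_unique diff_divide_distrib)
  qed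
  have "((\<lambda>T. exp (- (z * of_real T))) \<longlongrightarrow> 0) at_top"
    using assms
    by (intro tendsto_norm_zero_cancel[where 'b = complex])
       (auto intro!: filterlim_compose[OF exp_at_bot] filterlim_uminus_at_bot_at_top[THEN filterlim_compose] filterlim_tendsto_pos_mult_at_top[OF tendsto_const] filterlim_ident)
  then have "((\<lambda>T. (1 - exp (- (z * of_real T))) / z) \<longlongrightarrow> (1 - 0) / z) at_top"
    using z by (intro tendsto_intros) auto
  moreover have "\<forall>\<^sub>F T in at_top. (1 - exp (- (z * of_real T))) / z = integral {0..T} (\<lambda>t. exp (- (z * of_real t)))"
    using eventually_ge_at_top[of 0] by eventually_elim (simp add: eq)
  ultimately show ?thesis by (simp add: tendsto_cong)
qed

text \<open>Summation by parts with \<open>\<phi> t = exp (- z t)\<close>, for which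
  \<open>\<phi> - \<phi>' = (1 + z) \<phi>\<close>: the transform is the prime sum minus an
  integral, divided by \<open>1 + z\<close>.\<close>

lemma theta_laplace_tendsto:
  assumes z: "Re z > 0"
  shows "((\<lambda>T. theta_laplace_upto T z) \<longlongrightarrow> theta_laplace z) at_top"
proof -
  define S where "S = (\<lambda>T. \<Sum>p\<in>primes_exp T. (ln (real p) / real p) *\<^sub>R exp (- (z * of_real (ln (real p)))))"
  define I where "I = (\<lambda>T. integral {0..T} (\<lambda>t. exp (- (z * of_real t))))"
  have z1: "1 + z \<noteq> 0" "z \<noteq> 0" using z by (auto simp: complex_eq_iff)
  have eq: "theta_laplace_upto T z = (S T - I T - of_real (theta_error T) * exp (- (z * of_real T)) - 1) / (1 + z)" if T: "T \<ge> 0" for T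
  proof -
    have 1: "((\<lambda>t. theta_error t *\<^sub>R (exp (- (z * of_real t)) - (- z * exp (- (z * of_real t))))) has_integral
      (S T - I T - theta_error T *\<^sub>R exp (- (z * of_real T)) - exp (- (z * of_real 0)))) {0..T}"
      unfolding S_def I_def
    proof (rule prime_sum_by_parts[OF T])
      fix t
      have "((\<lambda>t. exp (- (z * t))) has_field_derivative - z * exp (- (z * of_real t))) (at (of_real t))"
        by (auto intro!: derivative_eq_intros)
      then show "((\<lambda>t. exp (- (z * of_real t))) has_vector_derivative - z * exp (- (z * of_real t))) (at t within {0..T})"
        by (rule has_vector_derivative_real_field)
    qed
    have 2: "((\<lambda>t. (1 + z) * (of_real (theta_error t) * exp (- (z * of_real t)))) has_integral (1 + z) * theta_laplace_upto T z) {0..T}"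
      by (intro has_integral_mult_right theta_laplace_upto_has_integral)
    have eq: "(\<lambda>t. (1 + z) * (of_real (theta_error t) * exp (- (z * of_real t)))) = (\<lambda>t. theta_error t *\<^sub>R (exp (- (z * of_real t)) - (- z * exp (- (z * of_real t)))))"
      by (simp add: fun_eq_iff scaleR_conv_of_real algebra_simps)
    have "(1 + z) * theta_laplace_upto T z = S T - I T - theta_error T *\<^sub>R exp (- (z * of_real T)) - exp (- (z * of_real 0))"
      by (rule has_integral_unique[OF 2[unfolded eq] 1])
    then show ?thesis using z1 by (simp add: scaleR_conv_of_real field_simps)
  qed
  have "((\<lambda>T. (S T - I T - of_real (theta_error T) * exp (- (z * of_real T)) - 1) / (1 + z)) \<longlongrightarrow> (primesum (\<lambda>q. q) (1 + z) - 1 / z - 0 - 1) / (1 + z)) at_top"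
    unfolding S_def I_def
    by (intro tendsto_intros prime_sum_tendsto integral_exp_tendsto theta_error_exp_tendsto z z1)
  also have "(primesum (\<lambda>q. q) (1 + z) - 1 / z - 0 - 1) / (1 + z) = theta_laplace z"
    using prime_series_eq_tail2[of "1 + z"] z unfolding theta_laplace_def by (simp add: algebra_simps)
  finally have "((\<lambda>T. (S T - I T - of_real (theta_error T) * exp (- (z * of_real T)) - 1) / (1 + z)) \<longlongrightarrow> theta_laplace z) at_top" .
  moreover have "\<forall>\<^sub>F T in at_top. (S T - I T - of_real (theta_error T) * exp (- (z * of_real T)) - 1) / (1 + z) = theta_laplace_upto T z"
    using eventually_ge_at_top[of 0] by eventually_elim (simp add: eq)
  ultimately show ?thesis by (simp add: tendsto_cong)
qed

interpretation theta: laplace theta_error 1 theta_laplace_upto theta_laplace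
  by standard (auto intro!: theta_error_bound[simplified] theta_laplace_upto_has_integral theta_laplace_upto_holomorphic theta_laplace_tendsto)

section \<open>Decay of the error term\<close>

definition laplace_controlled :: "real \<Rightarrow> real \<Rightarrow> real \<Rightarrow> bool" where
  "laplace_controlled d R M \<longleftrightarrow> theta_laplace holomorphic_on cbox (Complex (- d) (- R)) (Complex R R) \<and>
     (\<forall>z. - d \<le> Re z \<longrightarrow> Re z \<le> 0 \<longrightarrow> \<bar>Im z\<bar> \<le> R \<longrightarrow> norm (theta_laplace z) \<le> M)"

text \<open>To the right of the imaginary axis the Euler product excludes zeros, to the left the
  zero-free region does. The condition \<open>d \<le> 1/4\<close> keeps \<open>1 + z\<close> away
  from 0 and inside the domain of \<open>prime_tail2\<close>.\<close>

lemma theta_laplace_box: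
  assumes e: "0 < e" "e \<le> 1"
  obtains c K where "c > 0" "c \<le> 1 / 2" "K > 0"
    "\<And>R d. R \<ge> 2 \<Longrightarrow> 0 < d \<Longrightarrow> d \<le> 1 / 4 \<Longrightarrow> d \<le> c * R powr (- e) \<Longrightarrow> 
       laplace_controlled d R (K * R ^ 2)"
proof -
  obtain c C where c: "c > 0" "c \<le> 1 / 2" "C > 0" and
    zf: "\<And>R s. R \<ge> 2 \<Longrightarrow> \<bar>Im s\<bar> \<le> R \<Longrightarrow> 1 - c * R powr (- e) \<le> Re s \<Longrightarrow> Re s \<le> 1 \<Longrightarrow>
       xi s \<noteq> 0 \<and> norm (xi_logderiv s) \<le> C * R ^ 2"
    using xi_zero_free[OF e] by blast
  obtain D where D: "D > 0" "\<And>s. Re s \<ge> 3 / 5 \<Longrightarrow> norm (prime_tail2 s) \<le> D"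
    using prime_tail2_bounded[of "3 / 5"] by auto
  show ?thesis
  proof
    show "c > 0" "c \<le> 1 / 2" "2 * (1 + C + D) > 0" using c D by auto
    fix R d :: real assume R: "R \<ge> 2" and d: "0 < d" "d \<le> 1 / 4" "d \<le> c * R powr (- e)"
    define S where "S = cbox (Complex (- d) (- R)) (Complex R R)"
    have S: "z \<in> S \<Longrightarrow> - d \<le> Re z \<and> Re z \<le> R \<and> \<bar>Im z\<bar> \<le> R" for z
      by (auto simp: S_def in_cbox_complex_iff)
    have nz: "xi (1 + z) \<noteq> 0" if "z \<in> S" for z
    proof (cases "Re (1 + z) > 1")
      case False
      then show ?thesis using zf[of R "1 + z"] S[OF that] R d by auto
    qed (rule xi_nonzero_right)
    have "(xi_logderiv \<circ> (\<lambda>z. 1 + z)) holomorphic_on S"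
    proof (rule holomorphic_on_compose)
      show "xi_logderiv holomorphic_on (\<lambda>z. 1 + z) ` S"
        using nz S d by (intro xi_logderiv_holomorphic) force+
    qed (intro holomorphic_intros)
    moreover have "(prime_tail2 \<circ> (\<lambda>z. 1 + z)) holomorphic_on S"
    proof (rule holomorphic_on_compose_gen)
      show "prime_tail2 holomorphic_on {s. Re s > 3 / 5}" by (rule prime_tail2_holomorphic) simp
      show "(\<lambda>z. 1 + z) ` S \<subseteq> {s. Re s > 3 / 5}" using S d by force
    qed (intro holomorphic_intros)
    moreover have "1 + z \<noteq> 0" if "z \<in> S" for z
      using S[OF that] d by (auto simp: complex_eq_iff)
    ultimately have "theta_laplace holomorphic_on S"
      unfolding theta_laplace_def o_def by (intro holomorphic_intros) auto
    moreover have "norm (theta_laplace z) \<le> 2 * (1 + C + D) * R ^ 2"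
      if z: "- d \<le> Re z" "Re z \<le> 0" "\<bar>Im z\<bar> \<le> R" for z
    proof -
      have R1: "1 \<le> R ^ 2" using R by (intro one_le_power) auto
      have "norm (1 + xi_logderiv (1 + z) + prime_tail2 (1 + z)) \<le> 1 + norm (xi_logderiv (1 + z)) + norm (prime_tail2 (1 + z))"
        by (intro order.trans[OF norm_triangle_ineq] add_right_mono order.trans[OF norm_triangle_ineq]) simp
      also have "\<dots> \<le> 1 + C * R ^ 2 + D"
        using zf[of R "1 + z"] D(2)[of "1 + z"] z R d by (intro add_mono) auto
      also have "\<dots> \<le> R ^ 2 + C * R ^ 2 + D * R ^ 2" using R1 D(1) by (intro add_mono) auto
      finally have *: "norm (1 + xi_logderiv (1 + z) + prime_tail2 (1 + z)) \<le> (1 + C + D) * R ^ 2" by (simp add: algebra_simps)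
      have "norm (1 + z) \<ge> 1 / 2" using abs_Re_le_cmod[of "1 + z"] z d by auto
      then have "norm (theta_laplace z) \<le> (1 + C + D) * R ^ 2 / (1 / 2)"
        unfolding theta_laplace_def norm_divide norm_minus_cancel using * c D by (intro frac_le) auto
      then show ?thesis by (simp add: algebra_simps)
    qed
    ultimately show "laplace_controlled d R (2 * (1 + C + D) * R ^ 2)"
      by (simp add: S_def laplace_controlled_def)
  qed
qed

lemma const_div_at_top: "((\<lambda>T::real. K / T) \<longlongrightarrow> 0) at_top" for K :: real
  by (intro tendsto_divide_0[OF tendsto_const] filterlim_at_top_imp_at_infinity filterlim_ident)

text \<open>Newman's bound with \<open>R = T^(n+2)\<close> and \<open>d = c / sqrt T\<close>: the
  first two terms are \<open>O(T^(-n-1))\<close>, and the factor \<open>exp (- c sqrt T)\<close> of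
  the third beats every power of \<open>T\<close>.\<close>

lemma laplace_decay:
  "((\<lambda>T. T ^ n * norm (theta_laplace 0 - theta_laplace_upto T 0)) \<longlongrightarrow> 0) at_top"
proof -
  \<comment> \<open>Chosen so that \<open>R powr (- e) = 1 / sqrt T\<close> for
    \<open>R = T ^ (n + 2)\<close>.\<close>
  define e where "e = 1 / (2 * (real n + 2))"
  have e: "0 < e" "e \<le> 1" by (auto simp: e_def divide_simps)
  obtain c K where c: "c > 0" "c \<le> 1 / 2" "K > 0" and
    box: "\<And>R d. R \<ge> 2 \<Longrightarrow> 0 < d \<Longrightarrow> d \<le> 1 / 4 \<Longrightarrow> d \<le> c * R powr (- e) \<Longrightarrow> 
       laplace_controlled d R (K * R ^ 2)"
    using theta_laplace_box[OF e] by blast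
  \<comment> \<open>Twice an exponent of \<open>T\<close> that dominates
    \<open>T ^ n * R ^ 3 * sqrt T\<close>, since powers are measured in
    \<open>sqrt T\<close>.\<close>
  define m where "m = 2 * (n + 3 * (n + 2) + 1)"
  define b where "b = (\<lambda>T. 216 / T + 18 * K / T + 18 * K / (c * c ^ m) * ((c * sqrt T) ^ m / exp (c * sqrt T)))"
  have "(b \<longlongrightarrow> 0 + 0 + 18 * K / (c * c ^ m) * 0) at_top"
    unfolding b_def using c
    by (intro tendsto_add tendsto_mult tendsto_const const_div_at_top filterlim_compose[OF tendsto_power_div_exp_0]
        filterlim_tendsto_pos_mult_at_top[OF tendsto_const] sqrt_at_top) auto
  then have "(b \<longlongrightarrow> 0) at_top" by simp
  moreover have "\<forall>\<^sub>F T in at_top. norm (T ^ n * norm (theta_laplace 0 - theta_laplace_upto T 0)) \<le> b T"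
    using eventually_ge_at_top[of 4]
  proof eventually_elim
    case (elim T)
    define R where "R = T ^ (n + 2)"
    define d where "d = c / sqrt T"
    have T1: "T \<ge> 1" using elim by simp
    have "T ^ 1 \<le> R" unfolding R_def using T1 by (intro power_increasing) auto
    then have R: "R \<ge> 2" "R \<ge> T" using elim by auto
    have sq: "sqrt T \<ge> 2" using elim by (intro real_le_rsqrt) auto
    have "R powr (- e) = (T powr (real (n + 2))) powr (- e)"
      unfolding R_def using T1 by (simp only: powr_realpow)
    also have "\<dots> = T powr (- (1 / 2))"
    proof -
      have "real (n + 2) * e = 1 / 2" by (simp add: e_def divide_simps)
      then show ?thesis by (simp only: powr_powr mult_minus_right)
    qed
    also have "\<dots> = 1 / sqrt T" using T1 by (simp add: powr_minus powr_half_sqrt inverse_eq_divide)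
    finally have "c * R powr (- e) = d" by (simp add: d_def)
    moreover have "d \<le> (1 / 2) / 2" unfolding d_def using c sq by (intro frac_le) auto
    moreover have d0: "d > 0" unfolding d_def using c T1 by (intro divide_pos_pos) auto
    ultimately have bx: "theta_laplace holomorphic_on cbox (Complex (- d) (- R)) (Complex R R)"
       "\<And>z. - d \<le> Re z \<Longrightarrow> Re z \<le> 0 \<Longrightarrow> \<bar>Im z\<bar> \<le> R \<Longrightarrow> norm (theta_laplace z) \<le> K * R ^ 2"
      and d1: "d \<le> 1"
      using box[of R d] R by (auto simp: laplace_controlled_def)
    have "norm (theta_laplace 0 - theta_laplace_upto T 0) \<le> 72 * 1 * (2 + T) / R + 18 * (K * R ^ 2) * d ^ 3 / R ^ 3 + 18 * (K * R ^ 2) * R * exp (- (d * T)) / d"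
      using R d0 d1 T1 by (intro theta.newman_bound bx) auto
    also have "\<dots> \<le> 216 * T / R + 18 * K / R + 18 * K * R ^ 3 * exp (- (d * T)) * (sqrt T / c)"
    proof (intro add_mono)
      show "72 * 1 * (2 + T) / R \<le> 216 * T / R" using R T1 by (intro divide_right_mono) auto
      have "18 * (K * R ^ 2) * d ^ 3 / R ^ 3 = 18 * K / R * d ^ 3" using R by (simp add: power2_eq_square power3_eq_cube)
      also have "\<dots> \<le> 18 * K / R * 1" using d0 d1 c R by (intro mult_left_mono power_le_one) auto
      finally show "18 * (K * R ^ 2) * d ^ 3 / R ^ 3 \<le> 18 * K / R" by simp
      show "18 * (K * R ^ 2) * R * exp (- (d * T)) / d \<le> 18 * K * R ^ 3 * exp (- (d * T)) * (sqrt T / c)"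
        by (simp add: d_def power2_eq_square power3_eq_cube)
    qed
    finally have "T ^ n * norm (theta_laplace 0 - theta_laplace_upto T 0) \<le>
       T ^ n * (216 * T / R + 18 * K / R + 18 * K * R ^ 3 * exp (- (d * T)) * (sqrt T / c))"
      using T1 by (intro mult_left_mono) auto
    also have "\<dots> = 216 * (T ^ n * T / R) + 18 * K * (T ^ n / R) + 18 * K / c * exp (- (d * T)) * (T ^ n * R ^ 3 * sqrt T)"
      by (simp add: algebra_simps)
    also have "T ^ n * T / R = 1 / T" unfolding R_def using T1 by (simp add: power_add power2_eq_square)
    also have "d * T = c * sqrt T" using T1 by (simp add: d_def field_simps)
    also have "216 * (1 / T) + 18 * K * (T ^ n / R) + 18 * K / c * exp (- (c * sqrt T)) * (T ^ n * R ^ 3 * sqrt T)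
      \<le> 216 * (1 / T) + 18 * K * (1 / T) + 18 * K / c * exp (- (c * sqrt T)) * (sqrt T ^ m)"
    proof (intro add_mono mult_left_mono order.refl)
      have "T ^ n / R \<le> T ^ n * T / R" using T1 R by (intro divide_right_mono) auto
      also have "\<dots> = 1 / T" unfolding R_def using T1 by (simp add: power_add power2_eq_square)
      finally show "T ^ n / R \<le> 1 / T" .
      have "sqrt T \<le> T" using T1 by (intro real_le_lsqrt) (auto simp: power2_eq_square)
      then have "T ^ n * R ^ 3 * sqrt T \<le> T ^ n * R ^ 3 * T" using T1 R by (intro mult_left_mono) auto
      also have "\<dots> = T ^ (n + 3 * (n + 2) + 1)" 
        unfolding R_def power_mult[symmetric] by (simp only: power_add power_one_right mult.commute[of 3])
      also have "\<dots> = sqrt T ^ m" unfolding m_def power_mult using T1 by simp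
      finally show "T ^ n * R ^ 3 * sqrt T \<le> sqrt T ^ m" .
    qed (use c in auto)
    also have "\<dots> = b T"
      unfolding b_def using c by (simp add: power_mult_distrib exp_minus field_simps)
    finally show ?case using T1 by simp
  qed
  ultimately show ?thesis by (rule Lim_null_comparison[rotated])
qed

section \<open>From the integral of the error term back to the error term\<close>

definition theta_integrated :: "real \<Rightarrow> real" where
  "theta_integrated T = integral {0..T} theta_error"

lemma theta_error_integrable: "theta_error integrable_on {a..b}" if "a \<ge> 0"
proof -
  have "((\<lambda>t. theta_exp t *\<^sub>R exp (- t)) has_integral (\<Sum>p\<in>primes_exp b. ln (real p) *\<^sub>R integral {ln (real p)..b} (\<lambda>t. exp (- t)))) {0..b}"
    by (intro theta_integral integrable_continuous_interval continuous_intros)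
  then have "(\<lambda>t. theta_exp t * exp (- t)) integrable_on {0..b}" by (auto simp: integrable_on_def)
  then have "theta_error integrable_on {0..b}"
    unfolding theta_error_def by (intro integrable_diff) auto
  then show ?thesis by (rule integrable_on_subinterval) (use that in auto)
qed

lemma theta_laplace_upto_0: "theta_laplace_upto T 0 = of_real (theta_integrated T)"
proof -
  have "((\<lambda>t. complex_of_real (theta_error t)) has_integral theta_laplace_upto T 0) {0..T}"
    using theta_laplace_upto_has_integral[of 0 T] by simp
  moreover have "((\<lambda>t. complex_of_real (theta_error t)) has_integral of_real (theta_integrated T)) {0..T}"
    unfolding theta_integrated_def
    by (intro has_integral_of_real integrable_integral theta_error_integrable) simp
  ultimately show ?thesis by (rule has_integral_unique)
qed

lemma theta_integrated_diff:
  assumes "0 \<le> a" "a \<le> b"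
  shows "integral {a..b} theta_error = theta_integrated b - theta_integrated a"
  using Henstock_Kurzweil_Integration.integral_combine[of 0 a b theta_error] assms theta_error_integrable
  unfolding theta_integrated_def by auto

text \<open>Since \<open>theta_exp\<close> is monotone, a large positive error at \<open>t\<close>
  persists on \<open>[t, t + h]\<close> and a large negative one on \<open>[t - h, t]\<close>, up to
  a loss of order \<open>h\<close>. Either makes the integral over the short interval large.\<close>

lemma theta_error_local:
  assumes t: "t \<ge> 1" and h: "0 < h" "h \<le> 1 / 2"
  shows "h * theta_error t \<le> 2 * (h ^ 2 + \<bar>theta_integrated (t + h) - theta_integrated t\<bar>)"
    and "- h * theta_error t \<le> 2 * h ^ 2 + \<bar>theta_integrated t - theta_integrated (t - h)\<bar>"
proof -
  define f where "f = theta_error t"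
  have f1: "1 + f \<ge> 0" using theta_exp_nonneg[of t] by (simp add: f_def theta_error_def)
  have theta_t: "theta_exp t = (1 + f) * exp t" by (simp add: f_def theta_error_def exp_minus)
  have ei: "theta_exp s * exp (- s) = 1 + theta_error s" for s by (simp add: theta_error_def)
  show "h * theta_error t \<le> 2 * (h ^ 2 + \<bar>theta_integrated (t + h) - theta_integrated t\<bar>)"
  proof (cases "f \<ge> 0")
    case False
    then have "h * theta_error t \<le> 0" using h by (simp add: f_def mult_nonneg_nonpos)
    also have "0 \<le> 2 * (h ^ 2 + \<bar>theta_integrated (t + h) - theta_integrated t\<bar>)" by simp
    finally show ?thesis .
  next
    case True
    have low: "f - h * (1 + f) \<le> theta_error s" if s: "s \<in> {t..t + h}" for s
    proof -
      have "(1 + f) * (1 - h) \<le> (1 + f) * exp (t - s)"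
      proof (intro mult_left_mono f1)
        show "1 - h \<le> exp (t - s)" using exp_ge_add_one_self[of "t - s"] s unfolding atLeastAtMost_iff by linarith
      qed
      also have "\<dots> = theta_exp t * exp (- s)" by (simp add: theta_t exp_diff exp_minus field_simps)
      also have "\<dots> \<le> theta_exp s * exp (- s)" using s by (intro mult_right_mono theta_exp_mono) auto
      finally show ?thesis by (simp add: ei algebra_simps)
    qed
    have "h * (f - h * (1 + f)) = integral {t..t + h} (\<lambda>_. f - h * (1 + f))" using h by simp
    also have "\<dots> \<le> integral {t..t + h} theta_error"
      using t low by (intro integral_le theta_error_integrable) auto
    also have "\<dots> \<le> \<bar>theta_integrated (t + h) - theta_integrated t\<bar>"
      using t h by (subst theta_integrated_diff) auto
    finally have *: "h * f - h ^ 2 - h * f * h \<le> \<bar>theta_integrated (t + h) - theta_integrated t\<bar>"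
      by (simp add: algebra_simps power2_eq_square)
    \<comment> \<open>As \<open>h \<le> 1/2\<close>, this term absorbs at most half of
      \<open>h * f\<close>, whence the factor 2 in the conclusion.\<close>
    have "h * f * h \<le> h * f * (1 / 2)" using h True by (intro mult_left_mono) auto
    then show ?thesis using * by (simp add: f_def)
  qed
  show "- h * theta_error t \<le> 2 * h ^ 2 + \<bar>theta_integrated t - theta_integrated (t - h)\<bar>"
  proof (cases "f \<le> 0")
    case False
    then have "- h * theta_error t \<le> 0" using h by (simp add: f_def)
    also have "0 \<le> 2 * h ^ 2 + \<bar>theta_integrated t - theta_integrated (t - h)\<bar>" by simp
    finally show ?thesis .
  next
    case True
    have up: "theta_error s \<le> f + 2 * h" if s: "s \<in> {t - h..t}" for s
    proof -
      have "1 + theta_error s = theta_exp s * exp (- s)" by (simp add: ei)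
      also have "\<dots> \<le> theta_exp t * exp (- s)" using s by (intro mult_right_mono theta_exp_mono) auto
      also have "\<dots> = (1 + f) * exp (t - s)" by (simp add: theta_t exp_diff exp_minus field_simps)
      also have "\<dots> \<le> (1 + f) * exp h" using s f1 by (intro mult_left_mono) auto
      also have "\<dots> \<le> (1 + f) * (1 + 2 * h)"
      proof (intro mult_left_mono f1)
        have "h ^ 2 \<le> h * 1" unfolding power2_eq_square using h by (intro mult_left_mono) auto
        then show "exp h \<le> 1 + 2 * h" using exp_bound[of h] h by simp
      qed
      also have "\<dots> = 1 + f + 2 * h + f * (2 * h)" by (simp add: algebra_simps)
      also have "\<dots> \<le> 1 + f + 2 * h" using True h by (simp add: mult_nonpos_nonneg)
      finally show ?thesis by simp
    qed
    have "- \<bar>theta_integrated t - theta_integrated (t - h)\<bar> \<le> integral {t - h..t} theta_error"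
      using t h by (subst theta_integrated_diff) auto
    also have "\<dots> \<le> integral {t - h..t} (\<lambda>_. f + 2 * h)"
      using t h up by (intro integral_le theta_error_integrable) auto
    also have "\<dots> = h * (f + 2 * h)" using h by simp
    finally show ?thesis by (simp add: f_def algebra_simps power2_eq_square)
  qed
qed

lemma theta_error_decay: "((\<lambda>t. t ^ n * theta_error t) \<longlongrightarrow> 0) at_top"
proof -
  \<comment> \<open>With \<open>h = 1 / t ^ (n + 1)\<close> the integrated error is
    \<open>O(t^(-N)) = O(h^2)\<close>. The local inequality then gives an error \<open>O(h)\<close>,
    and \<open>t ^ n * h = 1 / t\<close>.\<close>
  define N where "N = 2 * n + 2"
  define H where "H = (\<lambda>T. theta_integrated T - Re (theta_laplace 0))"
  have HT: "\<bar>H T\<bar> \<le> norm (theta_laplace 0 - theta_laplace_upto T 0)" for T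
    using abs_Re_le_cmod[of "theta_laplace_upto T 0 - theta_laplace 0"]
    by (simp add: H_def theta_laplace_upto_0 norm_minus_commute)
  have "\<forall>\<^sub>F T in at_top. T ^ N * norm (theta_laplace 0 - theta_laplace_upto T 0) < 1"
    by (rule order_tendstoD(2)[OF laplace_decay]) simp
  then obtain T0 where T0: "\<And>T. T \<ge> T0 \<Longrightarrow> T ^ N * norm (theta_laplace 0 - theta_laplace_upto T 0) < 1"
    unfolding eventually_at_top_linorder by blast
  have bound: "norm (t ^ n * theta_error t) \<le> (2 + 4 * 2 ^ N) / t" if t: "t \<ge> 2" "t \<ge> 2 * T0" for t
  proof -
    define h where "h = 1 / t ^ (n + 1)"
    have "t ^ 1 \<le> t ^ (n + 1)" using t by (intro power_increasing) auto
    then have t2: "2 \<le> t ^ (n + 1)" using order.trans[OF t(1)] by simp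
    have h: "0 < h" "h \<le> 1 / 2" unfolding h_def using t t2 by (simp, intro frac_le) auto
    \<comment> \<open>The argument \<open>t - h\<close> may lie below \<open>t\<close>; the range
      \<open>s \<ge> t / 2\<close> covers it at the cost of \<open>2 ^ N\<close>.\<close>
    have Hb: "\<bar>H s\<bar> \<le> 2 ^ N * h ^ 2" if s: "s \<ge> t / 2" for s
    proof -
      have "(t / 2) ^ N * \<bar>H s\<bar> \<le> s ^ N * norm (theta_laplace 0 - theta_laplace_upto s 0)"
        using s t HT[of s] by (intro mult_mono power_mono) auto
      also have "\<dots> \<le> 1" using T0[of s] s t by simp
      finally have "\<bar>H s\<bar> \<le> 2 ^ N / t ^ N" using t by (simp add: power_divide field_simps)
      also have "t ^ N = (t ^ (n + 1)) ^ 2" 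
      proof -
        have "N = (n + 1) * 2" by (simp add: N_def)
        then show ?thesis by (simp only: power_mult)
      qed
      finally show ?thesis by (simp add: h_def power_divide)
    qed
    have t1: "t \<ge> 1" using t by simp
    note l = theta_error_local[OF t1 h]
    have "\<bar>theta_integrated (t + h) - theta_integrated t\<bar> \<le> 2 * 2 ^ N * h ^ 2"
      using Hb[of "t + h"] Hb[of t] h t by (simp add: H_def)
    then have "h * theta_error t \<le> 2 * h ^ 2 + 4 * 2 ^ N * h ^ 2" using l(1) by simp
    moreover have "\<bar>theta_integrated t - theta_integrated (t - h)\<bar> \<le> 2 * 2 ^ N * h ^ 2"
      using Hb[of "t - h"] Hb[of t] h t by (simp add: H_def)
    then have "- h * theta_error t \<le> 2 * h ^ 2 + 4 * 2 ^ N * h ^ 2" using l(2) zero_le_power2[of h] by simp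
    ultimately have "\<bar>h * theta_error t\<bar> \<le> h * ((2 + 4 * 2 ^ N) * h)" by (simp add: power2_eq_square algebra_simps abs_le_iff)
    then have "\<bar>theta_error t\<bar> \<le> (2 + 4 * 2 ^ N) * h" using h by (simp add: abs_mult)
    then have "t ^ n * \<bar>theta_error t\<bar> \<le> t ^ n * ((2 + 4 * 2 ^ N) * h)" using t by (intro mult_left_mono) auto
    also have "\<dots> = (2 + 4 * 2 ^ N) / t" using t by (simp add: h_def)
    finally show ?thesis using t by (simp add: abs_mult)
  qed
  show ?thesis
  proof (rule Lim_null_comparison[OF _ const_div_at_top])
    show "\<forall>\<^sub>F t in at_top. norm (t ^ n * theta_error t) \<le> (2 + 4 * 2 ^ N) / t"
      using eventually_ge_at_top[of 2] eventually_ge_at_top[of "2 * T0"] by eventually_elim (rule bound)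
  qed
qed

lemma theta_error_decay_bound: "\<exists>D>0. \<forall>t\<ge>0. \<bar>theta_error t\<bar> \<le> D / (1 + t) ^ n"
proof -
  have "\<forall>\<^sub>F t in at_top. norm (t ^ n * theta_error t) < 1"
    using order_tendstoD(2)[OF tendsto_norm_zero[OF theta_error_decay]] by simp
  then obtain T0 where T0: "\<And>t. t \<ge> T0 \<Longrightarrow> norm (t ^ n * theta_error t) < 1"
    unfolding eventually_at_top_linorder by blast
  define T1 where "T1 = max T0 1"
  have "\<bar>theta_error t\<bar> * (1 + t) ^ n \<le> (1 + T1) ^ (n + 1) + 2 ^ n" if t: "t \<ge> 0" for t
  proof (cases "t \<le> T1")
    case True
    have "\<bar>theta_error t\<bar> * (1 + t) ^ n \<le> (1 + T1) * (1 + T1) ^ n"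
      using theta_error_bound[OF t] True t by (intro mult_mono power_mono) auto
    then show ?thesis by (simp add: add_increasing2)
  next
    case False
    have "(1 + t) ^ n \<le> (2 * t) ^ n" using False by (intro power_mono) (auto simp: T1_def)
    then have "\<bar>theta_error t\<bar> * (1 + t) ^ n \<le> \<bar>theta_error t\<bar> * (2 * t) ^ n" by (intro mult_left_mono) auto
    also have "\<dots> = 2 ^ n * norm (t ^ n * theta_error t)" using t by (simp add: abs_mult power_mult_distrib)
    also have "\<dots> \<le> 2 ^ n * 1" using T0[of t] False by (intro mult_left_mono less_imp_le) (auto simp: T1_def)
    finally show ?thesis by (simp add: add_increasing T1_def)
  qed
  moreover have "(1 + T1) ^ (n + 1) + 2 ^ n > 0" by (intro add_nonneg_pos) (auto simp: T1_def)
  ultimately show ?thesis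
    by (intro exI[of _ "(1 + T1) ^ (n + 1) + 2 ^ n"]) (auto simp: pos_le_divide_eq)
qed

section \<open>Moments of the primes\<close>

lemma integral_inverse_square_bound:
  fixes F :: "real \<Rightarrow> real"
  assumes F: "\<And>T. T \<ge> 0 \<Longrightarrow> F integrable_on {0..T}"
    and bd: "\<And>t. t \<ge> 0 \<Longrightarrow> \<bar>F t\<bar> \<le> D / (1 + t) ^ 2" and ab: "0 \<le> a" "a \<le> b"
  shows "\<bar>integral {0..b} F - integral {0..a} F\<bar> \<le> D / (1 + a)"
proof -
  have "\<bar>F 0\<bar> \<le> D" using bd[of 0] by simp
  then have D: "D \<ge> 0" by linarith
  have J: "((\<lambda>t. D / (1 + t) ^ 2) has_integral (- D / (1 + b) - (- D / (1 + a)))) {a..b}"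
  proof (intro fundamental_theorem_of_calculus ab)
    fix t assume "t \<in> {a..b}"
    then have "1 + t > 0" using ab by auto
    then have "((\<lambda>t. - D / (1 + t)) has_real_derivative D / (1 + t) ^ 2) (at t within {a..b})"
      by (auto intro!: derivative_eq_intros simp: power2_eq_square)
    then show "((\<lambda>t. - D / (1 + t)) has_vector_derivative D / (1 + t) ^ 2) (at t within {a..b})"
      by (simp add: has_real_derivative_iff_has_vector_derivative)
  qed
  have "integral {0..b} F - integral {0..a} F = integral {a..b} F"
    using Henstock_Kurzweil_Integration.integral_combine[of 0 a b F] ab F[of b] by auto
  also have "norm \<dots> \<le> integral {a..b} (\<lambda>t. D / (1 + t) ^ 2)"
  proof (rule integral_norm_bound_integral)
    show "F integrable_on {a..b}" using F[of b] ab by (auto intro: integrable_on_subinterval)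
    show "norm (F t) \<le> D / (1 + t) ^ 2" if "t \<in> {a..b}" for t using bd[of t] that ab by auto
  qed (use J in auto)
  also have "\<dots> = D / (1 + a) - D / (1 + b)" using J by (simp add: integral_unique)
  also have "\<dots> \<le> D / (1 + a)" using D ab by simp
  finally show ?thesis by simp
qed

lemma integral_tendsto_inverse_square:
  fixes F :: "real \<Rightarrow> real"
  assumes F: "\<And>T. T \<ge> 0 \<Longrightarrow> F integrable_on {0..T}"
    and bd: "\<And>t. t \<ge> 0 \<Longrightarrow> \<bar>F t\<bar> \<le> D / (1 + t) ^ 2"
  shows "\<exists>l. ((\<lambda>T. integral {0..T} F) \<longlongrightarrow> l) at_top"
proof -
  have B: "\<bar>integral {0..b} F - integral {0..a} F\<bar> \<le> D / (1 + a)" if "0 \<le> a" "a \<le> b" for a b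
    using integral_inverse_square_bound[of F D a b] F bd that by blast
  have lim0: "((\<lambda>T. D / (1 + T)) \<longlongrightarrow> 0) at_top"
    by (intro tendsto_divide_0[OF tendsto_const] filterlim_at_top_imp_at_infinity
        filterlim_tendsto_add_at_top[OF tendsto_const filterlim_ident])
  define X where "X = (\<lambda>n. integral {0..real n} F)"
  have "Cauchy X"
  proof (rule CauchyI')
    fix e :: real assume "e > 0"
    then have "\<forall>\<^sub>F n in sequentially. D / (1 + real n) < e"
      by (intro order_tendstoD(2)[OF filterlim_compose[OF lim0 filterlim_real_sequentially]])
    then obtain M where M: "\<And>n. n \<ge> M \<Longrightarrow> D / (1 + real n) < e" by (auto simp: eventually_sequentially)
    have "dist (X m) (X n) < e" if "m \<ge> M" "n > m" for m n
      using B[of "real m" "real n"] M[OF that(1)] that by (auto simp: X_def dist_real_def abs_minus_commute)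
    then show "\<exists>M. \<forall>m\<ge>M. \<forall>n>m. dist (X m) (X n) < e" by blast
  qed
  then obtain l where l: "X \<longlonglongrightarrow> l" using Cauchy_convergent convergent_def by blast
  have "\<bar>integral {0..T} F - l\<bar> \<le> D / (1 + T)" if T: "T \<ge> 0" for T
  proof (rule tendsto_upperbound)
    show "(\<lambda>n. \<bar>integral {0..T} F - X n\<bar>) \<longlonglongrightarrow> \<bar>integral {0..T} F - l\<bar>"
      by (intro tendsto_intros l)
    have "\<forall>\<^sub>F n in sequentially. real n \<ge> T"
      using filterlim_real_sequentially by (simp add: filterlim_at_top)
    then show "\<forall>\<^sub>F n in sequentially. \<bar>integral {0..T} F - X n\<bar> \<le> D / (1 + T)"
      by eventually_elim (subst abs_minus_commute, use B[OF T] in \<open>simp add: X_def\<close>)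
  qed auto
  then have "((\<lambda>T. integral {0..T} F - l) \<longlongrightarrow> 0) at_top"
    by (intro Lim_null_comparison[OF _ lim0] eventually_mono[OF eventually_ge_at_top[of 0]]) auto
  then show ?thesis using Lim_null by blast
qed

text \<open>The shift \<open>k = j - 1\<close> makes \<open>k\<close> the order of the corresponding
  derivative at 1; \<open>alpha j\<close> is the limit of
  \<open>- prime_moment (j - 1) (ln x) / j\<close>.\<close>

definition prime_moment :: "nat \<Rightarrow> real \<Rightarrow> real" where
  "prime_moment k T = (\<Sum>p\<in>primes_exp T. ln (real p) ^ Suc k / real p) - T ^ Suc k / real (Suc k)"

lemma integral_power_Suc: "T \<ge> 0 \<Longrightarrow> ((\<lambda>t. t ^ k) has_integral T ^ Suc k / real (Suc k)) {0..T}" for T :: real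
proof -
  assume T: "T \<ge> 0"
  have "((\<lambda>t. t ^ k) has_integral (T ^ Suc k / real (Suc k) - 0 ^ Suc k / real (Suc k))) {0..T}"
  proof (intro fundamental_theorem_of_calculus T)
    fix t :: real
    have "((\<lambda>t. t ^ Suc k / real (Suc k)) has_real_derivative t ^ k) (at t within {0..T})"
      by (auto intro!: derivative_eq_intros simp del: power_Suc)
    then show "((\<lambda>t. t ^ Suc k / real (Suc k)) has_vector_derivative t ^ k) (at t within {0..T})"
      by (simp add: has_real_derivative_iff_has_vector_derivative)
  qed
  then show ?thesis by simp
qed

lemma theta_error_decay_mult:
  assumes "\<And>t. t \<ge> 0 \<Longrightarrow> \<bar>\<psi> t\<bar> \<le> A * (1 + t) ^ n" "A \<ge> 0" "t \<ge> 0"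
    and D: "\<And>t. t \<ge> 0 \<Longrightarrow> \<bar>theta_error t\<bar> \<le> D / (1 + t) ^ (n + 2)" "D \<ge> 0"
  shows "\<bar>theta_error t * \<psi> t\<bar> \<le> A * D / (1 + t) ^ 2"
proof -
  have "\<bar>theta_error t * \<psi> t\<bar> \<le> D / (1 + t) ^ (n + 2) * (A * (1 + t) ^ n)"
    unfolding abs_mult using assms by (intro mult_mono) auto
  also have "\<dots> = A * D / (1 + t) ^ 2"
  proof -
    have "D / u ^ (n + 2) * (A * u ^ n) = A * D / u ^ 2" if "u > 0" for u
      using that by (simp add: power_add del: add_2_eq_Suc')
    then show ?thesis using assms(3) by simp
  qed
  finally show ?thesis .
qed

text \<open>Summation by parts with \<open>\<phi> t = t ^ k\<close>. Decay of the error to the order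
  \<open>k + 2\<close> leaves an integrand \<open>O((1 + t)^(-2))\<close>. The summand
  \<open>0 ^ k\<close> is \<open>\<phi> 0\<close>, which is 1 for \<open>k = 0\<close>.\<close>

lemma prime_moment_convergent: "\<exists>L. (prime_moment k \<longlongrightarrow> L) at_top"
proof -
  define \<psi> where "\<psi> = (\<lambda>t::real. t ^ k - real k * t ^ (k - 1))"
  define F where "F = (\<lambda>t. theta_error t * \<psi> t)"
  have I: "(F has_integral (prime_moment k T - theta_error T * T ^ k - 0 ^ k)) {0..T}" if T: "T \<ge> 0" for T
  proof -
    have "((\<lambda>t. theta_error t *\<^sub>R (t ^ k - real k * t ^ (k - 1))) has_integral
      ((\<Sum>p\<in>primes_exp T. (ln (real p) / real p) *\<^sub>R ln (real p) ^ k) - integral {0..T} (\<lambda>t. t ^ k) - theta_error T *\<^sub>R T ^ k - 0 ^ k)) {0..T}"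
    proof (rule prime_sum_by_parts[OF T])
      fix t
      show "((\<lambda>t. t ^ k) has_vector_derivative real k * t ^ (k - 1)) (at t within {0..T})"
        unfolding has_real_derivative_iff_has_vector_derivative[symmetric]
        by (auto intro!: derivative_eq_intros)
    qed
    then show ?thesis using integral_unique[OF integral_power_Suc[OF T, of k]]
      by (simp add: prime_moment_def F_def \<psi>_def)
  qed
  obtain D where D: "D > 0" "\<And>t. t \<ge> 0 \<Longrightarrow> \<bar>theta_error t\<bar> \<le> D / (1 + t) ^ (k + 2)"
    using theta_error_decay_bound[of "k + 2"] by blast
  have \<psi>b: "\<bar>\<psi> t\<bar> \<le> (1 + real k) * (1 + t) ^ k" if t: "t \<ge> 0" for t
  proof -
    have "\<bar>\<psi> t\<bar> \<le> t ^ k + real k * t ^ (k - 1)"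
      unfolding \<psi>_def using t abs_triangle_ineq4[of "t ^ k" "real k * t ^ (k - 1)"] by (simp add: abs_mult)
    also have "\<dots> \<le> (1 + t) ^ k + real k * (1 + t) ^ k"
      using t by (intro add_mono mult_left_mono power_mono order.trans[OF power_mono power_increasing]) auto
    finally show ?thesis by (simp add: algebra_simps)
  qed
  have Fb: "\<bar>F t\<bar> \<le> (1 + real k) * D / (1 + t) ^ 2" if "t \<ge> 0" for t
    unfolding F_def using D that by (intro theta_error_decay_mult[where n = k] \<psi>b) auto
  have "\<exists>l. ((\<lambda>T. integral {0..T} F) \<longlongrightarrow> l) at_top"
    using I by (intro integral_tendsto_inverse_square[OF _ Fb]) auto
  then obtain l where l: "((\<lambda>T. integral {0..T} F) \<longlongrightarrow> l) at_top" by blast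
  have "((\<lambda>T. integral {0..T} F + T ^ k * theta_error T + 0 ^ k) \<longlongrightarrow> l + 0 + 0 ^ k) at_top"
    by (intro tendsto_intros l theta_error_decay)
  moreover have "\<forall>\<^sub>F T in at_top. integral {0..T} F + T ^ k * theta_error T + 0 ^ k = prime_moment k T"
    using eventually_ge_at_top[of 0] by eventually_elim (simp add: integral_unique[OF I])
  ultimately have "(prime_moment k \<longlongrightarrow> l + 0 + 0 ^ k) at_top" by (rule Lim_transform_eventually)
  then show ?thesis by blast
qed

definition moment_limit :: "nat \<Rightarrow> real" where
  "moment_limit k = Lim at_top (prime_moment k)"

lemma prime_moment_tendsto: "(prime_moment k \<longlongrightarrow> moment_limit k) at_top"
  using prime_moment_convergent[of k] tendsto_Lim[of at_top "prime_moment k"]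
  unfolding moment_limit_def by auto

text \<open>\<open>Lim\<close> yields the limit only once convergence is known; the substitution
  \<open>T = ln x\<close> transfers it from the moments.\<close>

lemma alpha_eq_moment_limit:
  assumes "j \<ge> 1"
  shows "alpha j = - moment_limit (j - 1) / real j"
proof -
  have "((\<lambda>x. - prime_moment (j - 1) (ln x) / real j) \<longlongrightarrow> - moment_limit (j - 1) / real j) at_top"
    by (intro tendsto_intros filterlim_compose[OF prime_moment_tendsto ln_at_top]) (use assms in auto)
  moreover have "\<forall>\<^sub>F x::real in at_top. - prime_moment (j - 1) (ln x) / real j
    = (1 / real j) * (ln x ^ j / real j - (\<Sum>p | prime (p::nat) \<and> real p \<le> x. ln (real p) ^ j / real p))"
    using eventually_gt_at_top[of 0]
  proof eventually_elim
    case (elim x)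
    then show ?case using assms by (simp add: prime_moment_def primes_exp_def)
  qed
  ultimately have "((\<lambda>x::real. (1 / real j) * (ln x ^ j / real j - (\<Sum>p | prime (p::nat) \<and> real p \<le> x. ln (real p) ^ j / real p)))
     \<longlongrightarrow> - moment_limit (j - 1) / real j) at_top"
    by (rule Lim_transform_eventually)
  then show ?thesis unfolding alpha_def by (intro tendsto_Lim) auto
qed

section \<open>One-sided expansion of the prime series at 1\<close>

definition exp_remainder :: "nat \<Rightarrow> real \<Rightarrow> real" where
  "exp_remainder j y = exp (- y) - (\<Sum>k<j. (- y) ^ k / fact k)"

lemma exp_remainder_bound:
  assumes "y \<ge> 0"
  shows "\<bar>exp_remainder j y\<bar> \<le> y ^ j"
proof (cases "j = 0 \<or> y = 0")
  case True
  then show ?thesis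
  proof
    assume "y = 0"
    then show ?thesis by (cases j) (auto simp: exp_remainder_def sum.lessThan_Suc_shift simp del: sum.lessThan_Suc)
  qed (use assms in \<open>auto simp: exp_remainder_def\<close>)
next
  case False
  then have "- y < 0" "0 < j" using assms by auto
  then obtain t where t: "- y < t" "t < 0"
    and eq: "exp (- y) = (\<Sum>m<j. exp 0 / fact m * (- y) ^ m) + exp t / fact j * (- y) ^ j"
    using Maclaurin_minus[of "- y" j "\<lambda>_. exp" exp] by (auto intro: DERIV_exp)
  have "\<bar>exp_remainder j y\<bar> = exp t / fact j * y ^ j"
    unfolding exp_remainder_def eq using assms by (simp add: abs_mult power_abs mult.commute)
  also have "\<dots> \<le> 1 * y ^ j"
  proof (intro mult_right_mono)
    have "exp t \<le> 1" using t by simp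
    also have "(1::real) \<le> fact j" by simp
    finally show "exp t / fact j \<le> 1" by simp
  qed (use assms in auto)
  finally show ?thesis by simp
qed

lemma exp_remainder_derivative:
  "((\<lambda>t. exp_remainder (Suc j) (x * t)) has_real_derivative - x * exp_remainder j (x * t)) (at t within A)"
proof -
  have "((\<lambda>t. (- (x * t)) ^ Suc k / fact (Suc k)) has_real_derivative - x * ((- (x * t)) ^ k / fact k)) (at t within A)" for k
    by (auto intro!: derivative_eq_intros simp: divide_simps simp del: power_Suc)
  then have "((\<lambda>t. exp (- (x * t)) - (1 + (\<Sum>k<j. (- (x * t)) ^ Suc k / fact (Suc k)))) has_real_derivative
     (- x * exp (- (x * t)) - (0 + (\<Sum>k<j. - x * ((- (x * t)) ^ k / fact k))))) (at t within A)"
    by (intro derivative_intros DERIV_sum) (auto intro!: derivative_eq_intros)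
  then show ?thesis
    by (simp add: exp_remainder_def sum.lessThan_Suc_shift sum_distrib_left sum_negf algebra_simps del: sum.lessThan_Suc power_Suc)
qed

text \<open>This is \<open>F(1 + x) - 1/x\<close>, meant for real \<open>x > 0\<close>, where the
  prime series converges absolutely.\<close>

definition prime_series_reg :: "real \<Rightarrow> real" where
  "prime_series_reg x = Re (primesum (\<lambda>q. q) (1 + of_real x)) - 1 / x"

lemma prime_series_reg_tendsto:
  assumes x: "x > 0"
  shows "((\<lambda>T. (\<Sum>p\<in>primes_exp T. ln (real p) / real p * exp (- (x * ln (real p)))) - integral {0..T} (\<lambda>t. exp (- (x * t))))
     \<longlongrightarrow> prime_series_reg x) at_top"
proof -
  have e: "exp (- (complex_of_real x * of_real t)) = of_real (exp (- (x * t)))" for t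
    using exp_of_real[of "- (x * t)", where 'a = complex] by simp
  have z: "Re (complex_of_real x) > 0" using x by simp
  have "((\<lambda>T. Re (\<Sum>p\<in>primes_exp T. (ln (real p) / real p) *\<^sub>R exp (- (complex_of_real x * of_real (ln (real p))))))
     \<longlongrightarrow> Re (primesum (\<lambda>q. q) (1 + of_real x))) at_top"
    by (intro tendsto_Re prime_sum_tendsto z)
  then have 1: "((\<lambda>T. \<Sum>p\<in>primes_exp T. ln (real p) / real p * exp (- (x * ln (real p)))) \<longlongrightarrow> Re (primesum (\<lambda>q. q) (1 + of_real x))) at_top"
    by (simp only: e Re_sum scaleR_complex.sel Re_complex_of_real)
  have "integral {0..T} (\<lambda>t. exp (- (complex_of_real x * of_real t))) = of_real (integral {0..T} (\<lambda>t. exp (- (x * t))))" for T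
    unfolding e by (intro integral_unique has_integral_of_real integrable_integral integrable_continuous_interval continuous_intros)
  then have 2: "((\<lambda>T. integral {0..T} (\<lambda>t. exp (- (x * t)))) \<longlongrightarrow> Re (1 / of_real x)) at_top"
    using tendsto_Re[OF integral_exp_tendsto[OF z]] by simp
  show ?thesis using tendsto_diff[OF 1 2] by (simp add: prime_series_reg_def)
qed

text \<open>In the sum over \<open>exp (- x ln p) ln p / p\<close> the exponential is split into a
  Taylor polynomial, which produces the moments, and a remainder, which is summed by parts. The
  remainder is \<open>O((x t)^(j+1))\<close>, so the decay of \<open>theta_error\<close> yields a
  bound uniform in the cut-off \<open>T\<close>.\<close>

lemma prime_series_reg_expansion:
  "\<exists>C. \<forall>x>0. \<bar>prime_series_reg x - (\<Sum>k<Suc j. (- x) ^ k / fact k * moment_limit k)\<bar> \<le> C * x ^ Suc j"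
proof -
  obtain D where D: "D > 0" "\<And>t. t \<ge> 0 \<Longrightarrow> \<bar>theta_error t\<bar> \<le> D / (1 + t) ^ (Suc j + 2)"
    using theta_error_decay_bound[of "Suc j + 2"] by blast
  have "\<bar>prime_series_reg x - (\<Sum>k<Suc j. (- x) ^ k / fact k * moment_limit k)\<bar> \<le> 3 * D * x ^ Suc j" if x: "x > 0" for x
  proof (rule tendsto_upperbound)
    define \<phi> where "\<phi> = (\<lambda>t. exp_remainder (Suc j) (x * t))"
    define \<phi>' where "\<phi>' = (\<lambda>t. - x * exp_remainder j (x * t))"
    define E where "E = (\<lambda>T. (\<Sum>p\<in>primes_exp T. ln (real p) / real p * exp (- (x * ln (real p)))) - integral {0..T} (\<lambda>t. exp (- (x * t))))"
    show "((\<lambda>T. \<bar>E T - (\<Sum>k<Suc j. (- x) ^ k / fact k * prime_moment k T)\<bar>) \<longlongrightarrow>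
      \<bar>prime_series_reg x - (\<Sum>k<Suc j. (- x) ^ k / fact k * moment_limit k)\<bar>) at_top"
      unfolding E_def by (intro tendsto_intros prime_series_reg_tendsto x prime_moment_tendsto)
    have \<phi>b: "\<bar>\<phi> t\<bar> \<le> x ^ Suc j * (1 + t) ^ Suc j" if "t \<ge> 0" for t
    proof -
      have "\<bar>\<phi> t\<bar> \<le> (x * t) ^ Suc j" unfolding \<phi>_def using x that by (intro exp_remainder_bound) auto
      also have "\<dots> \<le> (x * (1 + t)) ^ Suc j" using x that by (intro power_mono) auto
      finally show ?thesis by (simp only: power_mult_distrib)
    qed
    have \<phi>'b: "\<bar>\<phi> t - \<phi>' t\<bar> \<le> 2 * x ^ Suc j * (1 + t) ^ Suc j" if t: "t \<ge> 0" for t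
    proof -
      have "\<bar>exp_remainder j (x * t)\<bar> \<le> (x * t) ^ j" using x t by (intro exp_remainder_bound) auto
      then have "\<bar>\<phi>' t\<bar> \<le> x * (x * t) ^ j" unfolding \<phi>'_def using x by (simp add: abs_mult)
      also have "\<dots> = x ^ Suc j * t ^ j" by (simp add: power_mult_distrib)
      also have "\<dots> \<le> x ^ Suc j * (1 + t) ^ Suc j"
        using x t by (intro mult_left_mono order.trans[OF power_mono[of t "1 + t" j] power_increasing]) auto
      finally show ?thesis using \<phi>b[OF t] by linarith
    qed
    have "\<bar>E T - (\<Sum>k<Suc j. (- x) ^ k / fact k * prime_moment k T)\<bar> \<le> 3 * D * x ^ Suc j" if T: "T \<ge> 0" for T
    proof -
      define F where "F = (\<lambda>t. theta_error t * (\<phi> t - \<phi>' t))"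
      have parts: "((\<lambda>t. theta_error t *\<^sub>R (\<phi> t - \<phi>' t)) has_integral
        ((\<Sum>p\<in>primes_exp T. (ln (real p) / real p) *\<^sub>R \<phi> (ln (real p))) - integral {0..T} \<phi> - theta_error T *\<^sub>R \<phi> T - \<phi> 0)) {0..T}" if T: "T \<ge> 0" for T
      proof (rule prime_sum_by_parts[OF T])
        show "(\<phi> has_vector_derivative \<phi>' t) (at t within {0..T})" for t
          unfolding has_real_derivative_iff_has_vector_derivative[symmetric] \<phi>_def \<phi>'_def by (rule exp_remainder_derivative)
      qed
      \<comment> \<open>The boundary term at 0 would otherwise not be small in
        \<open>x\<close>.\<close>
      have "\<phi> 0 = 0"
        unfolding \<phi>_def exp_remainder_def by (simp add: sum.lessThan_Suc_shift del: sum.lessThan_Suc)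
      then have I: "integral {0..T} F = (\<Sum>p\<in>primes_exp T. ln (real p) / real p * \<phi> (ln (real p))) - integral {0..T} \<phi> - theta_error T * \<phi> T"
        using integral_unique[OF parts[OF T]] by (simp add: F_def)
      have Fb: "\<bar>F t\<bar> \<le> 2 * x ^ Suc j * D / (1 + t) ^ 2" if "t \<ge> 0" for t
        unfolding F_def using D x that by (intro theta_error_decay_mult[where n = "Suc j"] \<phi>'b) auto
      have Fi: "F integrable_on {0..T}" if "T \<ge> 0" for T
        using parts[OF that] by (auto simp: F_def)
      have bF: "\<bar>integral {0..T} F\<bar> \<le> 2 * x ^ Suc j * D"
        using integral_inverse_square_bound[OF Fi Fb, of 0 T] T by simp
      have "\<bar>theta_error T * \<phi> T\<bar> \<le> x ^ Suc j * D / (1 + T) ^ 2"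
        using D x T by (intro theta_error_decay_mult[where n = "Suc j"] \<phi>b) auto
      also have "\<dots> \<le> x ^ Suc j * D / 1"
        using T D x by (intro frac_le) auto
      finally have b\<phi>: "\<bar>theta_error T * \<phi> T\<bar> \<le> x ^ Suc j * D" by simp
      have "(\<Sum>p\<in>primes_exp T. ln (real p) / real p * \<phi> (ln (real p))) =
         (\<Sum>p\<in>primes_exp T. ln (real p) / real p * exp (- (x * ln (real p)))) - (\<Sum>k<Suc j. (- x) ^ k / fact k * (\<Sum>p\<in>primes_exp T. ln (real p) ^ Suc k / real p))"
      proof -
        have "(\<Sum>k<Suc j. (- x) ^ k / fact k * (\<Sum>p\<in>primes_exp T. ln (real p) ^ Suc k / real p)) =
          (\<Sum>p\<in>primes_exp T. \<Sum>k<Suc j. (- x) ^ k / fact k * (ln (real p) ^ Suc k / real p))"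
          unfolding sum_distrib_left by (rule sum.swap)
        also have "\<dots> = (\<Sum>p\<in>primes_exp T. ln (real p) / real p * (\<Sum>k<Suc j. (- (x * ln (real p))) ^ k / fact k))"
          unfolding sum_distrib_left
        proof (intro sum.cong refl)
          fix p k
          have "(- (x * ln (real p))) ^ k = (- x) ^ k * ln (real p) ^ k" by (simp flip: power_mult_distrib)
          then show "(- x) ^ k / fact k * (ln (real p) ^ Suc k / real p) = ln (real p) / real p * ((- (x * ln (real p))) ^ k / fact k)"
            by (simp add: mult_ac)
        qed
        finally show ?thesis unfolding \<phi>_def exp_remainder_def by (simp only: right_diff_distrib sum_subtractf)
      qed
      moreover have "integral {0..T} \<phi> = integral {0..T} (\<lambda>t. exp (- (x * t))) - (\<Sum>k<Suc j. (- x) ^ k / fact k * (T ^ Suc k / real (Suc k)))"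
      proof (rule integral_unique)
        have "((\<lambda>t. exp (- (x * t)) - (\<Sum>k<Suc j. (- x) ^ k / fact k * t ^ k)) has_integral
          (integral {0..T} (\<lambda>t. exp (- (x * t))) - (\<Sum>k<Suc j. (- x) ^ k / fact k * (T ^ Suc k / real (Suc k))))) {0..T}"
          by (intro has_integral_diff has_integral_sum has_integral_mult_right integral_power_Suc T integrable_integral
             integrable_continuous_interval continuous_intros) auto
        moreover have "(\<lambda>t. exp (- (x * t)) - (\<Sum>k<Suc j. (- x) ^ k / fact k * t ^ k)) = \<phi>"
          unfolding \<phi>_def exp_remainder_def fun_eq_iff by (simp add: power_mult_distrib[symmetric])
        ultimately show "(\<phi> has_integral
          (integral {0..T} (\<lambda>t. exp (- (x * t))) - (\<Sum>k<Suc j. (- x) ^ k / fact k * (T ^ Suc k / real (Suc k))))) {0..T}" by simp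
      qed
      ultimately have "E T - (\<Sum>k<Suc j. (- x) ^ k / fact k * prime_moment k T) = integral {0..T} F + theta_error T * \<phi> T"
        unfolding I E_def prime_moment_def right_diff_distrib sum_subtractf by linarith
      then show ?thesis using bF b\<phi> by (simp add: algebra_simps)
    qed
    then show "\<forall>\<^sub>F T in at_top. \<bar>E T - (\<Sum>k<Suc j. (- x) ^ k / fact k * prime_moment k T)\<bar> \<le> 3 * D * x ^ Suc j"
      by (intro eventually_mono[OF eventually_ge_at_top[of 0]])
  qed auto
  then show ?thesis by blast
qed

section \<open>Asymptotics of the constants\<close>

lemma xi_nonzero_near_1:
  assumes "norm (w - 1) < 1" "Re w > 0"
  shows "xi w \<noteq> 0"
proof (rule xi_nonzero)
  have "norm w \<le> norm (w - 1) + 1" using norm_triangle_ineq[of "w - 1" 1] by simp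
  then have "norm w * norm (w - 1) \<le> 2 * 1" using assms by (intro mult_mono) auto
  then show "norm w * norm (w - 1) < 4 * (Re w + 1)" using assms by simp
qed (use assms in simp)

text \<open>The circle about \<open>c\<close> bounding this disc passes through \<open>1 + i\<close>
  and \<open>1 - i\<close>, so the part of the disc with \<open>Re w \<le> 1\<close> lies in the
  unit disc around 1.\<close>

lemma xi_nonzero_ball:
  fixes c :: real
  assumes w: "norm (w - of_real c) ^ 2 < 1 + (c - 1) ^ 2" and "c \<ge> 1" "Re w > 0"
  shows "xi w \<noteq> 0"
proof (cases "Re w > 1")
  case False
  have "norm (w - 1) ^ 2 = norm (w - of_real c) ^ 2 + 2 * (c - 1) * (Re w - 1) - (c - 1) ^ 2"
    unfolding cmod_power2 by (simp add: power2_eq_square algebra_simps)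
  also have "2 * (c - 1) * (Re w - 1) \<le> 0" using assms False by (intro mult_nonneg_nonpos) auto
  finally have "norm (w - 1) ^ 2 < 1" using w by simp
  then have "norm (w - 1) < 1" by (simp add: power2_less_1_iff abs_square_less_1)
  then show ?thesis using assms by (intro xi_nonzero_near_1)
qed (rule xi_nonzero_right)

text \<open>What remains of \<open>F\<close> after \<open>1/(s-1) - 1/(2s-1) - 1/(3s-1)\<close> is
  taken out.\<close>

definition regular_part :: "complex \<Rightarrow> complex" where
  "regular_part s = xi_logderiv (2 * s) + xi_logderiv (3 * s) - xi_logderiv s - prime_tail5 s"

text \<open>Dilation by \<open>c\<close> maps the disc of radius \<open>r\<close> about 1 to the
  disc of radius \<open>c r\<close> about \<open>c\<close>, to which \<open>xi_nonzero_ball\<close>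
  applies if \<open>c^2 r^2 < 1 + (c - 1)^2\<close>. This holds for all real \<open>c\<close>
  exactly when \<open>r^2 < 1/2\<close>, as is the case for \<open>r = 7/10\<close>.\<close>

lemma regular_part_holomorphic: "regular_part holomorphic_on ball 1 (7 / 10)"
proof -
  have ball: "norm (s - 1) < 7 / 10" "Re s > 3 / 10" if "s \<in> ball 1 (7 / 10)" for s
    using that abs_Re_le_cmod[of "s - 1"] by (auto simp: dist_norm norm_minus_commute)
  have "(\<lambda>s. xi_logderiv (of_real c * s)) holomorphic_on ball 1 (7 / 10)" if c: "c \<ge> 1" "c \<le> 3" for c :: real
  proof -
    have "(xi_logderiv \<circ> (\<lambda>s. of_real c * s)) holomorphic_on ball 1 (7 / 10)"
    proof (rule holomorphic_on_compose)
      show "xi_logderiv holomorphic_on (\<lambda>s. of_real c * s) ` ball (1::complex) (7 / 10)"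
      proof (rule xi_logderiv_holomorphic)
        show "(\<lambda>s. of_real c * s) ` ball (1::complex) (7 / 10) \<subseteq> {s. Re s > 0}" using ball(2) c by force
        fix w assume "w \<in> (\<lambda>s. of_real c * s) ` ball (1::complex) (7 / 10)"
        then obtain s where s: "w = of_real c * s" "s \<in> ball 1 (7 / 10)" by blast
        have "w - of_real c = of_real c * (s - 1)" by (simp add: s algebra_simps)
        then have "norm (w - of_real c) ^ 2 = c ^ 2 * norm (s - 1) ^ 2" by (simp add: norm_mult power_mult_distrib)
        also have "\<dots> \<le> c ^ 2 * (7 / 10) ^ 2" using ball[OF s(2)] by (intro mult_left_mono power_mono) auto
        also have "\<dots> < 1 + (c - 1) ^ 2"
        proof -
          \<comment> \<open>Completing the square in \<open>(51/100) c^2 - 2 c + 2\<close>, which is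
            the difference of the two sides.\<close>
          have "(51 * c - 100) ^ 2 \<ge> 0" by simp
          then show ?thesis by (simp add: power2_eq_square algebra_simps)
        qed
        finally show "xi w \<noteq> 0" using ball[OF s(2)] c by (intro xi_nonzero_ball[of w c]) (auto simp: s)
      qed
    qed (intro holomorphic_intros)
    then show ?thesis by (simp add: o_def)
  qed
  from this[of 1] this[of 2] this[of 3] 
  have "xi_logderiv holomorphic_on ball 1 (7 / 10)" "(\<lambda>s. xi_logderiv (2 * s)) holomorphic_on ball 1 (7 / 10)"
    "(\<lambda>s. xi_logderiv (3 * s)) holomorphic_on ball 1 (7 / 10)" by auto
  moreover have "prime_tail5 holomorphic_on ball 1 (7 / 10)"
    by (rule holomorphic_on_subset[OF prime_tail5_holomorphic[of "3 / 10"]]) (use ball in auto)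
  ultimately show ?thesis unfolding regular_part_def by (intro holomorphic_intros)
qed

lemma prime_series_reg_eq:
  assumes "x > 0"
  shows "prime_series_reg x = Re (regular_part (1 + of_real x)) - 1 / (1 + 2 * x) - 1 / (2 + 3 * x)"
proof -
  have "primesum (\<lambda>q. q) (1 + of_real x) = of_real (1 / x) - of_real (1 / (1 + 2 * x)) - of_real (1 / (2 + 3 * x)) + regular_part (1 + of_real x)"
    using prime_series_eq_tail5[of "1 + of_real x"] assms by (simp add: regular_part_def algebra_simps)
  then show ?thesis unfolding prime_series_reg_def by (simp only: plus_complex.sel minus_complex.sel Re_complex_of_real)
qed

lemma holomorphic_taylor_bound:
  assumes f: "f holomorphic_on ball z r" and r: "0 < d" "d < r"
  shows "\<exists>C. \<forall>x. 0 < x \<longrightarrow> x \<le> d \<longrightarrow>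
    norm (f (z + of_real x) - (\<Sum>k<Suc n. (deriv ^^ k) f z / fact k * of_real x ^ k)) \<le> C * x ^ Suc n"
proof -
  have sub: "cball z d \<subseteq> ball z r" using r by auto
  have hol: "(deriv ^^ i) f holomorphic_on ball z r" for i using f by (intro holomorphic_higher_deriv) auto
  have "bounded ((deriv ^^ Suc n) f ` cball z d)"
    by (intro compact_imp_bounded compact_continuous_image holomorphic_on_imp_continuous_on holomorphic_on_subset[OF hol sub]) auto
  then obtain B where B: "\<And>w. w \<in> cball z d \<Longrightarrow> norm ((deriv ^^ Suc n) f w) \<le> B"
    unfolding bounded_iff by blast
  have "norm (f (z + of_real x) - (\<Sum>k<Suc n. (deriv ^^ k) f z / fact k * of_real x ^ k)) \<le> B / fact n * x ^ Suc n"
    if x: "0 < x" "x \<le> d" for x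
  proof -
    have "norm ((deriv ^^ 0) f (z + of_real x) - (\<Sum>i\<le>n. (deriv ^^ i) f z * (z + of_real x - z) ^ i / fact i)) \<le> B * norm (z + of_real x - z) ^ Suc n / fact n"
    proof (rule complex_Taylor[of "cball z d" n "\<lambda>i. (deriv ^^ i) f" B z "z + of_real x"])
      fix i w assume "w \<in> cball z d"
      then have "w \<in> ball z r" using sub by blast
      then show "((deriv ^^ i) f has_field_derivative (deriv ^^ Suc i) f w) (at w within cball z d)"
        using holomorphic_derivI[OF hol[of i], of w] by (auto intro: has_field_derivative_at_within)
    qed (use B x r in \<open>auto simp: dist_norm\<close>)
    then show ?thesis using x by (simp add: lessThan_Suc_atMost mult_ac del: power_Suc sum.lessThan_Suc)
  qed
  then show ?thesis by blast
qed

section \<open>Comparison of coefficients\<close>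

lemma geometric_expansion:
  fixes a x :: real
  assumes "a > 0" "x > 0"
  shows "\<bar>1 / (1 + a * x) - (\<Sum>k<n. (- a * x) ^ k)\<bar> \<le> a ^ n * x ^ n"
proof -
  have ax: "a * x > 0" using assms by simp
  have "(\<Sum>k<n. (- a * x) ^ k) = (1 - (- a * x) ^ n) / (1 + a * x)"
    using geometric_sum[of "- a * x" n] ax by (simp add: field_simps)
  then have "1 / (1 + a * x) - (\<Sum>k<n. (- a * x) ^ k) = (- a * x) ^ n / (1 + a * x)"
    by (simp add: diff_divide_distrib)
  then have "\<bar>1 / (1 + a * x) - (\<Sum>k<n. (- a * x) ^ k)\<bar> = (a * x) ^ n / (1 + a * x)"
    using ax assms by (simp add: abs_mult power_abs)
  also have "\<dots> \<le> (a * x) ^ n / 1" using ax by (intro frac_le) auto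
  finally show ?thesis by (simp add: power_mult_distrib)
qed

text \<open>Uniqueness of one-sided asymptotic expansions: letting \<open>x\<close> tend to 0 from
  the right kills the constant coefficient, and division by \<open>x\<close> lowers the
  order.\<close>

lemma small_polynomial_zero:
  fixes a :: "nat \<Rightarrow> real"
  assumes "d > 0" "\<And>x. 0 < x \<Longrightarrow> x \<le> d \<Longrightarrow> \<bar>\<Sum>k<n. a k * x ^ k\<bar> \<le> C * x ^ n"
  shows "k < n \<Longrightarrow> a k = 0"
  using assms
proof (induction n arbitrary: a k)
  case (Suc n)
  have ev: "\<forall>\<^sub>F x in at_right 0. 0 < x \<and> x \<le> d"
    using Suc.prems(2) by (auto simp: eventually_at_right intro: exI[of _ d])
  have "((\<lambda>x. \<bar>\<Sum>k<Suc n. a k * x ^ k\<bar>) \<longlongrightarrow> \<bar>\<Sum>k<Suc n. a k * 0 ^ k\<bar>) (at_right 0)"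
    by (intro tendsto_intros)
  moreover have "((\<lambda>x. C * x ^ Suc n) \<longlongrightarrow> C * 0 ^ Suc n) (at_right 0)" by (intro tendsto_intros)
  moreover have "\<forall>\<^sub>F x in at_right 0. \<bar>\<Sum>k<Suc n. a k * x ^ k\<bar> \<le> C * x ^ Suc n"
    using ev by eventually_elim (use Suc.prems(3) in auto)
  ultimately have "\<bar>\<Sum>k<Suc n. a k * 0 ^ k\<bar> \<le> C * 0 ^ Suc n"
    by (intro tendsto_le[of "at_right 0"]) auto
  then have a0: "a 0 = 0" by (simp add: sum.lessThan_Suc_shift del: sum.lessThan_Suc)
  have shift: "\<bar>\<Sum>k<n. a (Suc k) * x ^ k\<bar> \<le> C * x ^ n" if x: "0 < x" "x \<le> d" for x
  proof -
    have "(\<Sum>k<Suc n. a k * x ^ k) = x * (\<Sum>k<n. a (Suc k) * x ^ k)"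
      by (simp add: sum.lessThan_Suc_shift a0 sum_distrib_left mult_ac del: sum.lessThan_Suc)
    then have "x * \<bar>\<Sum>k<n. a (Suc k) * x ^ k\<bar> \<le> x * (C * x ^ n)"
      using Suc.prems(3)[OF x] x by (simp add: abs_mult mult_ac)
    then show ?thesis using x by simp
  qed
  show ?case
  proof (cases k)
    case (Suc i)
    then show ?thesis using Suc.IH[of i "\<lambda>k. a (Suc k)"] Suc.prems shift by simp
  qed (simp add: a0)
qed simp

definition regular_coeff :: "nat \<Rightarrow> real" where
  "regular_coeff k = Re ((deriv ^^ k) regular_part 1 / fact k)"

text \<open>Two expansions of \<open>prime_series_reg\<close> at 0 are compared. The pole terms
  become \<open>1/(1 + 2x)\<close> and \<open>1/(2 + 3x)\<close>, whose geometric series supply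
  \<open>2 ^ k\<close> and \<open>(3 / 2) ^ k / 2\<close>.\<close>

lemma moment_limit_eq:
  "moment_limit k = - fact k * (2 ^ k + (3 / 2) ^ k / 2) + (- 1) ^ k * fact k * regular_coeff k"
proof -
  define n where "n = Suc k"
  \<comment> \<open>The difference of the \<open>i\<close>-th coefficients of the two
    expansions.\<close>
  define a where "a = (\<lambda>i. (- 1) ^ i / fact i * moment_limit i - (regular_coeff i - (- 2) ^ i - (- (3 / 2)) ^ i / 2))"
  obtain C1 where C1: "\<And>x. x > 0 \<Longrightarrow> \<bar>prime_series_reg x - (\<Sum>i<n. (- x) ^ i / fact i * moment_limit i)\<bar> \<le> C1 * x ^ n"
    using prime_series_reg_expansion[of k] unfolding n_def by blast
  have "\<exists>C. \<forall>x. 0 < x \<longrightarrow> x \<le> 1 / 2 \<longrightarrow>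
    norm (regular_part (1 + of_real x) - (\<Sum>i<n. (deriv ^^ i) regular_part 1 / fact i * of_real x ^ i)) \<le> C * x ^ n"
    unfolding n_def by (rule holomorphic_taylor_bound[OF regular_part_holomorphic]) auto
  then obtain C2 where C2: "\<And>x. 0 < x \<Longrightarrow> x \<le> 1 / 2 \<Longrightarrow>
    norm (regular_part (1 + of_real x) - (\<Sum>i<n. (deriv ^^ i) regular_part 1 / fact i * of_real x ^ i)) \<le> C2 * x ^ n" by blast
  have "\<bar>\<Sum>i<n. a i * x ^ i\<bar> \<le> (C1 + C2 + 2 ^ n + (3 / 2) ^ n) * x ^ n" if x: "0 < x" "x \<le> 1 / 2" for x
  proof -
    have re: "\<bar>Re (regular_part (1 + of_real x)) - (\<Sum>i<n. regular_coeff i * x ^ i)\<bar> \<le> C2 * x ^ n"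
    proof -
      have "Re (\<Sum>i<n. (deriv ^^ i) regular_part 1 / fact i * of_real x ^ i) = (\<Sum>i<n. regular_coeff i * x ^ i)"
        unfolding Re_sum regular_coeff_def
        by (intro sum.cong refl) (simp only: of_real_power[symmetric] times_complex.sel Re_complex_of_real Im_complex_of_real mult_zero_right diff_zero)
      then show ?thesis
        using abs_Re_le_cmod[of "regular_part (1 + of_real x) - (\<Sum>i<n. (deriv ^^ i) regular_part 1 / fact i * of_real x ^ i)"] C2[OF x] by simp
    qed
    have g2: "\<bar>1 / (1 + 2 * x) - (\<Sum>i<n. (- 2) ^ i * x ^ i)\<bar> \<le> 2 ^ n * x ^ n"
      using geometric_expansion[of 2 x n] x by (simp only: power_mult_distrib)
    have g3: "\<bar>1 / (2 + 3 * x) - (\<Sum>i<n. (- (3 / 2)) ^ i / 2 * x ^ i)\<bar> \<le> (3 / 2) ^ n * x ^ n"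
    proof -
      have "1 / (2 + 3 * x) - (\<Sum>i<n. (- (3 / 2)) ^ i / 2 * x ^ i) = (1 / (1 + 3 / 2 * x) - (\<Sum>i<n. (- (3 / 2) * x) ^ i)) / 2"
      proof -
        have "1 / (2 + 3 * x) = 1 / (1 + 3 / 2 * x) / 2" using x by (simp add: field_simps)
        moreover have "(\<Sum>i<n. (- (3 / 2)) ^ i / 2 * x ^ i) = (\<Sum>i<n. (- (3 / 2) * x) ^ i) / 2"
          unfolding sum_divide_distrib power_mult_distrib by (intro sum.cong) auto
        ultimately show ?thesis by (simp only: diff_divide_distrib)
      qed
      also have "\<bar>\<dots>\<bar> \<le> \<bar>1 / (1 + 3 / 2 * x) - (\<Sum>i<n. (- (3 / 2) * x) ^ i)\<bar>" by simp
      also have "\<dots> \<le> (3 / 2) ^ n * x ^ n" using x by (intro geometric_expansion) auto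
      finally show ?thesis .
    qed
    have "(\<Sum>i<n. a i * x ^ i) = (\<Sum>i<n. (- x) ^ i / fact i * moment_limit i)
      - ((\<Sum>i<n. regular_coeff i * x ^ i) - (\<Sum>i<n. (- 2) ^ i * x ^ i) - (\<Sum>i<n. (- (3 / 2)) ^ i / 2 * x ^ i))"
      unfolding sum_subtractf[symmetric]
    proof (intro sum.cong refl)
      fix i
      have "(- x) ^ i = (- 1) ^ i * x ^ i" by (rule power_minus)
      then show "a i * x ^ i = (- x) ^ i / fact i * moment_limit i - (regular_coeff i * x ^ i - (- 2) ^ i * x ^ i - (- (3 / 2)) ^ i / 2 * x ^ i)"
        unfolding a_def by (simp only:) (simp add: algebra_simps)
    qed
    moreover have "(C1 + C2 + 2 ^ n + (3 / 2) ^ n) * x ^ n = C1 * x ^ n + C2 * x ^ n + 2 ^ n * x ^ n + (3 / 2) ^ n * x ^ n"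
      by (simp only: distrib_right)
    ultimately show ?thesis
      using C1[OF x(1)] re g2 g3 unfolding prime_series_reg_eq[OF x(1)] by linarith
  qed
  then have "a k = 0" by (intro small_polynomial_zero[where d = "1 / 2" and n = n]) (auto simp: n_def)
  then have "(- 1) ^ k * moment_limit k = fact k * (regular_coeff k - (- 2) ^ k - (- (3 / 2)) ^ k / 2)"
    by (simp add: a_def field_simps)
  then have "(- 1) ^ k * ((- 1) ^ k * moment_limit k) = (- 1) ^ k * (fact k * (regular_coeff k - (- 2) ^ k - (- (3 / 2)) ^ k / 2))" by simp
  moreover have "(- 1) ^ k * ((- 1) ^ k * y) = y" for y :: real by (simp add: power_mult_distrib[symmetric] mult.assoc[symmetric])
  moreover have "(- 2) ^ k = (- 1) ^ k * (2::real) ^ k" "(- (3 / 2)) ^ k = (- 1) ^ k * (3 / 2 :: real) ^ k" by (rule power_minus)+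
  ultimately have "moment_limit k = (- 1) ^ k * (fact k * regular_coeff k) - (- 1) ^ k * ((- 1) ^ k * (fact k * 2 ^ k)) - (- 1) ^ k * ((- 1) ^ k * (fact k * ((3 / 2) ^ k / 2)))"
    by (simp add: right_diff_distrib mult_ac)
  also have "\<dots> = - fact k * (2 ^ k + (3 / 2) ^ k / 2) + (- 1) ^ k * fact k * regular_coeff k"
    unfolding \<open>\<And>y. (- 1) ^ k * ((- 1) ^ k * y) = y\<close> by (simp add: algebra_simps)
  finally show ?thesis .
qed

text \<open>Cauchy's estimate on a closed disc of radius 69/100, inside the disc of holomorphy but
  still larger than 2/3, so that \<open>100 / 69 < 3 / 2\<close> and the coefficients lose against
  \<open>(3 / 2) ^ k\<close>.\<close>

lemma regular_coeff_bound: "\<exists>B. \<forall>k. \<bar>regular_coeff k\<bar> \<le> B * (100 / 69) ^ k"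
proof -
  define r :: real where "r = 69 / 100"
  have sub: "cball 1 r \<subseteq> ball (1::complex) (7 / 10)" by (auto simp: r_def)
  have cont: "continuous_on (cball 1 r) regular_part"
    by (intro holomorphic_on_imp_continuous_on holomorphic_on_subset[OF regular_part_holomorphic sub])
  then have "bounded (regular_part ` cball 1 r)" by (intro compact_imp_bounded compact_continuous_image) auto
  then obtain B where B: "\<And>w. w \<in> cball 1 r \<Longrightarrow> norm (regular_part w) \<le> B" unfolding bounded_iff by blast
  have "\<bar>regular_coeff k\<bar> \<le> B * (100 / 69) ^ k" for k
  proof -
    have "norm ((deriv ^^ k) regular_part 1) \<le> fact k * B / r ^ k"
    proof (rule Cauchy_inequality[OF _ cont])
      show "regular_part holomorphic_on ball 1 r"
        by (rule holomorphic_on_subset[OF regular_part_holomorphic]) (auto simp: r_def)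
    qed (use B in \<open>auto simp: r_def dist_norm\<close>)
    then have "norm ((deriv ^^ k) regular_part 1 / fact k) \<le> B / r ^ k" by (simp add: norm_divide field_simps)
    moreover have "B / r ^ k = B * (100 / 69) ^ k" by (simp add: r_def power_divide)
    ultimately show ?thesis unfolding regular_coeff_def using abs_Re_le_cmod order.trans by metis
  qed
  then show ?thesis by blast
qed

text \<open>Dividing \<open>2^k + (3/2)^k / 2\<close> by \<open>2^k\<close> for
  \<open>k = j - 1\<close> leaves \<open>1 + (3/4)^(j-1) / 2\<close>, and
  \<open>(3/4)^(j-1) / 2 = (2/3) (3/4)^j\<close>.\<close>

lemma alpha_asymptotics:
  obtains e :: "nat \<Rightarrow> real" where "e \<longlonglongrightarrow> 0"
    "\<And>j. j \<ge> 1 \<Longrightarrow> alpha j = fact j * 2 ^ j / (2 * real j ^ 2) * (1 + (2 / 3 + e j) * (3 / 4) ^ j)"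
proof -
  \<comment> \<open>The contribution of \<open>regular_part\<close> divided by
    \<open>(3/4)^j\<close> times the leading term, which leaves the factor
    \<open>2 * (2/3)^j\<close>. By the Cauchy bound it is \<open>O((200/207)^j)\<close>.\<close>
  define e where "e = (\<lambda>j. - ((- 1) ^ (j - 1)) * 2 * (2 / 3) ^ j * regular_coeff (j - 1))"
  obtain B where B: "\<And>k. \<bar>regular_coeff k\<bar> \<le> B * (100 / 69) ^ k" using regular_coeff_bound by blast
  have "B \<ge> 0" using B[of 0] by (simp add: order.trans[OF abs_ge_zero])
  show ?thesis
  proof
    show "e \<longlonglongrightarrow> 0"
    proof (rule Lim_null_comparison)
      show "\<forall>\<^sub>F j in sequentially. norm (e j) \<le> 2 * B * (200 / 207) ^ j"
      proof (rule always_eventually, rule allI)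
        fix j
        have "norm (e j) = 2 * (2 / 3) ^ j * \<bar>regular_coeff (j - 1)\<bar>" by (simp add: e_def abs_mult power_abs)
        also have "\<dots> \<le> 2 * (2 / 3) ^ j * (B * (100 / 69) ^ (j - 1))" by (intro mult_left_mono B) auto
        also have "\<dots> \<le> 2 * (2 / 3) ^ j * (B * (100 / 69) ^ j)"
          using \<open>B \<ge> 0\<close> by (intro mult_left_mono power_increasing) auto
        also have "\<dots> = 2 * B * ((2 / 3) * (100 / 69)) ^ j" by (simp only: power_mult_distrib) simp
        finally show "norm (e j) \<le> 2 * B * (200 / 207) ^ j" by simp
      qed
      have "(\<lambda>j. 2 * B * (200 / 207) ^ j) \<longlonglongrightarrow> 2 * B * 0" by (intro tendsto_intros LIMSEQ_power_zero) auto
      then show "(\<lambda>j. 2 * B * (200 / 207) ^ j) \<longlonglongrightarrow> 0" by simp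
    qed
    fix j :: nat assume "j \<ge> 1"
    then obtain k where j: "j = Suc k" by (cases j) auto
    have p: "(3 / 4 :: real) ^ k * 2 ^ k = (3 / 2) ^ k" "(2 / 3 :: real) ^ k * (3 / 4) ^ k * 2 ^ k = 1"
      by (simp_all flip: power_mult_distrib)
    define s where "s = (- 1 :: real) ^ k * regular_coeff k"
    have "2 ^ j * (1 + (2 / 3 + e j) * (3 / 4) ^ j) = 2 * (2 ^ k + ((3 / 4) ^ k * 2 ^ k) / 2 - ((2 / 3) ^ k * (3 / 4) ^ k * 2 ^ k) * s)"
      by (simp add: j e_def s_def algebra_simps)
    also have "\<dots> = 2 * (2 ^ k + (3 / 2) ^ k / 2 - s)" unfolding p by simp
    finally have *: "2 ^ j * (1 + (2 / 3 + e j) * (3 / 4) ^ j) = 2 * (2 ^ k + (3 / 2) ^ k / 2 - s)" .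
    have "fact j * 2 ^ j / (2 * real j ^ 2) * (1 + (2 / 3 + e j) * (3 / 4) ^ j) = fact j / (2 * real j ^ 2) * (2 ^ j * (1 + (2 / 3 + e j) * (3 / 4) ^ j))"
      by simp
    also have "\<dots> = fact k / real j * (2 ^ k + (3 / 2) ^ k / 2 - s)"
    proof -
      have "fact j / (2 * real j ^ 2) * (2 * A) = fact k / real j * A" for A :: real
        by (simp add: j power2_eq_square del: of_nat_Suc)
      then show ?thesis unfolding * .
    qed
    also have "\<dots> = alpha j"
    proof -
      have "moment_limit k = - (fact k * (2 ^ k + (3 / 2) ^ k / 2 - s))"
        unfolding moment_limit_eq s_def by (simp add: algebra_simps)
      then show ?thesis using alpha_eq_moment_limit[OF \<open>j \<ge> 1\<close>] by (simp add: j)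
    qed
    finally show "alpha j = fact j * 2 ^ j / (2 * real j ^ 2) * (1 + (2 / 3 + e j) * (3 / 4) ^ j)" by simp
  qed
qed

text \<open>Exponential decay beats \<open>j^(-m)\<close>. A convergent sequence is bounded at all
  indices, so a single constant serves every \<open>j \<ge> 1\<close>.\<close>

lemma geometric_le_inverse_power:
  fixes q :: real
  assumes q: "0 < q" "q < 1" and e: "e \<longlonglongrightarrow> (0::real)"
  shows "\<exists>C. \<forall>j\<ge>1. \<bar>(2 / 3 + e j) * q ^ j\<bar> \<le> C * real j powi (- int m)"
proof -
  define c where "c = - ln q"
  have c: "c > 0" using q by (simp add: c_def)
  have "(\<lambda>j. (c * real j) ^ m / exp (c * real j) / c ^ m) \<longlonglongrightarrow> 0 / c ^ m"
    using c by (intro tendsto_divide tendsto_const filterlim_compose[OF tendsto_power_div_exp_0]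
        filterlim_tendsto_pos_mult_at_top[OF tendsto_const] filterlim_real_sequentially) auto
  moreover have "(c * real j) ^ m / exp (c * real j) / c ^ m = real j ^ m * q ^ j" for j
  proof -
    have "exp (- (c * real j)) = q ^ j" using q by (simp add: c_def mult.commute[of "ln q"] exp_of_nat_mult)
    then show ?thesis using c by (simp add: power_mult_distrib exp_minus divide_inverse)
  qed
  ultimately have "(\<lambda>j. real j ^ m * q ^ j) \<longlonglongrightarrow> 0" by simp
  then have "(\<lambda>j. (2 / 3 + e j) * (real j ^ m * q ^ j)) \<longlonglongrightarrow> (2 / 3 + 0) * 0" by (intro tendsto_intros e)
  then have "Bseq (\<lambda>j. (2 / 3 + e j) * (real j ^ m * q ^ j))" by (intro convergent_imp_Bseq) (auto simp: convergent_def)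
  then obtain C where C: "\<And>j. norm ((2 / 3 + e j) * (real j ^ m * q ^ j)) \<le> C" by (auto simp: Bseq_def)
  have "\<bar>(2 / 3 + e j) * q ^ j\<bar> \<le> C * real j powi (- int m)" if "j \<ge> 1" for j
  proof -
    have "\<bar>(2 / 3 + e j) * q ^ j\<bar> * real j ^ m \<le> C" using C[of j] by (simp add: abs_mult mult_ac)
    then have "\<bar>(2 / 3 + e j) * q ^ j\<bar> \<le> C / real j ^ m" using that by (simp add: pos_le_divide_eq)
    then show ?thesis by (simp only: power_int_minus power_int_of_nat divide_inverse)
  qed
  then show ?thesis by blast
qed

theorem theorem1p1:
  "(\<forall>m::nat. \<exists>C::real. \<forall>j::nat. j \<ge> 1 \<longrightarrow>
      (\<exists>E::real. alpha j = fact j * 2 ^ j / (2 * real j ^ 2) * (1 + E)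
               \<and> \<bar>E\<bar> \<le> C * real j powi (- int m)))
   \<and> (riemann_hypothesis \<longrightarrow>
      (\<exists>e::nat \<Rightarrow> real. e \<longlonglongrightarrow> 0 \<and>
        (\<forall>j\<ge>1. alpha j = fact j * 2 ^ j / (2 * real j ^ 2) * (1 + (2 / 3 + e j) * (3 / 4) ^ j))))"
proof -
  obtain e :: "nat \<Rightarrow> real" where e: "e \<longlonglongrightarrow> 0"
    and alpha: "\<And>j. j \<ge> 1 \<Longrightarrow> alpha j = fact j * 2 ^ j / (2 * real j ^ 2) * (1 + (2 / 3 + e j) * (3 / 4) ^ j)"
    using alpha_asymptotics by blast
  show ?thesis
  proof (intro conjI impI allI)
    fix m
    \<comment> \<open>The relative error \<open>E\<close> is the whole secondary term
      \<open>(2/3 + e j) * (3/4)^j\<close>.\<close>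
    obtain C where "\<forall>j\<ge>1. \<bar>(2 / 3 + e j) * (3 / 4) ^ j\<bar> \<le> C * real j powi (- int m)"
      using geometric_le_inverse_power[OF _ _ e, of "3 / 4" m] by auto
    then show "\<exists>C::real. \<forall>j::nat. j \<ge> 1 \<longrightarrow> (\<exists>E::real. alpha j = fact j * 2 ^ j / (2 * real j ^ 2) * (1 + E)
               \<and> \<bar>E\<bar> \<le> C * real j powi (- int m))"
      using alpha by blast
  next
    show "\<exists>e::nat \<Rightarrow> real. e \<longlonglongrightarrow> 0 \<and>
        (\<forall>j\<ge>1. alpha j = fact j * 2 ^ j / (2 * real j ^ 2) * (1 + (2 / 3 + e j) * (3 / 4) ^ j))"
      using e alpha by blast
  qed
qed

end
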